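(* Let $\mathbb{F}$ be a subfield of a local field of characteristic different from $2$, equipped with the topology inherited from that local field, and let $n\in\mathbb{N}$. Then the topological group $\mathrm{SL}(n,\mathbb{F})$ is minimal if and only if the topological group $\mathrm{ST}^+(n,\mathbb{F})$ is minimal.
   Context: All topological groups are Hausdorff. A local field is a non-discrete locally compact topological field. For a topological field $\mathbb{F}$, $\mathrm{SL}(n,\mathbb{F})$ denotes the special linear group of degree $n$ over $\mathbb{F}$ (matrices of determinant $1$) with the topology inherited from $\mathbb{F}^{n^2}$, and $\mathrm{ST}^+(n,\mathbb{F})$ denotes its topological subgroup consisting of the upper triangular matrices. A topological group $G$ is minimal if every continuous group isomorphism $f\colon G\to H$ onto a (Hausdorff) topological group $H$ is a topological isomorphism; equivalently, if $G$ admits no strictly coarser Hausdorff group topology. *)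

theory Defs
  imports
    "HOL-Analysis.Analysis"
    "HOL-Algebra.Group"
begin

section \<open>Topological fields and local fields\<close>

class topological_field =
  field + t2_space + topological_ab_group_add + topological_semigroup_mult +
  assumes tendsto_inverse_at: "a \<noteq> 0 \<Longrightarrow> filterlim inverse (nhds (inverse a)) (at a)"

class local_field = topological_field +
  assumes nondiscrete: "\<exists>x. \<not> open {x}"
    and locally_compact: "\<exists>U K. open U \<and> compact K \<and> x \<in> U \<and> U \<subseteq> K"

lemma locally_compact_space_local_field:
  "locally_compact_space (euclidean :: 'a :: local_field topology)"
  using locally_compact by (auto simp: locally_compact_space_def)

instance local_field \<subseteq> perfect_space
proof
  fix y :: 'a
  show "\<not> open {y}"
  proof
    assume y: "open {y}"
    have "open {x}" for x :: 'a
    proof -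
      have "continuous_on UNIV (\<lambda>z. z + (y - x))"
        unfolding continuous_on_def by (auto intro!: tendsto_add tendsto_ident_at tendsto_const)
      then have "open ((\<lambda>z. z + (y - x)) -` {y})"
        using y by (simp add: continuous_on_open_vimage)
      moreover have "(\<lambda>z. z + (y - x)) -` {y} = {x}"
        by (auto simp: algebra_simps)
      ultimately show ?thesis by simp
    qed
    then show False using nondiscrete by blast
  qed
qed

instance real :: local_field
proof
  show "filterlim inverse (nhds (inverse a)) (at a)" if "a \<noteq> 0" for a :: real
    using that by (intro tendsto_inverse tendsto_ident_at)
  show "\<exists>x::real. \<not> open {x}" by (simp add: not_open_singleton)
  show "\<exists>U K. open U \<and> compact K \<and> x \<in> U \<and> U \<subseteq> K" for x :: real
    by (rule exI[of _ "ball x 1"], rule exI[of _ "cball x 1"]) (auto intro: ball_subset_cball)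
qed

definition is_subfield :: "'a :: field set \<Rightarrow> bool" where
  "is_subfield F \<longleftrightarrow>
    0 \<in> F \<and> 1 \<in> F \<and> (\<forall>x\<in>F. \<forall>y\<in>F. x + y \<in> F \<and> x * y \<in> F) \<and>
    (\<forall>x\<in>F. - x \<in> F) \<and> (\<forall>x\<in>F. x \<noteq> 0 \<longrightarrow> inverse x \<in> F)"


section \<open>Minimal topological groups\<close>

definition topological_group :: "('g, 'm) monoid_scheme \<Rightarrow> 'g topology \<Rightarrow> bool" where
  "topological_group G T \<longleftrightarrow>
     group G \<and> topspace T = carrier G \<and> Hausdorff_space T \<and>
     continuous_map (prod_topology T T) T (\<lambda>(x, y). x \<otimes>\<^bsub>G\<^esub> y) \<and>
     continuous_map T T (\<lambda>x. inv\<^bsub>G\<^esub> x)"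

text \<open>The target groups below live on the same type as \<open>G\<close>; the lemma
  \<open>minimal_topological_groupD\<close> shows that this is no restriction.\<close>

definition minimal_topological_group :: "('g, 'm) monoid_scheme \<Rightarrow> 'g topology \<Rightarrow> bool" where
  "minimal_topological_group G T \<longleftrightarrow>
     topological_group G T \<and>
     (\<forall>(H :: 'g monoid) S f.
        topological_group H S \<and> f \<in> iso G H \<and> continuous_map T S f \<longrightarrow> homeomorphic_map T S f)"

lemma topological_group_pullback:
  assumes G: "group G" and H: "topological_group H S" and f: "f \<in> iso G H"
  shows "topological_group G (pullback_topology (carrier G) f S)"
    and "homeomorphic_map (pullback_topology (carrier G) f S) S f"
proof -
  let ?P = "pullback_topology (carrier G) f S"
  have grpH: "group H" and top: "topspace S = carrier H" and haus: "Hausdorff_space S"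
    and cm: "continuous_map (prod_topology S S) S (\<lambda>(x, y). x \<otimes>\<^bsub>H\<^esub> y)"
    and ci: "continuous_map S S (\<lambda>x. inv\<^bsub>H\<^esub> x)"
    using H by (auto simp: topological_group_def)
  interpret G: group G by fact
  interpret H: group H by fact
  have hom: "f \<in> hom G H" and bij: "bij_betw f (carrier G) (carrier H)"
    using f by (auto simp: iso_def)
  have hom_mult: "f (x \<otimes>\<^bsub>G\<^esub> y) = f x \<otimes>\<^bsub>H\<^esub> f y" if "x \<in> carrier G" "y \<in> carrier G" for x y
    using hom that by (auto simp: hom_def)
  have hom_inv: "f (inv\<^bsub>G\<^esub> x) = inv\<^bsub>H\<^esub> f x" if "x \<in> carrier G" for x
    using group_hom.hom_inv[of G H f] hom that G grpH
    by (simp add: group_hom_def group_hom_axioms_def)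
  have inj: "inj_on f (carrier G)" and img: "f ` carrier G = carrier H"
    using bij by (auto simp: bij_betw_def)
  have topP: "topspace ?P = carrier G"
    using img top by (auto simp: topspace_pullback_topology)
  have cf: "continuous_map ?P S f"
    using continuous_map_pullback[OF continuous_map_id, of "carrier G" f S] by simp
  have into: "continuous_map X ?P g"
    if "continuous_map X S (f \<circ> g)" "g \<in> topspace X \<rightarrow> carrier G" for X :: "'x topology" and g
    using that by (intro continuous_map_pullback') auto
  show homeo: "homeomorphic_map ?P S f"
  proof -
    let ?g = "inv_into (carrier G) f"
    have "continuous_map S ?P ?g"
    proof (rule into)
      show "continuous_map S S (f \<circ> ?g)"
        by (rule continuous_map_eq[OF continuous_map_id])
           (auto simp: top img f_inv_into_f)
      show "?g \<in> topspace S \<rightarrow> carrier G"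
        by (auto simp: top img[symmetric] inv_into_into)
    qed
    then have "homeomorphic_maps ?P S f ?g"
      using cf inj img by (auto simp: homeomorphic_maps_def topP top f_inv_into_f)
    then show ?thesis by (rule homeomorphic_maps_imp_map)
  qed
  have "Hausdorff_space ?P"
    using homeomorphic_Hausdorff_space haus homeo homeomorphic_map_imp_homeomorphic_space by blast
  moreover have "continuous_map (prod_topology ?P ?P) ?P (\<lambda>(x, y). x \<otimes>\<^bsub>G\<^esub> y)"
  proof (rule into)
    have "continuous_map (prod_topology ?P ?P) (prod_topology S S) (\<lambda>(x, y). (f x, f y))"
      using cf by (auto simp: continuous_map_prod_top)
    from continuous_map_compose[OF this cm]
    show "continuous_map (prod_topology ?P ?P) S (f \<circ> (\<lambda>(x, y). x \<otimes>\<^bsub>G\<^esub> y))"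
      by (rule continuous_map_eq) (auto simp: topP hom_mult)
    show "(\<lambda>(x, y). x \<otimes>\<^bsub>G\<^esub> y) \<in> topspace (prod_topology ?P ?P) \<rightarrow> carrier G"
      by (auto simp: topP)
  qed
  moreover have "continuous_map ?P ?P (\<lambda>x. inv\<^bsub>G\<^esub> x)"
  proof (rule into)
    from continuous_map_compose[OF cf ci]
    show "continuous_map ?P S (f \<circ> (\<lambda>x. inv\<^bsub>G\<^esub> x))"
      by (rule continuous_map_eq) (auto simp: topP hom_inv)
  qed (auto simp: topP)
  ultimately show "topological_group G ?P"
    using G topP by (simp add: topological_group_def)
qed

lemma topological_group_truncate [simp]:
  "topological_group (monoid.truncate G) T \<longleftrightarrow> topological_group G T"
proof -
  let ?G = "monoid.truncate G"
  have [simp]: "carrier ?G = carrier G" "monoid.mult ?G = monoid.mult G" "one ?G = one G"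
    by (simp_all add: monoid.truncate_def)
  have "group ?G = group G"
    by (simp only: group_def monoid_def group_axioms_def Units_def) simp
  moreover have "m_inv ?G x = m_inv G x" for x
    by (simp add: m_inv_def)
  ultimately show ?thesis
    by (simp add: topological_group_def)
qed

lemma coarser_imp_homeo:
  assumes G: "topological_group G T"
    and min: "\<And>S. topological_group G S \<Longrightarrow> \<forall>U. openin S U \<longrightarrow> openin T U \<Longrightarrow> S = T"
    and H: "topological_group H S" and f: "f \<in> iso G H" and c: "continuous_map T S f"
  shows "homeomorphic_map T S f"
proof -
  have grp: "group G" and top: "topspace T = carrier G"
    using G by (auto simp: topological_group_def)
  have "\<forall>U. openin (pullback_topology (carrier G) f S) U \<longrightarrow> openin T U"
    using c by (auto simp: openin_pullback_topology continuous_map_alt top)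
  then have "pullback_topology (carrier G) f S = T"
    by (intro min topological_group_pullback[OF grp H f])
  then show ?thesis
    using topological_group_pullback(2)[OF grp H f] by simp
qed

lemma minimal_topological_group_iff_coarser:
  "minimal_topological_group G T \<longleftrightarrow>
     topological_group G T \<and>
     (\<forall>S. topological_group G S \<and> (\<forall>U. openin S U \<longrightarrow> openin T U) \<longrightarrow> S = T)"
proof (intro iffI conjI allI impI)
  assume G: "minimal_topological_group G T"
  then show tG: "topological_group G T" by (simp add: minimal_topological_group_def)
  fix S assume S: "topological_group G S \<and> (\<forall>U. openin S U \<longrightarrow> openin T U)"
  let ?H = "monoid.truncate G"
  have tops: "topspace S = carrier G" "topspace T = carrier G"
    using S tG by (auto simp: topological_group_def)
  have "continuous_map T S id"
  proof -
    have "{x \<in> carrier G. x \<in> U} = U" if "openin S U" for U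
      using openin_subset[OF that] tops by auto
    then show ?thesis
      using S tops by (simp add: continuous_map_def)
  qed
  moreover have "id \<in> iso G ?H"
    by (auto simp: iso_def hom_def monoid.truncate_def)
  moreover have "topological_group ?H S" using S by simp
  ultimately have "homeomorphic_map T S id"
    using G unfolding minimal_topological_group_def by blast
  then show "S = T" by (simp add: homeomorphic_map_id)
next
  assume *: "topological_group G T \<and>
     (\<forall>S. topological_group G S \<and> (\<forall>U. openin S U \<longrightarrow> openin T U) \<longrightarrow> S = T)"
  show "minimal_topological_group G T"
    unfolding minimal_topological_group_def
  proof (intro conjI allI impI)
    show "topological_group G T" using * by simp
    fix H :: "'a monoid" and S f
    assume "topological_group H S \<and> f \<in> iso G H \<and> continuous_map T S f"
    then show "homeomorphic_map T S f" using * by (intro coarser_imp_homeo[of G T H S f]) auto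
  qed
qed

lemma minimal_topological_groupD:
  fixes G :: "('g, 'm) monoid_scheme" and H :: "('h, 'k) monoid_scheme"
  assumes "minimal_topological_group G T" "topological_group H S"
    and "f \<in> iso G H" "continuous_map T S f"
  shows "homeomorphic_map T S f"
  using assms unfolding minimal_topological_group_iff_coarser
  by (intro coarser_imp_homeo[of G T H S f]) auto


section \<open>The matrix groups\<close>

definition SL :: "'a :: field set \<Rightarrow> ('a ^ 'n ^ 'n) monoid" where
  "SL F = \<lparr>carrier = {A. (\<forall>i j. A $ i $ j \<in> F) \<and> det A = 1},
     monoid.mult = (**), one = mat 1\<rparr>"

text \<open>The rows and columns are indexed by a finite total order, for which the library uses
  the sort \<open>{finite, wellorder}\<close>: on a finite type every total order is a well-order.
  Both groups carry the subspace topology of \<open>'a ^ 'n ^ 'n\<close>, i.e. of the product topology.\<close>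

definition ST_plus ::
  "'a :: field set \<Rightarrow> ('a ^ 'n :: {finite, wellorder} ^ 'n :: {finite, wellorder}) monoid" where
  "ST_plus F = (SL F)\<lparr>carrier := {A \<in> carrier (SL F). \<forall>i j. j < i \<longrightarrow> A $ i $ j = 0}\<rparr>"

lemma matrix_inv_det_1:
  fixes A :: "'a :: field ^ 'n ^ 'n"
  assumes "det A = 1"
  shows "A ** matrix_inv A = mat 1" "matrix_inv A ** A = mat 1"
    and "matrix_inv A $ k $ l = det (\<chi> i j. if j = k then axis l 1 $ i else A $ i $ j)"
proof -
  have "invertible A" using assms by (simp add: invertible_det_nz)
  then have "A ** matrix_inv A = mat 1 \<and> matrix_inv A ** A = mat 1"
    unfolding invertible_def matrix_inv_def by (rule someI_ex)
  then show *: "A ** matrix_inv A = mat 1" "matrix_inv A ** A = mat 1"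
    by simp_all
  have col: "(M *v axis l 1) $ k = M $ k $ l" for M :: "'a ^ 'n ^ 'n"
    by (simp add: matrix_vector_mult_def axis_def if_distrib cong: if_cong)
  have "A *v (matrix_inv A *v axis l 1) = axis l 1"
    by (simp add: matrix_vector_mul_assoc *)
  then have "matrix_inv A *v axis l 1
      = (\<chi> k. det (\<chi> i j. if j = k then axis l 1 $ i else A $ i $ j) / det A)"
    using assms by (subst (asm) cramer) auto
  then have "(matrix_inv A *v axis l 1) $ k = det (\<chi> i j. if j = k then axis l 1 $ i else A $ i $ j)"
    using assms by simp
  then show "matrix_inv A $ k $ l = det (\<chi> i j. if j = k then axis l 1 $ i else A $ i $ j)"
    by (simp add: col)
qed

lemma det_in_subfield:
  fixes A :: "'a :: field ^ 'n ^ 'n"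
  assumes F: "is_subfield F" and A: "\<And>i j. A $ i $ j \<in> F"
  shows "det A \<in> F"
proof -
  note F' = F[unfolded is_subfield_def]
  have "(\<Prod>i\<in>I. A $ i $ p i) \<in> F" if "finite I" for I p
    using that by (induction I rule: finite_induct) (use F' A in auto)
  then have "of_int (sign p) * (\<Prod>i\<in>UNIV. A $ i $ p i) \<in> F" for p
    using F' by (auto simp: sign_def)
  moreover have "sum g P \<in> F" if "finite P" "\<And>p. g p \<in> F" for g :: "('n \<Rightarrow> 'n) \<Rightarrow> 'a" and P
    using that by (induction P rule: finite_induct) (use F' in auto)
  ultimately show ?thesis unfolding det_def by (simp add: finite_permutations)
qed

lemma matrix_mult_in_subfield:
  fixes A B :: "'a :: field ^ 'n ^ 'n"
  assumes F: "is_subfield F"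
    and A: "\<And>i j. A $ i $ j \<in> F" and B: "\<And>i j. B $ i $ j \<in> F"
  shows "(A ** B) $ i $ j \<in> F"
proof -
  note F' = F[unfolded is_subfield_def]
  have "sum g I \<in> F" if "finite I" "\<And>p. g p \<in> F" for g :: "'n \<Rightarrow> 'a" and I
    using that by (induction I rule: finite_induct) (use F' in auto)
  then show ?thesis using A B F' by (simp add: matrix_matrix_mult_def)
qed

lemma upper_triangular_matrix_inv:
  fixes A :: "'a :: field ^ 'n :: {finite, wellorder} ^ 'n :: {finite, wellorder}"
  assumes A: "\<forall>i j. j < i \<longrightarrow> A $ i $ j = 0" and det: "det A = 1"
  shows "j < i \<Longrightarrow> matrix_inv A $ i $ j = 0"
proof -
  let ?B = "matrix_inv A"
  have diag: "A $ i $ i \<noteq> 0" for i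
  proof -
    have "det A = (\<Prod>i\<in>UNIV. A $ i $ i)"
      using A by (intro det_upperdiagonal) auto
    then show ?thesis using det prod_zero[of UNIV "\<lambda>i. A $ i $ i"] by auto
  qed
  have step: "\<forall>j. j < i \<longrightarrow> ?B $ i $ j = 0" if IH: "\<And>k. i < k \<Longrightarrow> \<forall>j. j < k \<longrightarrow> ?B $ k $ j = 0" for i
  proof (intro allI impI)
    fix j assume j: "j < i"
    have "0 = (A ** ?B) $ i $ j"
      using j by (simp add: matrix_inv_det_1[OF det] mat_def)
    also have "\<dots> = (\<Sum>k\<in>UNIV. A $ i $ k * ?B $ k $ j)"
      by (simp add: matrix_matrix_mult_def)
    also have "\<dots> = (\<Sum>k\<in>UNIV. if k = i then A $ i $ i * ?B $ i $ j else 0)"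
    proof (intro sum.cong refl)
      fix k :: 'n
      consider "k < i" | "k = i" | "i < k" by force
      then show "A $ i $ k * ?B $ k $ j = (if k = i then A $ i $ i * ?B $ i $ j else 0)"
        using A IH[of k] j by cases auto
    qed
    finally show "?B $ i $ j = 0" using diag by simp
  qed
  have "wf ({(x, y). (y :: 'n) < x} :: 'n rel)"
    by (rule finite_acyclic_wf) (auto intro!: acyclicI_order[where f = id])
  then have "\<forall>j. j < i \<longrightarrow> ?B $ i $ j = 0"
    by (induction i rule: wf_induct_rule) (rule step, simp)
  then show "j < i \<Longrightarrow> ?B $ i $ j = 0" by blast
qed

lemma SL_sel [simp]:
  "carrier (SL F) = {A. (\<forall>i j. A $ i $ j \<in> F) \<and> det A = 1}"
  "monoid.mult (SL F) = (**)" "one (SL F) = mat 1"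
  by (simp_all add: SL_def)

lemma ST_plus_sel [simp]:
  "carrier (ST_plus F) = {A \<in> carrier (SL F). \<forall>i j. j < i \<longrightarrow> A $ i $ j = 0}"
  "monoid.mult (ST_plus F) = (**)" "one (ST_plus F) = mat 1"
  by (simp_all add: ST_plus_def)

lemma continuous_on_det [continuous_intros]:
  fixes M :: "'x :: topological_space \<Rightarrow> 'a :: topological_field ^ 'n ^ 'n"
  assumes "\<And>i j. continuous_on S (\<lambda>x. M x $ i $ j)"
  shows "continuous_on S (\<lambda>x. det (M x))"
proof -
  have "continuous_on S (\<lambda>x. \<Prod>i\<in>I. M x $ i $ p i)" if "finite I" for I p
    using that
    by (induction I rule: finite_induct)
       (use assms in \<open>auto simp: continuous_on_def intro!: tendsto_mult tendsto_const\<close>)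
  then show ?thesis
    unfolding det_def
    by (auto simp: continuous_on_def intro!: tendsto_sum tendsto_mult tendsto_const)
qed

lemma Hausdorff_space_matrix:
  "Hausdorff_space (euclidean :: ('a :: t2_space ^ 'n ^ 'm) topology)"
  unfolding Hausdorff_space_def
proof (intro allI impI)
  fix A B :: "'a ^ 'n ^ 'm"
  assume "A \<in> topspace euclidean \<and> B \<in> topspace euclidean \<and> A \<noteq> B"
  then obtain i j where ne: "A $ i $ j \<noteq> B $ i $ j"
    by (metis vec_eq_iff)
  obtain U V where UV: "open U" "open V" "A $ i $ j \<in> U" "B $ i $ j \<in> V" "U \<inter> V = {}"
    using hausdorff[OF ne] by metis
  let ?pre = "\<lambda>W. (\<lambda>M :: 'a ^ 'n ^ 'm. M $ i) -` (\<lambda>v. v $ j) -` W"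
  have pre: "open (?pre U)" "open (?pre V)"
    by (intro open_vimage_vec_nth UV(1,2))+
  show "\<exists>U V. openin euclidean U \<and> openin euclidean V \<and> A \<in> U \<and> B \<in> V \<and> disjnt U V"
  proof (rule exI[of _ "?pre U"], rule exI[of _ "?pre V"], intro conjI)
    show "disjnt (?pre U) (?pre V)"
      using UV(5) by (auto simp: disjnt_iff)
  qed (use UV pre in \<open>simp_all only: open_openin[symmetric] vimage_eq\<close>)
qed

lemma topological_group_matrix:
  fixes G :: "('a :: topological_field ^ 'n ^ 'n) monoid"
  assumes grp: "\<And>A B. A \<in> carrier G \<Longrightarrow> B \<in> carrier G \<Longrightarrow> A ** B \<in> carrier G"
    "mat 1 \<in> carrier G" "\<And>A. A \<in> carrier G \<Longrightarrow> matrix_inv A \<in> carrier G"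
    and det: "\<And>A. A \<in> carrier G \<Longrightarrow> det A = 1"
    and [simp]: "monoid.mult G = (**)" "one G = mat 1"
  shows "topological_group G (top_of_set (carrier G))"
proof -
  have G: "group G"
  proof (rule groupI)
    show "\<exists>y\<in>carrier G. y \<otimes>\<^bsub>G\<^esub> x = \<one>\<^bsub>G\<^esub>" if "x \<in> carrier G" for x
      using that by (intro bexI[of _ "matrix_inv x"]) (simp_all add: grp matrix_inv_det_1 det)
  qed (use grp in \<open>auto simp: matrix_mul_assoc\<close>)
  then interpret G: group G .
  have inv: "inv\<^bsub>G\<^esub> A = matrix_inv A" if "A \<in> carrier G" for A
    using that grp(3) by (intro G.inv_equality) (auto simp: matrix_inv_det_1 det)
  have comp: "continuous_on S (\<lambda>x. g x $ i $ j)"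
    if "continuous_on S g" for S :: "'x :: topological_space set" and g :: "'x \<Rightarrow> 'a ^ 'n ^ 'n" and i j
    using that by (auto simp: continuous_on_def intro!: tendsto_vec_nth)
  have mk: "continuous_on S g" if "\<And>i j. continuous_on S (\<lambda>x. g x $ i $ j)"
    for S :: "'x :: topological_space set" and g :: "'x \<Rightarrow> 'a ^ 'n ^ 'n"
    using that by (auto simp: continuous_on_def intro!: vec_tendstoI)
  have sum_mult: "continuous_on S (\<lambda>x. \<Sum>k\<in>UNIV. g k x * h k x)"
    if "\<And>k. continuous_on S (g k)" "\<And>k. continuous_on S (h k)"
    for S :: "'x :: topological_space set" and g h :: "'n \<Rightarrow> 'x \<Rightarrow> 'a"
    using that by (auto simp: continuous_on_def intro!: tendsto_sum tendsto_mult)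
  have "continuous_on (carrier G \<times> carrier G) (\<lambda>(A, B). A ** B)"
  proof (rule mk)
    fix i j
    have "continuous_on (carrier G \<times> carrier G) (\<lambda>p. \<Sum>k\<in>UNIV. fst p $ i $ k * snd p $ k $ j)"
      by (intro sum_mult comp continuous_on_fst continuous_on_snd continuous_on_id)
    then show "continuous_on (carrier G \<times> carrier G) (\<lambda>p. (case p of (A, B) \<Rightarrow> A ** B) $ i $ j)"
      by (simp add: matrix_matrix_mult_def case_prod_beta)
  qed
  then have cm: "continuous_map (prod_topology (top_of_set (carrier G)) (top_of_set (carrier G)))
      (top_of_set (carrier G)) (\<lambda>(x, y). x \<otimes>\<^bsub>G\<^esub> y)"
    using grp(1) by (auto simp: continuous_map_in_subtopology prod_topology_subtopology
        subtopology_subtopology Times_Int_Times euclidean_product_topology)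
  have "continuous_on (carrier G) (\<lambda>A. det (\<chi> i j. if j = k then axis l 1 $ i else A $ i $ j))" for k l
  proof (rule continuous_on_det)
    fix i j
    show "continuous_on (carrier G)
        (\<lambda>A. (\<chi> i j. if j = k then axis l 1 $ i else A $ i $ j :: 'a ^ 'n ^ 'n) $ i $ j)"
      by (cases "j = k") (auto simp: comp intro!: continuous_on_const continuous_on_id)
  qed
  then have "continuous_on (carrier G) (\<lambda>A. matrix_inv A)"
    by (intro mk) (simp add: matrix_inv_det_1(3)[OF det] cong: continuous_on_cong)
  then have "continuous_on (carrier G) (\<lambda>A. inv\<^bsub>G\<^esub> A)"
    by (rule continuous_on_eq) (simp add: inv)
  then have "continuous_map (top_of_set (carrier G)) (top_of_set (carrier G)) (\<lambda>A. inv\<^bsub>G\<^esub> A)"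
    by (simp add: continuous_map_in_subtopology)
  then show ?thesis
    using cm G Hausdorff_space_subtopology[OF Hausdorff_space_matrix]
    by (simp add: topological_group_def)
qed

lemma mat_1_entry: "is_subfield F \<Longrightarrow> mat 1 $ i $ j \<in> F"
  by (simp add: mat_def is_subfield_def)

lemma mat_1_off_diagonal: "j < i \<Longrightarrow> mat 1 $ i $ j = 0" for i j :: "'n :: {finite, order}"
  by (auto simp: mat_def)

lemma SL_matrix_inv:
  fixes A :: "'a :: field ^ 'n ^ 'n"
  assumes F: "is_subfield F" and A: "A \<in> carrier (SL F)"
  shows "matrix_inv A \<in> carrier (SL F)"
proof -
  note F' = F[unfolded is_subfield_def]
  have det: "det A = 1" and AF: "A $ i $ j \<in> F" for i j
    using A by auto
  have "matrix_inv A $ k $ l \<in> F" for k l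
    unfolding matrix_inv_det_1(3)[OF det]
    by (rule det_in_subfield[OF F]) (use AF F' in \<open>simp add: axis_def\<close>)
  moreover have "det A * det (matrix_inv A) = 1"
    unfolding det_mul[symmetric] matrix_inv_det_1(1)[OF det] by simp
  ultimately show ?thesis using det by simp
qed

lemma topological_group_SL:
  fixes F :: "'a :: topological_field set"
  assumes F: "is_subfield F"
  shows "topological_group (SL F :: ('a ^ 'n ^ 'n) monoid) (top_of_set (carrier (SL F)))"
proof (rule topological_group_matrix)
  fix A B :: "'a ^ 'n ^ 'n"
  assume A: "A \<in> carrier (SL F)"
  then show "matrix_inv A \<in> carrier (SL F)" by (rule SL_matrix_inv[OF F])
  assume "B \<in> carrier (SL F)"
  with A show "A ** B \<in> carrier (SL F)"
    by (simp add: det_mul matrix_mult_in_subfield[OF F])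
qed (use mat_1_entry[OF F] in \<open>auto simp: mat_1_off_diagonal\<close>)

lemma topological_group_ST_plus:
  fixes F :: "'a :: topological_field set"
  assumes F: "is_subfield F"
  shows "topological_group (ST_plus F :: ('a ^ 'n :: {finite, wellorder} ^ 'n :: {finite, wellorder}) monoid)
    (top_of_set (carrier (ST_plus F)))"
proof (rule topological_group_matrix)
  have "group (SL F :: ('a ^ 'n :: {finite, wellorder} ^ 'n :: {finite, wellorder}) monoid)"
    using topological_group_SL[OF F] by (auto simp: topological_group_def)
  then interpret SL: group "SL F :: ('a ^ 'n :: {finite, wellorder} ^ 'n :: {finite, wellorder}) monoid" .
  fix A B :: "'a ^ 'n :: {finite, wellorder} ^ 'n :: {finite, wellorder}"
  assume A: "A \<in> carrier (ST_plus F)"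
  have "matrix_inv A \<in> carrier (SL F)"
    using A by (intro SL_matrix_inv[OF F]) simp
  then show "matrix_inv A \<in> carrier (ST_plus F)"
    using A upper_triangular_matrix_inv[of A] by simp
  assume B: "B \<in> carrier (ST_plus F)"
  have "(A ** B) $ i $ j = 0" if "j < i" for i j
  proof -
    have "A $ i $ k * B $ k $ j = 0" for k
      using A B that by (cases "k < i") auto
    then show ?thesis unfolding matrix_matrix_mult_def by (simp only: vec_lambda_beta sum.neutral_const)
  qed
  moreover have "A ** B \<in> carrier (SL F)"
    using A B SL.m_closed[of A B] by simp
  ultimately show "A ** B \<in> carrier (ST_plus F)"
    by simp
qed (use mat_1_entry[OF F] in \<open>auto simp: mat_1_off_diagonal\<close>)

end

theory Submission
  imports Defs
begin

text \<open>
  Let \<open>K\<close> be the local field and \<open>S\<close> a Hausdorff group topology on \<open>SL F\<close> or on the triangular group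
  \<open>ST_plus F\<close> that is coarser than the usual one. Both groups sit in the locally compact group
  \<open>SL UNIV\<close> over \<open>K\<close>, and \<open>S\<close> is studied through its \<^emph>\<open>residue\<close> there, the intersection of the
  closures of all \<open>S\<close>-neighbourhoods of the identity. The residue is normalised by the closure of the group,
  it meets the group trivially (\<open>residue_Int_H\<close>), and it meets trivially the closure of every subgroup on
  which \<open>S\<close> is already known to be the usual topology (\<open>residue_Int_closure\<close>). If some
  \<open>S\<close>-neighbourhood of the identity is relatively compact in \<open>SL UNIV\<close>, then \<open>S\<close> is the usual topology
  as soon as the residue is trivial (\<open>agree_of_compact\<close>). Each direction thus consists in finding a relatively
  compact neighbourhood and in showing that the residue is trivial. If \<open>F\<close> is finite or the matrices
  have size one, there is nothing to do.

  Suppose that \<open>ST_plus F\<close> is minimal. Then \<open>S\<close> is the usual topology on \<open>ST_plus F\<close>. Elimination with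
  pivots chosen according to size writes every matrix in \<open>SL F\<close> as a bounded matrix times a triangular one
  (\<open>bounded_triangularization\<close>); this replaces the compactness of the flag variety, and yields a
  relatively compact neighbourhood (\<open>bounded_of_factorization\<close>). The residue is normalised by the closure of
  \<open>SL F\<close> and contains no triangular matrix except the identity. For \<open>g\<close> in it, the Bruhat decomposition
  provides a torus whose elements fix both the standard flag and its image under \<open>g\<close>; the commutators of
  \<open>g\<close> with these are triangular, hence trivial, and this is possible only if \<open>g\<close> is triangular.

  Suppose that \<open>SL F\<close> is minimal. On the corner root group, conjugation by the torus multiplies by
  squares, and differences of squares of scalars near one fill a neighbourhood of zero because the
  characteristic is not two. This makes \<open>S\<close> the usual topology on that group
  (\<open>agree_corner\<close>). Commutators carry this over to the last column and the first row, and then show that an \<open>S\<close>-small triangular matrix is nearly scalar up to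
  its corner entry; the scalar is bounded since the determinant is one. This gives a relatively compact
  neighbourhood (\<open>bounded_neighbourhood\<close>). The same commutators show that the residue consists of scalar
  matrices \<open>z\<close> with \<open>z ^ n = 1\<close>. It is therefore a finite central subgroup in the closure of \<open>SL F\<close>
  that meets \<open>SL F\<close> trivially, and would yield a strictly coarser topology on \<open>SL F\<close> if it were nontrivial
  (\<open>minimal_subgroup_meets_finite_central\<close>).

  The analytic input, besides local compactness of \<open>K\<close>, is that inverses are small outside a compact
  set (\<open>inverse_near_0_outside_compact\<close>).
\<close>

section \<open>Group topologies\<close>

lemma topological_group_continuous_mult:
  fixes G (structure)
  assumes "topological_group G T" "continuous_map X T f" "continuous_map X T g"
  shows "continuous_map X T (\<lambda>x. f x \<otimes> g x)"
proof -
  have "continuous_map X (prod_topology T T) (\<lambda>x. (f x, g x))"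
    using assms(2,3) by (rule continuous_map_pairedI)
  moreover have "continuous_map (prod_topology T T) T (\<lambda>(x, y). x \<otimes> y)"
    using assms(1) unfolding topological_group_def by blast
  ultimately have "continuous_map X T ((\<lambda>(x, y). x \<otimes> y) \<circ> (\<lambda>x. (f x, g x)))"
    by (rule continuous_map_compose)
  then show ?thesis by (simp add: o_def)
qed

lemma topological_group_continuous_inv:
  fixes G (structure)
  assumes "topological_group G T" "continuous_map X T f"
  shows "continuous_map X T (\<lambda>x. inv f x)"
proof -
  have "continuous_map T T (\<lambda>x. inv x)"
    using assms(1) unfolding topological_group_def by blast
  from continuous_map_compose[OF assms(2) this] show ?thesis by (simp add: o_def)
qed

lemma topological_group_continuous_const:
  "topological_group G T \<Longrightarrow> a \<in> carrier G \<Longrightarrow> continuous_map X T (\<lambda>_. a)"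
  unfolding topological_group_def continuous_map_const by blast

lemmas topological_group_continuous =
  topological_group_continuous_mult topological_group_continuous_inv
  topological_group_continuous_const continuous_map_fst continuous_map_snd continuous_map_id[unfolded id_def]

lemma open_preimage:
  assumes "continuous_map T T' f" "openin T' U"
  shows "openin T {x \<in> topspace T. f x \<in> U}"
  using assms by (simp add: continuous_map_def)

lemma open_preimage_prod:
  assumes "continuous_map (prod_topology T1 T2) T' (\<lambda>p. f (fst p) (snd p))" "openin T' U"
    and "f a b \<in> U" "a \<in> topspace T1" "b \<in> topspace T2"
  obtains P Q where "openin T1 P" "openin T2 Q" "a \<in> P" "b \<in> Q"
    "\<And>p q. p \<in> P \<Longrightarrow> q \<in> Q \<Longrightarrow> f p q \<in> U"
proof -
  define W where "W = {x \<in> topspace (prod_topology T1 T2). f (fst x) (snd x) \<in> U}"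
  have "openin (prod_topology T1 T2) W"
    unfolding W_def using assms(1,2) by (rule open_preimage)
  moreover have "(a, b) \<in> W" using assms by (simp add: W_def)
  ultimately obtain P Q where "openin T1 P" "openin T2 Q" "a \<in> P" "b \<in> Q" and PQ: "P \<times> Q \<subseteq> W"
    by (elim openin_prod_topology_alt[THEN iffD1, THEN spec, THEN spec, THEN mp, elim_format] exE conjE)
  moreover have "f p q \<in> U" if "p \<in> P" "q \<in> Q" for p q
    using subsetD[OF PQ, of "(p, q)"] that by (simp add: W_def)
  ultimately show ?thesis using that by blast
qed

lemma openin_Int_Inter:
  "finite \<U> \<Longrightarrow> openin T V \<Longrightarrow> (\<And>U. U \<in> \<U> \<Longrightarrow> openin T U) \<Longrightarrow> openin T (V \<inter> \<Inter> \<U>)"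
  by (induction \<U> rule: finite_induct) (auto simp: Int_left_commute intro: openin_Int)

lemma closure_meets:
  assumes "h \<in> T closure_of Q" "openin T U" "h \<in> U"
  obtains q where "q \<in> Q" "q \<in> U"
  using assms unfolding in_closure_of by blast

lemma small_neighbourhood:
  fixes G (structure)
  assumes G: "topological_group G T" and U: "openin T U" "\<one> \<in> U"
  obtains V where "openin T V" "\<one> \<in> V"
    "\<And>x y. x \<in> V \<Longrightarrow> y \<in> V \<Longrightarrow> x \<otimes> y \<in> U"
    "\<And>x y. x \<in> V \<Longrightarrow> y \<in> V \<Longrightarrow> inv x \<otimes> y \<in> U"
    "\<And>x y. x \<in> V \<Longrightarrow> y \<in> V \<Longrightarrow> x \<otimes> inv y \<in> U"
proof -
  interpret group G using G by (simp add: topological_group_def)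
  have top: "topspace T = carrier G" using G by (simp add: topological_group_def)
  have one: "\<one> \<in> topspace T" using top by simp
  have "continuous_map (prod_topology T T) T (\<lambda>p. fst p \<otimes> snd p)"
    using G by (intro topological_group_continuous)
  moreover have "\<one> \<otimes> \<one> \<in> U" using U by simp
  ultimately obtain P1 Q1 where 1: "openin T P1" "openin T Q1" "\<one> \<in> P1" "\<one> \<in> Q1"
      "\<And>p q. p \<in> P1 \<Longrightarrow> q \<in> Q1 \<Longrightarrow> p \<otimes> q \<in> U"
    using open_preimage_prod[OF _ U(1) _ one one] by blast
  have "continuous_map (prod_topology T T) T (\<lambda>p. inv (fst p) \<otimes> snd p)"
    using G by (intro topological_group_continuous)
  moreover have "inv \<one> \<otimes> \<one> \<in> U" using U by simp
  ultimately obtain P2 Q2 where 2: "openin T P2" "openin T Q2" "\<one> \<in> P2" "\<one> \<in> Q2"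
      "\<And>p q. p \<in> P2 \<Longrightarrow> q \<in> Q2 \<Longrightarrow> inv p \<otimes> q \<in> U"
    using open_preimage_prod[where f = "\<lambda>p q. inv p \<otimes> q", OF _ U(1) _ one one] by blast
  have "continuous_map (prod_topology T T) T (\<lambda>p. fst p \<otimes> inv (snd p))"
    using G by (intro topological_group_continuous)
  moreover have "\<one> \<otimes> inv \<one> \<in> U" using U by simp
  ultimately obtain P3 Q3 where 3: "openin T P3" "openin T Q3" "\<one> \<in> P3" "\<one> \<in> Q3"
      "\<And>p q. p \<in> P3 \<Longrightarrow> q \<in> Q3 \<Longrightarrow> p \<otimes> inv q \<in> U"
    using open_preimage_prod[where f = "\<lambda>p q. p \<otimes> inv q", OF _ U(1) _ one one] by blast
  show ?thesis
    by (rule that[of "P1 \<inter> Q1 \<inter> P2 \<inter> Q2 \<inter> P3 \<inter> Q3"])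
      (use 1 2 3 in \<open>simp_all add: openin_Int\<close>)
qed

text \<open>The centres of a finite cover of \<open>K\<close> by translates need not lie in \<open>M\<close>; halving the
  neighbourhood allows each useful centre to be replaced by a point of \<open>M\<close>.\<close>

lemma topological_group_totally_bounded:
  fixes G (structure)
  assumes G: "topological_group G T" and K: "compactin T K" "M \<subseteq> K"
    and Q: "openin T Q" "\<one> \<in> Q"
  obtains I where "finite I" "I \<subseteq> M" "\<And>m. m \<in> M \<Longrightarrow> \<exists>i\<in>I. inv i \<otimes> m \<in> Q"
proof -
  interpret group G using G by (simp add: topological_group_def)
  have top: "topspace T = carrier G" using G by (simp add: topological_group_def)
  obtain P where P: "openin T P" "\<one> \<in> P" 
    "\<And>x y. x \<in> P \<Longrightarrow> y \<in> P \<Longrightarrow> inv x \<otimes> y \<in> Q"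
    using small_neighbourhood[OF G Q] by metis
  define B where "B x = {y \<in> carrier G. inv x \<otimes> y \<in> P}" for x
  have Kc: "K \<subseteq> carrier G" using K(1) top compactin_subset_topspace by metis
  have op: "openin T (B x)" if "x \<in> K" for x
    unfolding B_def top[symmetric] using that Kc top G P(1)
    by (intro open_preimage topological_group_continuous) auto
  have "K \<subseteq> \<Union> (B ` K)"
    using Kc P(2) by (fastforce simp: B_def subset_iff)
  then obtain \<F> where F: "finite \<F>" "\<F> \<subseteq> B ` K" "K \<subseteq> \<Union> \<F>"
    using compactinD[OF K(1), of "B ` K"] op by auto
  obtain X where X: "finite X" "X \<subseteq> K" "\<F> = B ` X"
    using finite_subset_image[OF F(1,2)] by blast
  define m where "m x = (SOME m. m \<in> M \<inter> B x)" for x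
  define I where "I = m ` {x \<in> X. M \<inter> B x \<noteq> {}}"
  have m: "m x \<in> M \<inter> B x" if "M \<inter> B x \<noteq> {}" for x
    unfolding m_def using that by (metis ex_in_conv someI_ex)
  show ?thesis
  proof (rule that)
    show "finite I" using X by (simp add: I_def)
    show "I \<subseteq> M" using m by (auto simp: I_def)
    fix y assume y: "y \<in> M"
    then obtain x where x: "x \<in> X" "y \<in> B x" using K F X by blast
    then have mx: "m x \<in> M \<inter> B x" using m y by blast
    have c: "x \<in> carrier G" "m x \<in> carrier G" "y \<in> carrier G"
      using mx x X Kc by (auto simp: B_def)
    have "inv (inv x \<otimes> m x) \<otimes> (inv x \<otimes> y) \<in> Q"
      using mx x by (intro P) (auto simp: B_def)
    also have "inv (inv x \<otimes> m x) \<otimes> (inv x \<otimes> y) = inv (m x) \<otimes> y"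
      using c by (simp add: inv_mult_group m_assoc) (simp add: m_assoc[symmetric])
    finally show "\<exists>i\<in>I. inv i \<otimes> y \<in> Q"
      using x mx y by (auto simp: I_def)
  qed
qed

lemma compactin_product_set:
  fixes G (structure)
  assumes "topological_group G T" "compactin T A" "compactin T B"
  shows "compactin T {a \<otimes> b |a b. a \<in> A \<and> b \<in> B}"
proof -
  have "compactin T ((\<lambda>(x, y). x \<otimes> y) ` (A \<times> B))"
    using assms by (intro image_compactin[of "prod_topology T T"])
      (auto simp: compactin_Times topological_group_def)
  also have "(\<lambda>(x, y). x \<otimes> y) ` (A \<times> B) = {a \<otimes> b |a b. a \<in> A \<and> b \<in> B}"
    by auto
  finally show ?thesis .
qed

section \<open>A coarser topology on a subgroup\<close>

text \<open>Throughout, \<open>S\<close> is a group topology on a subgroup \<open>H\<close> of a topological group \<open>(G, T)\<close>, at most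
  as fine as the topology induced by \<open>T\<close>. The point is to compare the two although \<open>S\<close> is not defined
  on all of \<open>G\<close>.\<close>

locale coarser_group_topology =
  fixes G (structure) and T H S
  assumes G: "topological_group G T" and H: "subgroup H G"
    and S: "topological_group (G\<lparr>carrier := H\<rparr>) S"
    and coarser: "openin S U \<Longrightarrow> openin (subtopology T H) U"
begin

sublocale group G using G by (simp add: topological_group_def)
sublocale H: subgroup H G by (rule H)

lemma topT: "topspace T = carrier G" and topS: "topspace S = H"
  using G S by (auto simp: topological_group_def)

lemma openS_subset: "openin S U \<Longrightarrow> U \<subseteq> H"
  using openin_subset topS by metis

lemma openS_T: assumes "openin S U" obtains Q where "openin T Q" "U = Q \<inter> H"
  using coarser[OF assms] by (auto simp: openin_subtopology)

lemma inv_H: "x \<in> H \<Longrightarrow> inv\<^bsub>G\<lparr>carrier := H\<rparr>\<^esub> x = inv x"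
  using H by (rule m_inv_consistent)

lemma continuous_multS:
  assumes "continuous_map X S f" "continuous_map X S g"
  shows "continuous_map X S (\<lambda>x. f x \<otimes> g x)"
  using topological_group_continuous_mult[OF S assms] by simp

lemma continuous_invS:
  assumes "continuous_map X S f"
  shows "continuous_map X S (\<lambda>x. inv f x)"
  using topological_group_continuous_inv[OF S assms]
  by (rule continuous_map_eq) (use assms in \<open>auto simp: inv_H topS continuous_map_def Pi_iff\<close>)

lemma continuous_constS: "a \<in> H \<Longrightarrow> continuous_map X S (\<lambda>_. a)"
  using topS by simp

lemmas continuousS = continuous_multS continuous_invS continuous_constS
  continuous_map_fst continuous_map_snd continuous_map_id[unfolded id_def]

lemmas continuousT = topological_group_continuous_mult[OF G] topological_group_continuous_inv[OF G]
  topological_group_continuous_const[OF G]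
  continuous_map_fst continuous_map_snd continuous_map_id[unfolded id_def]

lemma small_neighbourhoodS:
  assumes U: "openin S U" "\<one> \<in> U"
  obtains V where "openin S V" "\<one> \<in> V"
    "\<And>x y. x \<in> V \<Longrightarrow> y \<in> V \<Longrightarrow> x \<otimes> y \<in> U"
    "\<And>x y. x \<in> V \<Longrightarrow> y \<in> V \<Longrightarrow> inv x \<otimes> y \<in> U"
    "\<And>x y. x \<in> V \<Longrightarrow> y \<in> V \<Longrightarrow> x \<otimes> inv y \<in> U"
proof -
  obtain V where "openin S V" "\<one> \<in> V"
    "\<And>x y. x \<in> V \<Longrightarrow> y \<in> V \<Longrightarrow> x \<otimes> y \<in> U"
    "\<And>x y. x \<in> V \<Longrightarrow> y \<in> V \<Longrightarrow> inv\<^bsub>G\<lparr>carrier := H\<rparr>\<^esub> x \<otimes> y \<in> U"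
    "\<And>x y. x \<in> V \<Longrightarrow> y \<in> V \<Longrightarrow> x \<otimes> inv\<^bsub>G\<lparr>carrier := H\<rparr>\<^esub> y \<in> U"
    using small_neighbourhood[OF S U(1)] U(2) by auto
  then show ?thesis
    using inv_H openS_subset[of V] by (intro that[of V]) (metis subsetD)+
qed

lemma open_preimageS:
  assumes "continuous_map S S f" "openin S U" shows "openin S {x \<in> H. f x \<in> U}"
  using open_preimage[OF assms] topS by simp

lemma open_preimageT:
  assumes "continuous_map T T f" "openin T U" shows "openin T {x \<in> carrier G. f x \<in> U}"
  using open_preimage[OF assms] topT by simp

text \<open>The intersection of the \<open>T\<close>-closures of the sets \<open>V \<inter> L\<close>, where \<open>V\<close> runs over the
  \<open>S\<close>-neighbourhoods of the identity. It collects the points of \<open>G\<close> that are \<open>T\<close>-limits of nets in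
  \<open>L\<close> tending to the identity for \<open>S\<close>; for \<open>L = H\<close> and \<open>G\<close> complete it is the kernel of the map which
  the identity \<open>(H, T) \<rightarrow> (H, S)\<close> induces between the completions.\<close>

definition residue :: "'a set \<Rightarrow> 'a set" where
  "residue L = {g \<in> carrier G. \<forall>V B. openin S V \<and> \<one> \<in> V \<and> openin T B \<and> g \<in> B \<longrightarrow> V \<inter> L \<inter> B \<noteq> {}}"

text \<open>Both topologies induce the same neighbourhoods of the identity on \<open>L\<close>.\<close>

definition agree :: "'a set \<Rightarrow> bool" where
  "agree L \<longleftrightarrow> (\<forall>B. openin T B \<and> \<one> \<in> B \<longrightarrow> (\<exists>V. openin S V \<and> \<one> \<in> V \<and> V \<inter> L \<subseteq> B))"

lemma residueD:
  assumes "g \<in> residue L" "openin S V" "\<one> \<in> V" "openin T B" "g \<in> B"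
  obtains x where "x \<in> V" "x \<in> L" "x \<in> B"
  using assms unfolding residue_def by blast

lemma residueI:
  assumes "g \<in> carrier G"
    "\<And>V B. openin S V \<Longrightarrow> \<one> \<in> V \<Longrightarrow> openin T B \<Longrightarrow> g \<in> B \<Longrightarrow> \<exists>x. x \<in> V \<and> x \<in> L \<and> x \<in> B"
  shows "g \<in> residue L"
  using assms unfolding residue_def by blast

lemma agreeD:
  assumes "agree L" "openin T B" "\<one> \<in> B"
  obtains V where "openin S V" "\<one> \<in> V" "V \<inter> L \<subseteq> B"
  using assms unfolding agree_def by blast

lemma residue_carrier: "g \<in> residue L \<Longrightarrow> g \<in> carrier G"
  by (simp add: residue_def)

lemma residue_mono: "L \<subseteq> L' \<Longrightarrow> residue L \<subseteq> residue L'"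
  unfolding residue_def by blast

lemma openS_H: "openin S H" using topS openin_topspace by metis

lemma residue_closure: "g \<in> residue L \<Longrightarrow> g \<in> T closure_of L"
  unfolding in_closure_of topT using residueD[OF _ openS_H H.one_closed] residue_carrier by metis

lemma one_residue: "\<one> \<in> L \<Longrightarrow> \<one> \<in> residue L"
  by (intro residueI) auto

lemma Hausdorff_S: "Hausdorff_space S" and Hausdorff_T: "Hausdorff_space T"
  using S G by (simp_all add: topological_group_def)

text \<open>A point of \<open>H\<close> other than the identity has an \<open>S\<close>-neighbourhood missing an \<open>S\<close>-neighbourhood of
  the identity, and the former is also a \<open>T\<close>-neighbourhood.\<close>

lemma residue_Int_H: assumes "g \<in> residue L" "g \<in> H" shows "g = \<one>"
proof (rule ccontr)
  assume "g \<noteq> \<one>"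
  then obtain U V where UV: "openin S U" "openin S V" "g \<in> U" "\<one> \<in> V" "disjnt U V"
    using Hausdorff_S assms(2) topS H.one_closed unfolding Hausdorff_space_def by metis
  obtain Q where Q: "openin T Q" "U = Q \<inter> H" using openS_T[OF UV(1)] .
  obtain x where "x \<in> V" "x \<in> Q"
    using residueD[OF assms(1) UV(2,4) Q(1)] UV(3) Q(2) by blast
  then show False using Q(2) UV(5) openS_subset[OF UV(2)] by (auto simp: disjnt_iff)
qed

lemma residue_inv:
  assumes L: "\<And>x. x \<in> L \<Longrightarrow> inv x \<in> L" and g: "g \<in> residue L"
  shows "inv g \<in> residue L"
proof (rule residueI)
  show "inv g \<in> carrier G" using residue_carrier[OF g] by simp
  fix V B assume VO: "openin S V" "\<one> \<in> V" "openin T B" "inv g \<in> B"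
  have "openin S {x \<in> H. inv x \<in> V}"
    using VO(1) by (intro open_preimageS continuousS)
  moreover have "openin T {x \<in> carrier G. inv x \<in> B}"
    using VO by (intro open_preimageT continuousT)
  ultimately obtain x where "x \<in> {x \<in> H. inv x \<in> V}" "x \<in> L" "x \<in> {x \<in> carrier G. inv x \<in> B}"
    using residueD[OF g, of "{x \<in> H. inv x \<in> V}" "{x \<in> carrier G. inv x \<in> B}"] VO residue_carrier[OF g]
    by force
  then show "\<exists>x. x \<in> V \<and> x \<in> L \<and> x \<in> B" using L by blast
qed

lemma residue_mult:
  assumes L: "\<And>x y. x \<in> L \<Longrightarrow> y \<in> L \<Longrightarrow> x \<otimes> y \<in> L" and g: "g \<in> residue L" and h: "h \<in> residue L"
  shows "g \<otimes> h \<in> residue L"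
proof (rule residueI)
  have c: "g \<in> carrier G" "h \<in> carrier G" using residue_carrier g h by auto
  then show "g \<otimes> h \<in> carrier G" by simp
  fix V B assume VO: "openin S V" "\<one> \<in> V" "openin T B" "g \<otimes> h \<in> B"
  obtain W where W: "openin S W" "\<one> \<in> W" "\<And>x y. x \<in> W \<Longrightarrow> y \<in> W \<Longrightarrow> x \<otimes> y \<in> V"
    using small_neighbourhoodS[OF VO(1,2)] by metis
  have "continuous_map (prod_topology T T) T (\<lambda>p. fst p \<otimes> snd p)"
    by (intro continuousT)
  then obtain P Q where PQ: "openin T P" "openin T Q" "g \<in> P" "h \<in> Q"
      "\<And>p q. p \<in> P \<Longrightarrow> q \<in> Q \<Longrightarrow> p \<otimes> q \<in> B"
    using open_preimage_prod[where f = "\<lambda>p q. p \<otimes> q", OF _ VO(3) VO(4)] c topT by blast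
  obtain x where x: "x \<in> W" "x \<in> L" "x \<in> P" using residueD[OF g W(1,2) PQ(1,3)] .
  obtain y where y: "y \<in> W" "y \<in> L" "y \<in> Q" using residueD[OF h W(1,2) PQ(2,4)] .
  show "\<exists>x. x \<in> V \<and> x \<in> L \<and> x \<in> B" using x y W(3) PQ(5) L by blast
qed

text \<open>The elements of \<open>Q\<close> normalise the residue because conjugation by them is continuous for both
  topologies; the residue is \<open>T\<close>-closed, so this passes to the closure of \<open>Q\<close>, even though conjugation
  by an element of that closure need not act on \<open>H\<close>.\<close>

lemma residue_conj:
  assumes Q: "Q \<subseteq> H" "\<And>q x. q \<in> Q \<Longrightarrow> x \<in> L \<Longrightarrow> q \<otimes> x \<otimes> inv q \<in> L"
    and h: "h \<in> T closure_of Q" and g: "g \<in> residue L"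
  shows "h \<otimes> g \<otimes> inv h \<in> residue L"
proof (rule residueI)
  have c: "g \<in> carrier G" "h \<in> carrier G"
    using residue_carrier g h topT by (auto simp: in_closure_of)
  then show "h \<otimes> g \<otimes> inv h \<in> carrier G" by simp
  fix V B assume VO: "openin S V" "\<one> \<in> V" "openin T B" "h \<otimes> g \<otimes> inv h \<in> B"
  have "openin T {h \<in> carrier G. h \<otimes> g \<otimes> inv h \<in> B}"
    using VO c by (intro open_preimageT continuousT)
  moreover have "h \<in> {h \<in> carrier G. h \<otimes> g \<otimes> inv h \<in> B}" using VO c by simp
  ultimately obtain q where q: "q \<in> Q" "q \<in> {h \<in> carrier G. h \<otimes> g \<otimes> inv h \<in> B}"
    by (rule closure_meets[OF h])
  have qH: "q \<in> H" "q \<in> carrier G" using q Q by auto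
  have "openin S {x \<in> H. q \<otimes> x \<otimes> inv q \<in> V}"
    using VO qH by (intro open_preimageS continuousS) auto
  moreover have "openin T {x \<in> carrier G. q \<otimes> x \<otimes> inv q \<in> B}"
    using VO qH by (intro open_preimageT continuousT) auto
  ultimately obtain x where "x \<in> {x \<in> H. q \<otimes> x \<otimes> inv q \<in> V}" "x \<in> L"
      "x \<in> {x \<in> carrier G. q \<otimes> x \<otimes> inv q \<in> B}"
    using residueD[OF g, of "{x \<in> H. q \<otimes> x \<otimes> inv q \<in> V}" "{x \<in> carrier G. q \<otimes> x \<otimes> inv q \<in> B}"]
      VO qH q c by force
  then show "\<exists>x. x \<in> V \<and> x \<in> L \<and> x \<in> B" using Q q by blast
qed

text \<open>Let \<open>x\<close> in \<open>H\<close> be \<open>S\<close>-close to the identity and \<open>T\<close>-close to \<open>g\<close>, and let \<open>l\<close> in \<open>L\<close> be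
  \<open>T\<close>-close to \<open>g\<close>. Then \<open>x\<close> and \<open>l\<close> are close for \<open>T\<close>, hence for \<open>S\<close>, so \<open>l\<close> is \<open>S\<close>-close to the
  identity. As the topologies agree on \<open>L\<close>, it is also \<open>T\<close>-close to it, and \<open>g\<close> is the identity.\<close>

lemma residue_Int_closure:
  assumes L: "agree L" "L \<subseteq> H" and g: "g \<in> residue H" "g \<in> T closure_of L"
  shows "g = \<one>"
proof (rule ccontr)
  assume "g \<noteq> \<one>"
  have c: "g \<in> carrier G" using residue_carrier g by auto
  obtain P B where PO: "openin T P" "openin T B" "g \<in> P" "\<one> \<in> B" "disjnt P B"
    using Hausdorff_T c \<open>g \<noteq> \<one>\<close> topT unfolding Hausdorff_space_def by (metis one_closed)
  obtain V where V: "openin S V" "\<one> \<in> V" "V \<inter> L \<subseteq> B" using agreeD[OF L(1) PO(2,4)] .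
  obtain V' where V': "openin S V'" "\<one> \<in> V'" "\<And>x y. x \<in> V' \<Longrightarrow> y \<in> V' \<Longrightarrow> inv x \<otimes> y \<in> V"
    using small_neighbourhoodS[OF V(1,2)] by metis
  obtain Q where Q: "openin T Q" "V' = Q \<inter> H" using openS_T[OF V'(1)] .
  have cm: "continuous_map (prod_topology T T) T (\<lambda>p. fst p \<otimes> inv (snd p))"
    by (intro continuousT)
  have mem: "g \<otimes> inv g \<in> Q" "g \<in> topspace T" using Q V' c topT by auto
  obtain R1 R2 where R: "openin T R1" "openin T R2" "g \<in> R1" "g \<in> R2"
      "\<And>p q. p \<in> R1 \<Longrightarrow> q \<in> R2 \<Longrightarrow> p \<otimes> inv q \<in> Q"
    using open_preimage_prod[where f = "\<lambda>p q. p \<otimes> inv q", OF cm Q(1) mem(1,2,2)] by blast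
  obtain x where x: "x \<in> V'" "x \<in> H" "x \<in> R1" using residueD[OF g(1) V'(1,2) R(1,3)] .
  have "openin T (R2 \<inter> P)" "g \<in> R2 \<inter> P" using R PO by auto
  then obtain l where l: "l \<in> L" "l \<in> R2" "l \<in> P" using closure_meets[OF g(2)] by blast
  have lH: "l \<in> H" using l L by auto
  have "x \<otimes> inv l \<in> V'" using R(5)[OF x(3) l(2)] Q(2) x lH by auto
  then have "inv (x \<otimes> inv l) \<otimes> x \<in> V" using V' x by blast
  also have "inv (x \<otimes> inv l) \<otimes> x = l"
    using x lH by (simp add: inv_mult_group m_assoc)
  finally have "l \<in> B" using V l by blast
  then show False using PO l by (auto simp: disjnt_iff)
qed

text \<open>The finite intersection property: outside a \<open>T\<close>-neighbourhood of the identity the compact set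
  \<open>C\<close> contains no point common to the closures of all sets \<open>V \<inter> L\<close>.\<close>

lemma agree_of_compact:
  assumes V0: "openin S V0" "\<one> \<in> V0" "V0 \<inter> L \<subseteq> C" "compactin T C"
    and N: "residue L \<subseteq> {\<one>}"
  shows "agree L"
  unfolding agree_def
proof (intro allI impI, elim conjE)
  fix B assume B: "openin T B" "\<one> \<in> B"
  have "\<exists>V P. openin S V \<and> \<one> \<in> V \<and> openin T P \<and> g \<in> P \<and> V \<inter> L \<inter> P = {}" if "g \<in> C - B" for g
  proof -
    have "g \<notin> residue L" using N B that by auto
    moreover have "g \<in> carrier G" using that V0(4) compactin_subset_topspace topT by blast
    ultimately show ?thesis unfolding residue_def by blast
  qed
  then obtain V P where VP: "\<And>g. g \<in> C - B \<Longrightarrow> openin S (V g) \<and> \<one> \<in> V g \<and> openin T (P g) \<and> g \<in> P g \<and> V g \<inter> L \<inter> P g = {}"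
    by metis
  have "\<exists>\<F>. finite \<F> \<and> \<F> \<subseteq> insert B (P ` (C - B)) \<and> C \<subseteq> \<Union>\<F>"
    by (rule compactinD[OF V0(4)]) (use VP B in auto)
  then obtain \<F> where F: "finite \<F>" "\<F> \<subseteq> insert B (P ` (C - B))" "C \<subseteq> \<Union>\<F>" by blast
  then have "finite (\<F> - {B})" "\<F> - {B} \<subseteq> P ` (C - B)" by auto
  then obtain X where X: "finite X" "X \<subseteq> C - B" "\<F> - {B} = P ` X"
    using finite_subset_image by metis
  let ?V = "V0 \<inter> \<Inter> (V ` X)"
  have VX: "openin S (V g)" "\<one> \<in> V g" "V g \<inter> L \<inter> P g = {}" if "g \<in> X" for g
    using VP[of g] X(2) that by blast+
  have "openin S ?V"
    using VX V0(1) X(1) by (rule_tac openin_Int_Inter) auto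
  moreover have "\<one> \<in> ?V" using VX V0(2) by blast
  moreover have "?V \<inter> L \<subseteq> B"
  proof
    fix x assume x: "x \<in> ?V \<inter> L"
    show "x \<in> B"
    proof (rule ccontr)
      assume "x \<notin> B"
      have "x \<in> C" using V0(3) x by blast
      then obtain D where "D \<in> \<F>" "x \<in> D" using F(3) by blast
      then have "D \<in> P ` X" using X(3) \<open>x \<notin> B\<close> by blast
      then obtain y where "y \<in> X" "x \<in> P y" using \<open>x \<in> D\<close> by blast
      then show False using VX(3)[of y] x by blast
    qed
  qed
  ultimately show "\<exists>V. openin S V \<and> \<one> \<in> V \<and> V \<inter> L \<subseteq> B" by blast
qed

text \<open>If \<open>x = a \<otimes> b\<close> is \<open>S\<close>-small and \<open>a\<close> is \<open>T\<close>-small, then \<open>a\<close> is \<open>S\<close>-small, so \<open>b\<close> is \<open>S\<close>-small,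
  so \<open>b\<close> is \<open>T\<close>-small.\<close>

lemma agree_of_factorization:
  assumes L0: "agree L0" "L0 \<subseteq> H" and "L \<subseteq> H"
    and fac: "\<And>B. openin T B \<Longrightarrow> \<one> \<in> B \<Longrightarrow> \<exists>V. openin S V \<and> \<one> \<in> V \<and>
      (\<forall>x \<in> V \<inter> L. \<exists>a \<in> B \<inter> H. \<exists>b \<in> L0. x = a \<otimes> b)"
  shows "agree L"
  unfolding agree_def
proof (intro allI impI, elim conjE)
  fix B assume B: "openin T B" "\<one> \<in> B"
  obtain O1 where O1: "openin T O1" "\<one> \<in> O1" "\<And>x y. x \<in> O1 \<Longrightarrow> y \<in> O1 \<Longrightarrow> x \<otimes> y \<in> B"
    using small_neighbourhood[OF G B] by metis
  obtain V0 where V0: "openin S V0" "\<one> \<in> V0" "V0 \<inter> L0 \<subseteq> O1" using agreeD[OF L0(1) O1(1,2)] .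
  obtain V1 where V1: "openin S V1" "\<one> \<in> V1" "\<And>x y. x \<in> V1 \<Longrightarrow> y \<in> V1 \<Longrightarrow> inv x \<otimes> y \<in> V0"
    using small_neighbourhoodS[OF V0(1,2)] by metis
  obtain Q where Q: "openin T Q" "V1 = Q \<inter> H" using openS_T[OF V1(1)] .
  have "openin T (Q \<inter> O1)" "\<one> \<in> Q \<inter> O1" using Q O1 V1 by auto
  from fac[OF this] obtain V where V: "openin S V" "\<one> \<in> V"
     "\<And>x. x \<in> V \<inter> L \<Longrightarrow> \<exists>a \<in> Q \<inter> O1 \<inter> H. \<exists>b \<in> L0. x = a \<otimes> b" by blast
  have "V \<inter> V1 \<inter> L \<subseteq> B"
  proof
    fix x assume x: "x \<in> V \<inter> V1 \<inter> L"
    then obtain a b where ab: "a \<in> Q \<inter> O1 \<inter> H" "b \<in> L0" "x = a \<otimes> b" using V(3)[of x] by blast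
    have "inv a \<otimes> x \<in> V0" using V1(3) ab Q x by blast
    also have "inv a \<otimes> x = b" using ab L0 by (simp add: m_assoc[symmetric] subset_iff)
    finally have "b \<in> O1" using V0 ab by blast
    then show "x \<in> B" using O1 ab by auto
  qed
  then show "\<exists>V. openin S V \<and> \<one> \<in> V \<and> V \<inter> L \<subseteq> B"
    using V V1 by (intro exI[of _ "V \<inter> V1"]) auto
qed

text \<open>Write \<open>x = m \<otimes> l\<close> for \<open>x\<close> near the identity. By total boundedness \<open>m\<close> is within a small
  neighbourhood of one of finitely many \<open>i \<in> M\<close>. For two elements with the same \<open>i\<close> the quotient of
  their \<open>l\<close>-parts is \<open>S\<close>-small, hence lies in \<open>V0 \<inter> L \<subseteq> C0\<close>; so all \<open>l\<close>-parts belonging to \<open>i\<close> lie in one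
  right translate of \<open>C0\<close>.\<close>

lemma bounded_of_factorization:
  assumes V0: "openin S V0" "\<one> \<in> V0" "V0 \<inter> L \<subseteq> C0" "compactin T C0"
    and V1: "openin S V1" "\<one> \<in> V1" "\<And>x. x \<in> V1 \<Longrightarrow> \<exists>m\<in>M. \<exists>l\<in>L. x = m \<otimes> l"
    and M: "M \<subseteq> K" "compactin T K" "M \<subseteq> H" and L: "subgroup L G" "L \<subseteq> H"
  obtains V C where "openin S V" "\<one> \<in> V" "V \<subseteq> C" "compactin T C"
proof -
  interpret L: subgroup L G by fact
  obtain W where W: "openin S W" "\<one> \<in> W" "\<And>x y. x \<in> W \<Longrightarrow> y \<in> W \<Longrightarrow> x \<otimes> y \<in> V0"
    using small_neighbourhoodS[OF V0(1,2)] by metis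
  obtain V2 where V2: "openin S V2" "\<one> \<in> V2" "\<And>x y. x \<in> V2 \<Longrightarrow> y \<in> V2 \<Longrightarrow> inv x \<otimes> y \<in> W"
    using small_neighbourhoodS[OF W(1,2)] by metis
  obtain Q where Q: "openin T Q" "W \<inter> V2 = Q \<inter> H" using openS_T[of "W \<inter> V2"] W V2 by blast
  have Q1: "\<one> \<in> Q" using Q W V2 by blast
  obtain I where I: "finite I" "I \<subseteq> M" "\<And>m. m \<in> M \<Longrightarrow> \<exists>i\<in>I. inv i \<otimes> m \<in> Q"
    using topological_group_totally_bounded[OF G M(2,1) Q(1) Q1] by metis
  have "\<exists>U. openin S U \<and> \<one> \<in> U \<and> (\<forall>x\<in>U. \<forall>y\<in>U. inv i \<otimes> (x \<otimes> inv y) \<otimes> i \<in> V2)" if "i \<in> I" for i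
  proof -
    have i: "i \<in> H" "i \<in> carrier G" using that I M by auto
    define E where "E = {x \<in> H. inv i \<otimes> x \<otimes> i \<in> V2}"
    have "openin S E"
      unfolding E_def using i V2(1) by (intro open_preimageS continuousS) auto
    moreover have "\<one> \<in> E" using i V2(2) by (simp add: E_def)
    ultimately have E: "openin S E" "\<one> \<in> E" .
    obtain U where "openin S U" "\<one> \<in> U" "\<And>x y. x \<in> U \<Longrightarrow> y \<in> U \<Longrightarrow> x \<otimes> inv y \<in> E"
      using small_neighbourhoodS[OF E] by metis
    then show ?thesis unfolding E_def by blast
  qed
  then obtain U where U: "\<And>i. i \<in> I \<Longrightarrow> openin S (U i) \<and> \<one> \<in> U i \<and> (\<forall>x\<in>U i. \<forall>y\<in>U i. inv i \<otimes> (x \<otimes> inv y) \<otimes> i \<in> V2)"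
    by metis
  define V where "V = V1 \<inter> \<Inter> (U ` I)"
  have V: "openin S V" "\<one> \<in> V"
  proof -
    show "openin S V"
      unfolding V_def using U V1(1) I(1) by (rule_tac openin_Int_Inter) auto
    show "\<one> \<in> V" unfolding V_def using U V1(2) by blast
  qed
  \<comment> \<open>\<open>R i a m l\<close>: the element \<open>a\<close> of \<open>V\<close> factors as \<open>m \<otimes> l\<close> with \<open>m\<close> in the piece of \<open>M\<close> around \<open>i\<close>\<close>
  define R where "R i a m l \<longleftrightarrow> a \<in> V \<and> m \<in> M \<and> l \<in> L \<and> a = m \<otimes> l \<and> inv i \<otimes> m \<in> Q" for i a m l
  define J where "J = {i \<in> I. \<exists>a m l. R i a m l}"
  have "\<exists>l a m. R i a m l" if "i \<in> J" for i using that by (auto simp: J_def)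
  then obtain l0 where l0: "\<And>i. i \<in> J \<Longrightarrow> \<exists>a m. R i a m (l0 i)" by metis
  have l0c: "l0 i \<in> carrier G" if "i \<in> J" for i using l0[OF that] by (auto simp: R_def)
  have key: "l \<otimes> inv l' \<in> C0" if i: "i \<in> I" and R: "R i a m l" "R i a' m' l'" for i a m l a' m' l'
  proof -
    have H': "i \<in> H" "a \<in> H" "a' \<in> H" "m \<in> H" "m' \<in> H" "l \<in> L" "l' \<in> L"
      using i R I M openS_subset[OF V(1)] by (auto simp: R_def)
    have c: "i \<in> carrier G" "m \<in> carrier G" "m' \<in> carrier G" "l \<in> carrier G" "l' \<in> carrier G"
      using H' by auto
    define q where "q = inv i \<otimes> m" 
    define q' where "q' = inv i \<otimes> m'"
    define x where "x = inv i \<otimes> (a \<otimes> inv a') \<otimes> i"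
    have qc: "q \<in> carrier G" "q' \<in> carrier G" using c by (auto simp: q_def q'_def)
    have q: "q \<in> W \<inter> V2" "q' \<in> W \<inter> V2" using R H' Q by (auto simp: q_def q'_def R_def)
    have x: "x \<in> V2" unfolding x_def using U[OF i] i R by (auto simp: R_def V_def)
    have "inv q \<otimes> x \<otimes> q' \<in> V0" using q x W V2 by blast
    moreover have "inv q \<otimes> x \<otimes> q' = l \<otimes> inv l'"
    proof -
      have m: "m = i \<otimes> q" "m' = i \<otimes> q'" using c by (simp_all add: q_def q'_def m_assoc[symmetric])
      have "a \<otimes> inv a' = i \<otimes> q \<otimes> l \<otimes> inv l' \<otimes> inv q' \<otimes> inv i"
        using R c qc unfolding R_def m by (simp add: inv_mult_group m_assoc)
      then have "x = q \<otimes> l \<otimes> inv l' \<otimes> inv q'"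
        using c qc by (simp add: x_def m_assoc) (simp add: m_assoc[symmetric])
      then show ?thesis
        using c qc by (simp add: m_assoc) (simp add: m_assoc[symmetric])
    qed
    moreover have "l \<otimes> inv l' \<in> L" using H' by auto
    ultimately show ?thesis using V0 by auto
  qed
  define C where "C = (\<Union>i\<in>J. {a \<otimes> b |a b. a \<in> K \<and> b \<in> {a \<otimes> b |a b. a \<in> C0 \<and> b \<in> {l0 i}}})"
  have "compactin T {a \<otimes> b |a b. a \<in> K \<and> b \<in> {a \<otimes> b |a b. a \<in> C0 \<and> b \<in> {l0 i}}}" if "i \<in> J" for i
    using l0c[OF that] topT by (intro compactin_product_set[OF G] M V0) simp
  moreover have "finite J" using I by (simp add: J_def)
  ultimately have "compactin T C"
    unfolding C_def by (intro compactin_Union) auto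
  moreover have "V \<subseteq> C"
  proof
    fix a assume a: "a \<in> V"
    then have "a \<in> V1" by (simp add: V_def)
    then obtain m l where ml: "m \<in> M" "l \<in> L" "a = m \<otimes> l" using V1(3) by blast
    then obtain i where i: "i \<in> I" "inv i \<otimes> m \<in> Q" using I by blast
    have R: "R i a m l" using a ml i by (simp add: R_def)
    then have iJ: "i \<in> J" using i by (auto simp: J_def)
    obtain a' m' where "R i a' m' (l0 i)" using l0[OF iJ] by blast
    then have "l \<otimes> inv (l0 i) \<in> C0" using key i R by blast
    moreover have "l = l \<otimes> inv (l0 i) \<otimes> l0 i" using l0c[OF iJ] ml by (simp add: m_assoc)
    ultimately show "a \<in> C" using ml M iJ unfolding C_def by blast
  qed
  ultimately show ?thesis using that V by blast
qed

lemma topologies_equal: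
  assumes "agree H" shows "S = subtopology T H"
proof (rule topology_eq[THEN iffD2], intro allI iffI)
  fix U show "openin S U \<Longrightarrow> openin (subtopology T H) U" by (rule coarser)
  assume "openin (subtopology T H) U"
  then obtain B where B: "openin T B" "U = B \<inter> H" by (auto simp: openin_subtopology)
  have "\<exists>W. openin S W \<and> u \<in> W \<and> W \<subseteq> U" if "u \<in> U" for u
  proof -
    have u: "u \<in> B" "u \<in> H" "u \<in> carrier G" using that B by auto
    have "openin T {x \<in> carrier G. x \<otimes> u \<in> B}"
      using u B by (intro open_preimageT continuousT)
    then obtain V where V: "openin S V" "\<one> \<in> V" "V \<inter> H \<subseteq> {x \<in> carrier G. x \<otimes> u \<in> B}"
      using agreeD[OF assms] u by (metis (no_types, lifting) l_one mem_Collect_eq one_closed)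
    have "openin S {x \<in> H. x \<otimes> inv u \<in> V}"
      using u V by (intro open_preimageS continuousS) auto
    moreover have "{x \<in> H. x \<otimes> inv u \<in> V} \<subseteq> U"
    proof safe
      fix x assume x: "x \<in> H" "x \<otimes> inv u \<in> V"
      then have "x \<otimes> inv u \<otimes> u \<in> B" using V u by blast
      then show "x \<in> U" using x u B by (simp add: m_assoc)
    qed
    ultimately show ?thesis using u V by (intro exI[of _ "{x \<in> H. x \<otimes> inv u \<in> V}"]) auto
  qed
  then show "openin S U" by (subst openin_subopen) blast
qed

end

lemma continuous_map_prodI:
  assumes "\<And>a b U. a \<in> topspace T1 \<Longrightarrow> b \<in> topspace T2 \<Longrightarrow> openin T' U \<Longrightarrow> f a b \<in> U \<Longrightarrow>
      \<exists>P Q. openin T1 P \<and> openin T2 Q \<and> a \<in> P \<and> b \<in> Q \<and> (\<forall>p\<in>P. \<forall>q\<in>Q. f p q \<in> U)"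
    and "\<And>a b. a \<in> topspace T1 \<Longrightarrow> b \<in> topspace T2 \<Longrightarrow> f a b \<in> topspace T'"
  shows "continuous_map (prod_topology T1 T2) T' (\<lambda>(x, y). f x y)"
  unfolding continuous_map_eq_topcontinuous_at topcontinuous_at_def
proof (intro ballI conjI allI impI)
  fix x assume x: "x \<in> topspace (prod_topology T1 T2)"
  then show "x \<in> topspace (prod_topology T1 T2)" .
  obtain a b where ab: "x = (a, b)" "a \<in> topspace T1" "b \<in> topspace T2" using x by auto
  show "(\<lambda>(x, y). f x y) \<in> topspace (prod_topology T1 T2) \<rightarrow> topspace T'"
    using assms(2) by auto
  fix U assume U: "openin T' U \<and> (\<lambda>(x, y). f x y) x \<in> U"
  then obtain P Q where PQ: "openin T1 P" "openin T2 Q" "a \<in> P" "b \<in> Q" "\<And>p q. p \<in> P \<Longrightarrow> q \<in> Q \<Longrightarrow> f p q \<in> U"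
    using assms(1)[of a b U] ab by auto
  show "\<exists>V. openin (prod_topology T1 T2) V \<and> x \<in> V \<and> (\<forall>y\<in>V. (\<lambda>(x, y). f x y) y \<in> U)"
    by (rule exI[of _ "P \<times> Q"]) (use PQ ab in \<open>simp add: openin_prod_Times_iff\<close>)
qed

text \<open>As \<open>Z\<close> meets \<open>H\<close> trivially, \<open>H\<close> embeds into the Hausdorff group \<open>G / Z\<close>. If \<open>Z\<close> were nontrivial, the
  topology induced from there would be strictly coarser, because nets in \<open>H\<close> that converge to a nontrivial
  element of \<open>Z\<close> tend to the identity in it. The open sets of \<open>G / Z\<close> are represented by the \<open>Z\<close>-saturated open
  sets of \<open>G\<close>.\<close>

lemma minimal_subgroup_meets_finite_central:
  fixes G (structure) and T :: "'a topology"
  assumes G: "topological_group G T" and H: "subgroup H G"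
    and min: "minimal_topological_group (G\<lparr>carrier := H\<rparr>) (subtopology T H)"
    and Z: "subgroup Z G" "finite Z" "\<And>z x. z \<in> Z \<Longrightarrow> x \<in> carrier G \<Longrightarrow> z \<otimes> x = x \<otimes> z"
    and cl: "Z \<subseteq> T closure_of H" and Int: "\<And>z. z \<in> Z \<Longrightarrow> z \<in> H \<Longrightarrow> z = \<one>"
  shows "Z = {\<one>}"
proof -
  interpret group G using G by (simp add: topological_group_def)
  interpret H: subgroup H G by fact
  interpret Z: subgroup Z G by fact
  note [simp] = Z.mem_carrier H.mem_carrier
  have top: "topspace T = carrier G" and haus: "Hausdorff_space T"
    using G by (auto simp: topological_group_def)
  define sat where "sat P \<longleftrightarrow> openin T P \<and> (\<forall>x\<in>P. \<forall>z\<in>Z. x \<otimes> z \<in> P)" for P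
  define S where "S = topology (\<lambda>W. \<exists>Q. sat Q \<and> W = Q \<inter> H)"
  have "istopology (\<lambda>W. \<exists>Q. sat Q \<and> W = Q \<inter> H)"
    unfolding istopology_def
  proof (intro conjI allI impI)
    fix V W assume "\<exists>Q. sat Q \<and> V = Q \<inter> H" "\<exists>Q. sat Q \<and> W = Q \<inter> H"
    then obtain Q R where "sat Q" "V = Q \<inter> H" "sat R" "W = R \<inter> H" by blast
    then show "\<exists>Q. sat Q \<and> V \<inter> W = Q \<inter> H"
      by (intro exI[of _ "Q \<inter> R"]) (auto simp: sat_def)
  next
    fix \<K> assume "\<forall>K\<in>\<K>. \<exists>Q. sat Q \<and> K = Q \<inter> H"
    then obtain q where q: "\<And>K. K \<in> \<K> \<Longrightarrow> sat (q K)" "\<And>K. K \<in> \<K> \<Longrightarrow> K = q K \<inter> H" by metis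
    have "sat (\<Union> (q ` \<K>))" using q(1) by (auto simp: sat_def)
    moreover have "\<Union> \<K> = \<Union> (q ` \<K>) \<inter> H" using q(2) by blast
    ultimately show "\<exists>Q. sat Q \<and> \<Union> \<K> = Q \<inter> H" by blast
  qed
  then have openS: "openin S W \<longleftrightarrow> (\<exists>Q. sat Q \<and> W = Q \<inter> H)" for W
    by (simp add: S_def)
  define thick where "thick P = (\<Union>z\<in>Z. {x \<in> carrier G. x \<otimes> z \<in> P})" for P
  have thick_sat: "sat (thick P)" if "openin T P" for P
  proof -
    have "openin T {x \<in> carrier G. x \<otimes> z \<in> P}" if "z \<in> Z" for z
      using \<open>openin T P\<close> that G unfolding top[symmetric]
      by (intro open_preimage topological_group_continuous) (auto simp: top)
    then have "openin T (thick P)" unfolding thick_def by (intro openin_Union) auto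
    moreover have "x \<otimes> y \<in> thick P" if "x \<in> thick P" "y \<in> Z" for x y
    proof -
      obtain z where z: "z \<in> Z" "x \<in> carrier G" "x \<otimes> z \<in> P"
        using \<open>x \<in> thick P\<close> unfolding thick_def by blast
      then have "x \<otimes> y \<otimes> (inv y \<otimes> z) \<in> P"
        using that by (simp add: m_assoc) (simp add: m_assoc[symmetric])
      moreover have "inv y \<otimes> z \<in> Z" using z that by simp
      ultimately show ?thesis using z that unfolding thick_def by auto
    qed
    ultimately show ?thesis unfolding sat_def by blast
  qed
  have thick: "a \<in> thick P" if "a \<in> P" "openin T P" for a P
  proof -
    have "a \<in> carrier G" using that top openin_subset by blast
    then show ?thesis using that by (auto simp: thick_def intro!: bexI[of _ "\<one>"])
  qed
  have topS: "topspace S = H"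
  proof -
    have "sat (carrier G)" using openin_topspace[of T] by (simp add: sat_def top)
    moreover have "H = carrier G \<inter> H" using H.subset by blast
    ultimately have "openin S H" using openS by blast
    then have "H \<subseteq> topspace S" by (rule openin_subset)
    moreover obtain Q where "topspace S = Q \<inter> H" using openS[of "topspace S"] by auto
    ultimately show ?thesis by blast
  qed
  have cS: "openin S (thick P \<inter> H)" if "openin T P" for P using thick_sat[OF that] openS by blast
  have "Hausdorff_space S"
    unfolding Hausdorff_space_def topS
  proof (intro allI impI, elim conjE)
    fix a b assume ab: "a \<in> H" "b \<in> H" "a \<noteq> b"
    have "\<exists>P Q. openin T P \<and> openin T Q \<and> a \<in> P \<and> b \<in> Q \<and> (\<forall>x\<in>P. x \<otimes> z \<notin> Q)" if z: "z \<in> Z" for z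
    proof -
      have "a \<otimes> z \<noteq> b"
      proof
        assume b: "a \<otimes> z = b"
        then have "z = inv a \<otimes> b" using z ab by (simp add: m_assoc[symmetric] flip: b)
        then have "z = \<one>" using Int[OF z] ab by simp
        then show False using b ab by simp
      qed
      then obtain P Q where PQ: "openin T P" "openin T Q" "a \<otimes> z \<in> P" "b \<in> Q" "disjnt P Q"
        using haus z ab unfolding Hausdorff_space_def top by (metis H.mem_carrier Z.mem_carrier m_closed)
      have "openin T {x \<in> topspace T. x \<otimes> z \<in> P}"
        using PQ z G by (intro open_preimage topological_group_continuous) auto
      then show ?thesis using PQ z ab top
        by (intro exI[of _ "{x \<in> topspace T. x \<otimes> z \<in> P}"] exI[of _ Q]) (auto simp: disjnt_iff)
    qed
    then obtain P Q where PQ: "\<And>z. z \<in> Z \<Longrightarrow> openin T (P z)" "\<And>z. z \<in> Z \<Longrightarrow> openin T (Q z)"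
      "\<And>z. z \<in> Z \<Longrightarrow> a \<in> P z" "\<And>z. z \<in> Z \<Longrightarrow> b \<in> Q z" "\<And>z x. z \<in> Z \<Longrightarrow> x \<in> P z \<Longrightarrow> x \<otimes> z \<notin> Q z"
      by metis
    let ?P = "\<Inter> (P ` Z)" and ?Q = "\<Inter> (Q ` Z)"
    have "Z \<noteq> {}" using Z.one_closed by blast
    then have op: "openin T ?P" "openin T ?Q" using Z(2) PQ(1,2)
      by (auto intro!: openin_Inter)
    have "disjnt (thick ?P \<inter> H) (thick ?Q \<inter> H)"
    proof (rule ccontr)
      assume "\<not> ?thesis"
      then obtain x where "x \<in> thick ?P" "x \<in> thick ?Q" by (auto simp: disjnt_iff)
      then obtain y z where yz: "y \<in> Z" "z \<in> Z" "x \<in> carrier G" "x \<otimes> y \<in> ?P" "x \<otimes> z \<in> ?Q"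
        unfolding thick_def by blast
      have w: "inv y \<otimes> z \<in> Z" using yz by simp
      have "x \<otimes> y \<otimes> (inv y \<otimes> z) = x \<otimes> z"
        using yz by (simp add: m_assoc) (simp add: m_assoc[symmetric])
      moreover have "x \<otimes> y \<in> P (inv y \<otimes> z)" "x \<otimes> z \<in> Q (inv y \<otimes> z)"
        using yz(4,5) w by blast+
      ultimately show False using PQ(5)[OF w] by metis
    qed
    moreover have "a \<in> thick ?P" "b \<in> thick ?Q" using op PQ(3,4) by (auto intro!: thick)
    ultimately show "\<exists>U V. openin S U \<and> openin S V \<and> a \<in> U \<and> b \<in> V \<and> disjnt U V"
      using cS op ab by blast
  qed
  moreover have "continuous_map (prod_topology S S) S (\<lambda>(x, y). x \<otimes> y)"
  proof (rule continuous_map_prodI)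
    fix a b U assume ab: "a \<in> topspace S" "b \<in> topspace S" "openin S U" "a \<otimes> b \<in> U"
    then obtain Q where Q: "sat Q" "U = Q \<inter> H" using openS by blast
    have abG: "a \<in> topspace T" "b \<in> topspace T" using ab topS top by auto
    have "continuous_map (prod_topology T T) T (\<lambda>p. fst p \<otimes> snd p)"
      using G by (intro topological_group_continuous)
    then obtain P1 P2 where P: "openin T P1" "openin T P2" "a \<in> P1" "b \<in> P2"
       "\<And>x y. x \<in> P1 \<Longrightarrow> y \<in> P2 \<Longrightarrow> x \<otimes> y \<in> Q"
      using open_preimage_prod[where f = "monoid.mult G", of T T T Q a b] Q ab abG
      unfolding sat_def by blast
    have "x \<otimes> y \<in> U" if xy: "x \<in> thick P1 \<inter> H" "y \<in> thick P2 \<inter> H" for x y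
    proof -
      obtain z w where zw: "z \<in> Z" "w \<in> Z" "x \<otimes> z \<in> P1" "y \<otimes> w \<in> P2"
        using xy unfolding thick_def by blast
      have c: "x \<in> carrier G" "y \<in> carrier G" "z \<in> carrier G" "w \<in> carrier G" using xy zw by auto
      have "x \<otimes> z \<otimes> (y \<otimes> w) \<otimes> inv (z \<otimes> w) \<in> Q"
        using P(5) zw Q by (simp add: sat_def)
      also have "x \<otimes> z \<otimes> (y \<otimes> w) = x \<otimes> y \<otimes> (z \<otimes> w)"
        using c Z(3)[OF zw(1), of y] by (metis m_assoc m_closed)
      also have "x \<otimes> y \<otimes> (z \<otimes> w) \<otimes> inv (z \<otimes> w) = x \<otimes> y"
        using c by (simp add: m_assoc)
      finally show ?thesis using xy Q by simp
    qed
    then show "\<exists>P Q. openin S P \<and> openin S Q \<and> a \<in> P \<and> b \<in> Q \<and> (\<forall>p\<in>P. \<forall>q\<in>Q. p \<otimes> q \<in> U)"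
      using cS P thick ab topS by (intro exI[of _ "thick P1 \<inter> H"] exI[of _ "thick P2 \<inter> H"]) auto
  qed (simp add: topS)
  moreover have "continuous_map S S (\<lambda>x. inv\<^bsub>G\<lparr>carrier := H\<rparr>\<^esub> x)"
    unfolding continuous_map_def topS
  proof (intro conjI allI impI)
    have inv: "inv\<^bsub>G\<lparr>carrier := H\<rparr>\<^esub> x = inv x" if "x \<in> H" for x
      using m_inv_consistent[OF H that] .
    then show "(\<lambda>x. inv\<^bsub>G\<lparr>carrier := H\<rparr>\<^esub> x) \<in> H \<rightarrow> H" by simp
    fix U assume "openin S U"
    then obtain Q where Q: "sat Q" "U = Q \<inter> H" using openS by blast
    have "openin T {x \<in> topspace T. inv x \<in> Q}"
      using Q G unfolding sat_def by (intro open_preimage topological_group_continuous) auto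
    moreover have "inv (x \<otimes> z) \<in> Q" if "x \<in> carrier G" "inv x \<in> Q" "z \<in> Z" for x z
      using that Q Z(3)[of "inv z" "inv x"] by (simp add: inv_mult_group sat_def)
    ultimately have "sat {x \<in> topspace T. inv x \<in> Q}" by (auto simp: sat_def top)
    moreover have "{x \<in> H. inv\<^bsub>G\<lparr>carrier := H\<rparr>\<^esub> x \<in> U} = {x \<in> topspace T. inv x \<in> Q} \<inter> H"
      unfolding Q(2) top by (simp add: inv set_eq_iff cong: conj_cong) (metis H.mem_carrier)
    ultimately show "openin S {x \<in> H. inv\<^bsub>G\<lparr>carrier := H\<rparr>\<^esub> x \<in> U}" using openS by blast
  qed
  ultimately have "topological_group (G\<lparr>carrier := H\<rparr>) S"
    using H.subgroup_is_group[OF is_group] by (simp add: topological_group_def topS)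
  moreover have "openin (subtopology T H) U" if "openin S U" for U
    using that unfolding openS openin_subtopology sat_def by blast
  ultimately have eq: "S = subtopology T H"
    using min unfolding minimal_topological_group_iff_coarser by blast
  show ?thesis
  proof (rule ccontr)
    assume "Z \<noteq> {\<one>}"
    then obtain z where z: "z \<in> Z" "z \<noteq> \<one>" using Z.one_closed by blast
    then obtain P Q where PQ: "openin T P" "openin T Q" "z \<in> P" "\<one> \<in> Q" "disjnt P Q"
      using haus unfolding Hausdorff_space_def top by (metis Z.mem_carrier one_closed)
    have "openin S (Q \<inter> H)" unfolding eq openin_subtopology using PQ by blast
    then obtain R where R: "sat R" "Q \<inter> H = R \<inter> H" using openS by blast
    have "\<one> \<in> Q \<inter> H" using PQ(4) by simp
    then have "\<one> \<in> R" unfolding R(2) by simp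
    then have "\<one> \<otimes> z \<in> R" using R(1) z(1) unfolding sat_def by blast
    then have "z \<in> R" using z(1) by simp
    then have "openin T (P \<inter> R)" "z \<in> P \<inter> R" using R(1) PQ unfolding sat_def by blast+
    then obtain x where "x \<in> H" "x \<in> P \<inter> R" using closure_meets[of z T H] cl z(1) by blast
    then show False using R PQ by (auto simp: disjnt_iff)
  qed
qed

section \<open>Local fields\<close>

lemma tendsto_inverse_field:
  fixes a :: "'a :: topological_field"
  assumes "(f \<longlongrightarrow> a) F" "a \<noteq> 0"
  shows "((\<lambda>x. inverse (f x)) \<longlongrightarrow> inverse a) F"
proof -
  have "filterlim inverse (nhds (inverse a)) (nhds a)"
    using tendsto_inverse_at[OF assms(2)] unfolding tendsto_at_iff_tendsto_nhds .
  then show ?thesis using assms(1) by (rule filterlim_compose)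
qed

lemma continuous_on_inverse_field:
  fixes f :: "'b :: topological_space \<Rightarrow> 'a :: topological_field"
  assumes "continuous_on A f" "\<And>x. x \<in> A \<Longrightarrow> f x \<noteq> 0"
  shows "continuous_on A (\<lambda>x. inverse (f x))"
  using assms unfolding continuous_on_def by (auto intro: tendsto_inverse_field)

lemma compact_mult_image:
  fixes C :: "'a :: topological_field set"
  assumes "compact C" shows "compact ((*) c ` C)"
  using assms by (intro compact_continuous_image continuous_intros)

lemma mult_nhd:
  fixes D :: "'a :: topological_field set"
  assumes "compact D" "open U" "0 \<in> U"
  obtains V where "open V" "0 \<in> V" "\<And>v d. v \<in> V \<Longrightarrow> d \<in> D \<Longrightarrow> v * d \<in> U"
proof -
  have "\<exists>P Q. open P \<and> open Q \<and> 0 \<in> P \<and> d \<in> Q \<and> (\<forall>x\<in>P. \<forall>y\<in>Q. x * y \<in> U)" for d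
  proof -
    have "open ((\<lambda>p. fst p * snd p) -` U)"
      by (intro open_vimage assms continuous_intros)
    moreover have "(0, d) \<in> (\<lambda>p. fst p * snd p) -` U" using assms by simp
    ultimately obtain P Q where "open P" "open Q" "(0, d) \<in> P \<times> Q" "P \<times> Q \<subseteq> (\<lambda>p. fst p * snd p) -` U"
      by (rule open_prod_elim)
    then show ?thesis by (intro exI[of _ P] exI[of _ Q]) auto
  qed
  then obtain P Q where PQ: "\<And>d. open (P d)" "\<And>d. open (Q d)" "\<And>d. 0 \<in> P d" "\<And>d. d \<in> Q d"
    "\<And>d x y. x \<in> P d \<Longrightarrow> y \<in> Q d \<Longrightarrow> x * y \<in> U" by metis
  obtain X where X: "X \<subseteq> D" "finite X" "D \<subseteq> (\<Union>d\<in>X. Q d)"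
    by (rule compactE_image[OF assms(1), of D Q]) (use PQ in auto)
  show ?thesis
    by (rule that[of "\<Inter> (P ` X)"]) (use X PQ in \<open>auto intro!: open_INT\<close>, blast)
qed

text \<open>Take \<open>r\<close> so small that multiplication by it maps a compact neighbourhood \<open>U\<close> of \<open>0\<close>, together
  with \<open>1\<close>, into an open set \<open>U0 \<inter> P\<close> that stays away from \<open>1\<close>. Then all positive powers of \<open>r\<close> lie in
  \<open>U\<close> and away from \<open>1\<close>. A nonzero cluster point of the powers would make quotients \<open>r ^ m / r ^ n\<close> with
  \<open>m > n\<close> approach \<open>1\<close>, although these are positive powers again. So \<open>0\<close> is the only cluster point.\<close>

lemma exists_topologically_nilpotent:
  obtains r :: "'a :: local_field" where "r \<noteq> 0" "(\<lambda>n. r ^ n) \<longlonglongrightarrow> 0"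
proof -
  obtain U0 U :: "'a set" where U: "open U0" "compact U" "0 \<in> U0" "U0 \<subseteq> U"
    using locally_compact[of 0] by blast
  obtain P Q :: "'a set" where PQ: "open P" "open Q" "0 \<in> P" "1 \<in> Q" "P \<inter> Q = {}"
    using hausdorff[of "0 :: 'a" 1] by auto
  have op: "open (U0 \<inter> P)" "0 \<in> U0 \<inter> P" using U PQ by auto
  have "compact (insert 1 U)" using U by simp
  then obtain V where V: "open V" "0 \<in> V" "\<And>v d. v \<in> V \<Longrightarrow> d \<in> insert 1 U \<Longrightarrow> v * d \<in> U0 \<inter> P"
    using mult_nhd[OF _ op] by metis
  obtain r where r: "r \<in> V" "r \<noteq> 0"
  proof -
    have "V \<noteq> {0}" using V(1) not_open_singleton[of "0 :: 'a"] by metis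
    then show ?thesis using V(2) that by blast
  qed
  have pow: "r ^ Suc n \<in> U0 \<inter> P" for n
  proof (induction n)
    case 0
    then show ?case using V(3)[OF r(1), of 1] by simp
  next
    case (Suc n)
    then have "r ^ Suc n \<in> insert 1 U" using U by blast
    then show ?case using V(3)[OF r(1), of "r ^ Suc n"] by simp
  qed
  have "(\<lambda>n. r ^ n) \<longlonglongrightarrow> 0"
  proof (rule ccontr)
    assume "\<not> ?thesis"
    then obtain W where W: "open W" "0 \<in> W" "\<not> (\<forall>\<^sub>F n in sequentially. r ^ n \<in> W)"
      unfolding tendsto_def by blast
    define F where "F = filtermap (\<lambda>n. r ^ n) (inf sequentially (principal {n. r ^ n \<notin> W \<and> n \<noteq> 0}))"
    have fr: "\<exists>\<^sub>F n in sequentially. r ^ n \<notin> W"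
      using W(3) by (simp add: frequently_def)
    have "F \<noteq> bot"
    proof
      assume "F = bot"
      then have "eventually (\<lambda>_. False) F" by simp
      then have "\<forall>\<^sub>F n in sequentially. \<not> (r ^ n \<notin> W \<and> n \<noteq> 0)"
        unfolding F_def eventually_filtermap eventually_inf_principal by simp
      moreover have "\<forall>\<^sub>F n in sequentially. n \<noteq> (0 :: nat)"
        by (rule eventually_sequentiallyI[of 1]) simp
      ultimately have "\<forall>\<^sub>F n in sequentially. r ^ n \<in> W" by eventually_elim blast
      then show False using W by simp
    qed
    moreover have "F \<le> principal U"
      unfolding F_def le_principal eventually_filtermap eventually_inf_principal
    proof (intro always_eventually allI impI)
      fix n assume "n \<in> {n. r ^ n \<notin> W \<and> n \<noteq> 0}"
      then show "r ^ n \<in> U" using pow[of "n - 1"] U by auto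
    qed
    ultimately obtain x where x: "x \<in> U" "inf (nhds x) F \<noteq> bot"
      using U(2) unfolding compact_filter le_principal by blast
    have meets: "\<exists>n > m. r ^ n \<in> Y \<and> r ^ n \<notin> W" if "open Y" "x \<in> Y" for Y and m :: nat
    proof (rule ccontr)
      assume n: "\<not> ?thesis"
      have "eventually (\<lambda>y. y \<in> Y) (nhds x)" using that by (simp add: eventually_nhds_in_open)
      moreover have "\<forall>\<^sub>F y in F. y \<notin> Y"
        unfolding F_def eventually_filtermap eventually_inf_principal
        by (rule eventually_sequentiallyI[of "Suc m"]) (use n in auto)
      ultimately have "eventually (\<lambda>y. False) (inf (nhds x) F)"
        unfolding eventually_inf by (metis (no_types, lifting))
      then show False using x by (simp add: trivial_limit_def)
    qed
    have x0: "x \<noteq> 0" using meets[OF W(1)] W(2) by blast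
    have "continuous_on (UNIV \<times> {y. y \<noteq> 0}) (\<lambda>p. fst p * inverse (snd p :: 'a))"
      by (intro continuous_intros continuous_on_inverse_field) auto
    moreover have "open (UNIV \<times> {y :: 'a. y \<noteq> 0})"
      by (intro open_Times open_UNIV) (simp add: open_Collect_neq)
    ultimately have "open ((\<lambda>p. fst p * inverse (snd p)) -` Q \<inter> UNIV \<times> {y. y \<noteq> 0})"
      using PQ(2) continuous_on_open_vimage by blast
    moreover have "(x, x) \<in> (\<lambda>p. fst p * inverse (snd p)) -` Q \<inter> UNIV \<times> {y. y \<noteq> 0}"
      using x0 PQ by simp
    ultimately obtain Y1 Y2 where Y: "open Y1" "open Y2" "(x, x) \<in> Y1 \<times> Y2"
       "Y1 \<times> Y2 \<subseteq> (\<lambda>p. fst p * inverse (snd p)) -` Q \<inter> UNIV \<times> {y. y \<noteq> 0}"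
      by (rule open_prod_elim)
    obtain n where n: "r ^ n \<in> Y2" using meets[OF Y(2)] Y(3) by blast
    obtain m where m: "m > n" "r ^ m \<in> Y1" using meets[OF Y(1), of n] Y(3) by blast
    have "r ^ m * inverse (r ^ n) \<in> Q" using Y(4) n m by auto
    also have "r ^ m * inverse (r ^ n) = r ^ Suc (m - n - 1)"
      using m r by (simp add: power_diff flip: divide_inverse)
    finally show False using pow PQ by blast
  qed
  then show ?thesis using that r by blast
qed

text \<open>A point outside a compact neighbourhood \<open>K\<close> of \<open>0\<close> enters \<open>K\<close> after multiplication by a least
  power \<open>r ^ n\<close> of a topologically nilpotent \<open>r\<close>, and then lies in the compact shell \<open>D\<close>, which avoids
  \<open>0\<close>. Its inverse lies in \<open>r ^ n\<close> times the compact set of inverses of \<open>D\<close>, which is small if \<open>n\<close>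
  is large; if \<open>n\<close> is bounded, the point lies in a fixed compact set.\<close>

lemma inverse_near_0_outside_compact:
  fixes U :: "'a :: local_field set"
  assumes "open U" "0 \<in> U"
  obtains C where "compact C" "\<And>x. x \<notin> C \<Longrightarrow> inverse x \<in> U"
proof -
  obtain r :: 'a where r: "r \<noteq> 0" "(\<lambda>n. r ^ n) \<longlonglongrightarrow> 0" by (rule exists_topologically_nilpotent)
  obtain W K :: "'a set" where W: "open W" "compact K" "0 \<in> W" "W \<subseteq> K"
    using locally_compact[of 0] by blast
  define D where "D = K - (*) r ` W"
  have "open ((*) r ` W)"
  proof -
    have "(*) r ` W = (\<lambda>x. inverse r * x) -` W"
      using r(1) by (auto simp: image_iff field_simps intro!: bexI[of _ "_ / r"])
    then show ?thesis using W(1) by (auto intro!: open_vimage continuous_intros)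
  qed
  then have D: "compact D" unfolding D_def using W(2) by (simp add: compact_diff)
  have D0: "0 \<notin> D" using W(3) by (auto simp: D_def image_iff)
  have "compact (inverse ` D)"
    using D D0 by (intro compact_continuous_image continuous_on_inverse_field continuous_on_id) auto
  then obtain V where V: "open V" "0 \<in> V" "\<And>v d. v \<in> V \<Longrightarrow> d \<in> inverse ` D \<Longrightarrow> v * d \<in> U"
    using mult_nhd[OF _ assms] by metis
  have "\<forall>\<^sub>F n in sequentially. r ^ n \<in> V" using r(2) V unfolding tendsto_def by blast
  then obtain n0 where n0: "\<And>n. n \<ge> n0 \<Longrightarrow> r ^ n \<in> V" unfolding eventually_sequentially by blast
  define C where "C = (\<Union>n\<le>n0. (*) (inverse (r ^ n)) ` K)"
  have "compact C" unfolding C_def by (intro compact_UN compact_mult_image W) simp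
  moreover have "inverse x \<in> U" if x: "x \<notin> C" for x
  proof -
    have inC: "x \<in> C" if "r ^ n * x \<in> K" "n \<le> n0" for n
      unfolding C_def using that r by (auto intro!: exI[of _ n] image_eqI[of _ _ "r ^ n * x"] simp: field_simps)
    have "(\<lambda>n. r ^ n * x) \<longlonglongrightarrow> 0 * x" by (intro tendsto_mult r tendsto_const)
    then have "\<forall>\<^sub>F n in sequentially. r ^ n * x \<in> W" using W unfolding tendsto_def by simp
    then have ex: "\<exists>n. r ^ n * x \<in> K" using W(4) unfolding eventually_sequentially by blast
    define n where "n = (LEAST n. r ^ n * x \<in> K)"
    have n: "r ^ n * x \<in> K" unfolding n_def using ex by (rule LeastI_ex)
    then have gt: "n > n0" using inC x by (meson not_le)
    have "r ^ (n - 1) * x \<notin> K" using not_less_Least[of "n - 1" "\<lambda>n. r ^ n * x \<in> K"] gt unfolding n_def by simp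
    moreover have "r ^ n * x = r * (r ^ (n - 1) * x)" using gt by (cases n) auto
    ultimately have "r ^ n * x \<in> D" using n r W(4) by (auto simp: D_def)
    then have "inverse (r ^ n * x) \<in> inverse ` D" by (rule imageI)
    then have "r ^ n * inverse (r ^ n * x) \<in> U" using V(3)[OF n0[of n]] gt by simp
    then show ?thesis using r by (simp add: mult.assoc[symmetric])
  qed
  ultimately show ?thesis using that by blast
qed

lemma self_or_inverse_in_compact:
  obtains C :: "'a :: local_field set" where "compact C" "\<And>x. x \<in> C \<or> inverse x \<in> C"
proof -
  obtain W K :: "'a set" where W: "open W" "compact K" "0 \<in> W" "W \<subseteq> K"
    using locally_compact[of 0] by blast
  obtain C where C: "compact C" "\<And>x. x \<notin> C \<Longrightarrow> inverse x \<in> W"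
    using inverse_near_0_outside_compact[OF W(1,3)] by metis
  have "compact (C \<union> K)" using C W by (simp add: compact_Un)
  moreover have "x \<in> C \<union> K \<or> inverse x \<in> C \<union> K" for x using C W by blast
  ultimately show ?thesis by (rule that)
qed

lemma bounded_of_bounded_power:
  fixes C :: "'a :: local_field set"
  assumes "compact C" 
  obtains D where "compact D" "\<And>x. x ^ n \<in> C \<Longrightarrow> n \<noteq> 0 \<Longrightarrow> x \<in> D"
proof -
  obtain P Q :: "'a set" where PQ: "open P" "open Q" "0 \<in> P" "1 \<in> Q" "P \<inter> Q = {}"
    using hausdorff[of "0 :: 'a" 1] by auto
  obtain V where V: "open V" "0 \<in> V" "\<And>v d. v \<in> V \<Longrightarrow> d \<in> C \<Longrightarrow> v * d \<in> P"
    using mult_nhd[OF assms PQ(1,3)] by metis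
  show ?thesis
  proof (cases "n = 0")
    case False
    have cont: "continuous_on UNIV (\<lambda>x :: 'a. x ^ m)" for m
      by (induction m) (auto intro!: continuous_intros)
    have "open ((\<lambda>x. x ^ n) -` V)" using V(1) cont by (rule open_vimage)
    moreover have "0 \<in> (\<lambda>x. x ^ n) -` V" using V(2) False by (simp add: zero_power)
    ultimately obtain D where D: "compact D" "\<And>x. x \<notin> D \<Longrightarrow> inverse x \<in> (\<lambda>x. x ^ n) -` V"
      using inverse_near_0_outside_compact by metis
    have "x \<in> insert 0 D" if "x ^ n \<in> C" for x
    proof (rule ccontr)
      assume x: "x \<notin> insert 0 D"
      then have "inverse x ^ n * x ^ n \<in> P" using D V that by auto
      then show False using x PQ by (auto simp: power_inverse)
    qed
    then show ?thesis using that[of "insert 0 D"] D by auto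
  qed (use that[of "{}"] in auto)
qed

section \<open>The topology of matrices\<close>

lemma continuous_on_entry [continuous_intros]:
  "continuous_on A (\<lambda>X :: 'a :: topological_space ^ 'm ^ 'n. X $ i $ j)"
  unfolding continuous_on_def by (auto intro!: tendsto_vec_nth)

lemma continuous_on_matrixI:
  fixes f :: "'b :: topological_space \<Rightarrow> 'a :: topological_space ^ 'm ^ 'n"
  assumes "\<And>i j. continuous_on A (\<lambda>x. f x $ i $ j)"
  shows "continuous_on A f"
  using assms unfolding continuous_on_def by (auto intro!: vec_tendstoI)

lemma matrix_neighbourhood:
  fixes Q :: "('a :: topological_field ^ 'n ^ 'm) set"
  assumes "open Q" "Y \<in> Q"
  obtains W where "open W" "0 \<in> W" "\<And>X. (\<And>i j. X $ i $ j - Y $ i $ j \<in> W) \<Longrightarrow> X \<in> Q"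
proof -
  obtain A where A: "\<And>i. open (A i)" "\<And>i. Y $ i \<in> A i" "\<And>X. (\<And>i. X $ i \<in> A i) \<Longrightarrow> X \<in> Q"
    using assms unfolding open_vec_def by metis
  have "\<exists>B. (\<forall>j. open (B j) \<and> Y $ i $ j \<in> B j) \<and> (\<forall>x. (\<forall>j. x $ j \<in> B j) \<longrightarrow> x \<in> A i)" for i
    using A(1,2)[of i] unfolding open_vec_def by blast
  then obtain B where B: "\<And>i j. open (B i j)" "\<And>i j. Y $ i $ j \<in> B i j"
    "\<And>i x. (\<And>j. x $ j \<in> B i j) \<Longrightarrow> x \<in> A i" by metis
  let ?W = "\<Inter>i. \<Inter>j. (\<lambda>x. x + Y $ i $ j) -` B i j"
  show ?thesis
  proof (rule that[of ?W])
    show "open ?W" by (intro open_INT finite open_vimage ballI B continuous_intros)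
    show "0 \<in> ?W" using B(2) by simp
    fix X :: "'a ^ 'n ^ 'm" assume X: "\<And>i j. X $ i $ j - Y $ i $ j \<in> ?W"
    show "X \<in> Q"
    proof (intro A(3) B(3))
      fix i j show "X $ i $ j \<in> B i j" using X[of i j] by (auto dest!: spec[of _ i] spec[of _ j])
    qed
  qed
qed

lemma compact_matrices:
  fixes C :: "'a :: topological_space set"
  assumes "compact C"
  shows "compact {X :: 'a ^ 'n ^ 'm. \<forall>i j. X $ i $ j \<in> C}"
proof -
  have "compactin (product_topology (\<lambda>_. euclidean) UNIV) (PiE (UNIV :: ('m \<times> 'n) set) (\<lambda>_. C))"
    using assms by (simp add: compactin_PiE)
  then have "compact (PiE (UNIV :: ('m \<times> 'n) set) (\<lambda>_. C))"
    by (simp add: euclidean_product_topology)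
  then have "compact ((\<lambda>f. \<chi> i j. f (i, j)) ` (PiE (UNIV :: ('m \<times> 'n) set) (\<lambda>_. C)))"
  proof (rule compact_continuous_image[rotated])
    show "continuous_on (PiE (UNIV :: ('m \<times> 'n) set) (\<lambda>_. C)) (\<lambda>f. \<chi> i j. f (i, j))"
      by (rule continuous_on_matrixI, rule continuous_on_subset[OF _ subset_UNIV])
         (simp add: continuous_on_product_coordinates)
  qed
  also have "(\<lambda>f. \<chi> i j. f (i, j)) ` (PiE (UNIV :: ('m \<times> 'n) set) (\<lambda>_. C)) = {X :: 'a ^ 'n ^ 'm. \<forall>i j. X $ i $ j \<in> C}"
  proof safe
    fix X :: "'a ^ 'n ^ 'm" assume "\<forall>i j. X $ i $ j \<in> C"
    then show "X \<in> (\<lambda>f. \<chi> i j. f (i, j)) ` (PiE (UNIV :: ('m \<times> 'n) set) (\<lambda>_. C))"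
      by (intro image_eqI[of _ _ "\<lambda>p. X $ fst p $ snd p"]) (auto simp: vec_eq_iff)
  qed auto
  finally show ?thesis .
qed

section \<open>Subfields and their closures\<close>

lemma is_subfieldD:
  assumes "is_subfield F"
  shows "0 \<in> F" "1 \<in> F" "\<And>x y. x \<in> F \<Longrightarrow> y \<in> F \<Longrightarrow> x + y \<in> F" "\<And>x y. x \<in> F \<Longrightarrow> y \<in> F \<Longrightarrow> x * y \<in> F"
    "\<And>x. x \<in> F \<Longrightarrow> - x \<in> F" "\<And>x. x \<in> F \<Longrightarrow> inverse x \<in> F" "\<And>x y. x \<in> F \<Longrightarrow> y \<in> F \<Longrightarrow> x - y \<in> F"
    "\<And>x y. x \<in> F \<Longrightarrow> y \<in> F \<Longrightarrow> x / y \<in> F"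
proof -
  note F = assms[unfolded is_subfield_def]
  show inv: "inverse x \<in> F" if "x \<in> F" for x using F that by (cases "x = 0") auto
  show "x - y \<in> F" if "x \<in> F" "y \<in> F" for x y
    using F that(1) bspec[of F "\<lambda>x. - x \<in> F", OF _ that(2)] unfolding diff_conv_add_uminus by metis
  show "x / y \<in> F" if "x \<in> F" "y \<in> F" for x y
    using F inv[OF that(2)] that(1) unfolding divide_inverse by metis
qed (use assms in \<open>auto simp: is_subfield_def\<close>)

lemma is_subfield_UNIV: "is_subfield UNIV"
  by (simp add: is_subfield_def)

lemma closure_point_meets:
  assumes "x \<in> closure A" "open U" "x \<in> U"
  obtains y where "y \<in> A" "y \<in> U"
  using assms open_Int_closure_eq_empty[of U A] by blast

lemma is_subfield_closure:
  fixes F :: "'a :: topological_field set"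
  assumes F: "is_subfield F"
  shows "is_subfield (closure F)"
proof -
  note F' = is_subfieldD[OF F]
  have "f x y \<in> closure F" if "x \<in> closure F" "y \<in> closure F"
    and "continuous_on UNIV (\<lambda>p. f (fst p) (snd p))" "\<And>x y. x \<in> F \<Longrightarrow> y \<in> F \<Longrightarrow> f x y \<in> F" for x y f
  proof -
    have "(\<lambda>p. f (fst p) (snd p)) ` closure (F \<times> F) \<subseteq> closure F"
      using that(3,4) closure_subset
      by (intro image_closure_subset) (auto intro: continuous_on_subset subsetD[OF closure_subset])
    then show ?thesis using that(1,2) by (force simp: closure_Times)
  qed
  note bin = this
  have "x + y \<in> closure F" "x * y \<in> closure F" if "x \<in> closure F" "y \<in> closure F" for x y
    using that F' by (auto intro!: bin[of x y "(+)"] bin[of x y "(*)"] continuous_intros)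
  moreover have "- x \<in> closure F" if "x \<in> closure F" for x
  proof -
    have "continuous_on UNIV (\<lambda>p :: 'a \<times> 'a. fst p - snd p)" by (intro continuous_intros)
    moreover have "0 \<in> closure F" using F'(1) closure_subset by blast
    ultimately have "0 - x \<in> closure F" using bin[of 0 x "(-)", OF _ that] F'(7) by blast
    then show ?thesis by simp
  qed
  moreover have "inverse x \<in> closure F" if x: "x \<in> closure F" "x \<noteq> 0" for x
  proof (rule ccontr)
    assume "inverse x \<notin> closure F"
    then have "x \<in> inverse -` (- closure F) \<inter> {y. y \<noteq> 0}" using x by simp
    moreover have "open (inverse -` (- closure F) \<inter> {y. y \<noteq> 0})"
    proof -
      have "continuous_on {y :: 'a. y \<noteq> 0} inverse"
        by (intro continuous_on_inverse_field continuous_on_id) auto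
      moreover have "open {y :: 'a. y \<noteq> 0}" by (simp add: open_Collect_neq)
      ultimately have "open ({y. y \<noteq> 0} \<inter> inverse -` (- closure F))"
        by (rule continuous_open_preimage) (simp add: open_closed)
      then show ?thesis by (simp add: Int_commute)
    qed
    ultimately obtain y where y: "y \<in> F" "y \<in> inverse -` (- closure F) \<inter> {y. y \<noteq> 0}"
      using closure_point_meets[OF x(1)] by metis
    then have "inverse y \<in> closure F" using F'(6)[OF y(1)] closure_subset[of F] by (rule_tac subsetD)
    then show False using y(2) by simp
  qed
  moreover have "0 \<in> closure F" "1 \<in> closure F" using F'(1,2) closure_subset[of F] by blast+
  ultimately show ?thesis by (simp add: is_subfield_def)
qed

lemma is_subfield_prod: "is_subfield F \<Longrightarrow> (\<And>i. i \<in> I \<Longrightarrow> f i \<in> F) \<Longrightarrow> prod f I \<in> F"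
  by (induction I rule: infinite_finite_induct) (auto intro: is_subfieldD)

section \<open>Special linear groups\<close>

abbreviation SL_top :: "('a :: topological_field ^ 'n ^ 'n) topology" where
  "SL_top \<equiv> top_of_set (carrier (SL UNIV))"

lemma tg_SL: "topological_group (SL UNIV :: ('a :: topological_field ^ 'n ^ 'n) monoid) SL_top"
  by (rule topological_group_SL[OF is_subfield_UNIV])

lemma SL_carrier_update: "SL F = (SL UNIV)\<lparr>carrier := carrier (SL F)\<rparr>"
  "ST_plus F = (SL UNIV)\<lparr>carrier := carrier (ST_plus F)\<rparr>"
  by (simp_all add: SL_def ST_plus_def)

lemma group_SL: "group (SL UNIV :: ('a :: topological_field ^ 'n ^ 'n) monoid)"
  using tg_SL[where 'a = 'a and 'n = 'n] unfolding topological_group_def by blast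

lemma subgroup_SL:
  fixes F :: "'a :: topological_field set"
  assumes "is_subfield F"
  shows "subgroup (carrier (SL F)) (SL UNIV :: ('a ^ 'n ^ 'n) monoid)"
proof (rule group.group_incl_imp_subgroup[OF group_SL])
  show "group ((SL UNIV :: ('a ^ 'n ^ 'n) monoid)\<lparr>carrier := carrier (SL F)\<rparr>)"
    using topological_group_SL[OF assms, where 'n = 'n]
    unfolding topological_group_def SL_carrier_update(1)[symmetric] by blast
qed auto

lemma subgroup_ST:
  fixes F :: "'a :: topological_field set"
  assumes "is_subfield F"
  shows "subgroup (carrier (ST_plus F)) (SL UNIV :: ('a ^ 'n :: {finite, wellorder} ^ 'n :: {finite, wellorder}) monoid)"
proof (rule group.group_incl_imp_subgroup[OF group_SL])
  show "group ((SL UNIV :: ('a ^ 'n :: {finite, wellorder} ^ 'n :: {finite, wellorder}) monoid)\<lparr>carrier := carrier (ST_plus F)\<rparr>)"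
    using topological_group_ST_plus[OF assms, where 'n = 'n]
    unfolding topological_group_def SL_carrier_update(2)[symmetric] by blast
qed auto

lemma subtopology_SL_top:
  "subtopology SL_top (carrier (SL F)) = top_of_set (carrier (SL F))"
  "subtopology SL_top (carrier (ST_plus F)) = top_of_set (carrier (ST_plus F))"
  by (auto simp: subtopology_subtopology intro!: arg_cong[where f = top_of_set])

lemma SL_top_neighbourhood:
  fixes Y :: "'a :: topological_field ^ 'n ^ 'n"
  assumes "openin SL_top Q" "Y \<in> Q"
  obtains W where "open W" "0 \<in> W"
    "\<And>X. det X = 1 \<Longrightarrow> (\<And>i j. X $ i $ j - Y $ i $ j \<in> W) \<Longrightarrow> X \<in> Q"
proof -
  obtain R where R: "open R" "Q = carrier (SL UNIV) \<inter> R"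
    using assms(1) by (auto simp: openin_open)
  have "Y \<in> R" using assms(2) R by blast
  from matrix_neighbourhood[OF R(1) this] obtain W where
    "open W" "0 \<in> W" "\<And>X. (\<And>i j. X $ i $ j - Y $ i $ j \<in> W) \<Longrightarrow> X \<in> R" by blast
  then show ?thesis using R by (intro that[of W]) auto
qed

lemma openin_SL_entry:
  fixes f :: "'a :: topological_field ^ 'n ^ 'n \<Rightarrow> 'a"
  assumes "continuous_on UNIV f" "open W"
  shows "openin SL_top {X \<in> carrier (SL UNIV). f X \<in> W}"
proof -
  have "open (f -` W)" using assms(2,1) by (rule open_vimage)
  moreover have "{X \<in> carrier (SL UNIV). f X \<in> W} = carrier (SL UNIV) \<inter> f -` W" by auto
  ultimately show ?thesis by (auto simp: openin_open)
qed

lemma compactin_SL: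
  fixes C :: "'a :: topological_field set"
  assumes "compact C"
  shows "compactin SL_top {X :: 'a ^ 'n ^ 'n. det X = 1 \<and> (\<forall>i j. X $ i $ j \<in> C)}"
proof -
  have "closed ((\<lambda>X :: 'a ^ 'n ^ 'n. det X) -` {1})"
    by (intro closed_vimage closed_singleton continuous_on_det continuous_intros)
  from closed_Int_compact[OF this compact_matrices[OF assms]]
  have "compact ((\<lambda>X :: 'a ^ 'n ^ 'n. det X) -` {1} \<inter> {X. \<forall>i j. X $ i $ j \<in> C})" .
  also have "(\<lambda>X :: 'a ^ 'n ^ 'n. det X) -` {1} \<inter> {X. \<forall>i j. X $ i $ j \<in> C}
     = {X. det X = 1 \<and> (\<forall>i j. X $ i $ j \<in> C)}" by auto
  finally show ?thesis by (auto simp: compactin_subtopology)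
qed

subsection \<open>Transvections\<close>

definition transvection :: "'n \<Rightarrow> 'n \<Rightarrow> 'a \<Rightarrow> 'a :: field ^ 'n ^ 'n" where
  "transvection i j x = (\<chi> k l. (if k = l then 1 else 0) + (if k = i \<and> l = j then x else 0))"

lemma transvection_entry:
  "transvection i j x $ k $ l = (if k = l then 1 else 0) + (if k = i \<and> l = j then x else 0)"
  by (simp add: transvection_def)

lemma transvection_mult_entry:
  "(transvection i j x ** A) $ k $ l = A $ k $ l + (if k = i then x * A $ j $ l else 0)"
proof -
  have "(transvection i j x ** A) $ k $ l
     = (\<Sum>r\<in>UNIV. (if k = r then A $ r $ l else 0) + (if r = j then (if k = i then x * A $ j $ l else 0) else 0))"
    unfolding matrix_matrix_mult_def transvection_def vec_lambda_beta
    by (intro sum.cong refl) (simp add: algebra_simps)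
  then show ?thesis by (simp add: sum.distrib)
qed

lemma mult_transvection_entry:
  "(A ** transvection i j x) $ k $ l = A $ k $ l + (if l = j then A $ k $ i * x else 0)"
proof -
  have "(A ** transvection i j x) $ k $ l
     = (\<Sum>r\<in>UNIV. (if r = l then A $ k $ r else 0) + (if r = i then (if l = j then A $ k $ i * x else 0) else 0))"
    unfolding matrix_matrix_mult_def transvection_def vec_lambda_beta
    by (intro sum.cong refl) (simp add: algebra_simps)
  then show ?thesis by (simp add: sum.distrib)
qed

lemma transvection_0 [simp]: "transvection i j 0 = mat 1"
  by (simp add: vec_eq_iff transvection_entry mat_def)

lemma transvection_add:
  "i \<noteq> j \<Longrightarrow> transvection i j x ** transvection i j y = transvection i j (x + y)"
  by (auto simp: vec_eq_iff transvection_mult_entry transvection_entry)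

lemma det_transvection [simp]: "i \<noteq> j \<Longrightarrow> det (transvection i j x) = 1"
proof -
  assume ij: "i \<noteq> j"
  have "transvection i j x = (\<chi> k. if k = i then row i (mat 1) + x *s row j (mat 1) else row k (mat 1))"
    by (auto simp: vec_eq_iff transvection_entry row_def mat_def)
  then show ?thesis using det_row_operation[OF ij, of "mat 1" x] by simp
qed

lemma transvection_SL:
  "is_subfield F \<Longrightarrow> i \<noteq> j \<Longrightarrow> x \<in> F \<Longrightarrow> transvection i j x \<in> carrier (SL F)"
  by (auto simp: transvection_entry intro: is_subfieldD)

lemma transvection_ST:
  "is_subfield F \<Longrightarrow> i < j \<Longrightarrow> x \<in> F \<Longrightarrow> transvection i j x \<in> carrier (ST_plus F)"
  using transvection_SL[of F i j x] by (auto simp: transvection_entry)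

lemma mult_SL: "is_subfield F \<Longrightarrow> A \<in> carrier (SL F) \<Longrightarrow> B \<in> carrier (SL F) \<Longrightarrow> A ** B \<in> carrier (SL F)"
  by (simp add: det_mul matrix_mult_in_subfield)

lemma compactin_transvections:
  fixes C :: "'a :: topological_field set"
  assumes "compact C" "i \<noteq> j"
  shows "compactin SL_top ((transvection i j :: 'a \<Rightarrow> 'a ^ 'n ^ 'n) ` C)"
proof -
  have "continuous_on UNIV (transvection i j :: 'a \<Rightarrow> 'a ^ 'n ^ 'n)"
    unfolding transvection_def
    by (rule continuous_on_matrixI, rename_tac k l, case_tac "k = i \<and> l = j") (auto intro!: continuous_intros)
  then have "compact ((transvection i j :: 'a \<Rightarrow> 'a ^ 'n ^ 'n) ` C)"
    using assms(1) by (intro compact_continuous_image) (auto intro: continuous_on_subset)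
  then show ?thesis using assms(2) by (auto simp: compactin_subtopology)
qed

subsection \<open>Approximation by matrices over a subfield\<close>

text \<open>Entrywise approximation of \<open>Y\<close> spoils the determinant. It is repaired by recomputing the last
  diagonal entry from the others, which changes little because \<open>Y\<close> has determinant one.\<close>

lemma closure_ST_plus:
  fixes F :: "'a :: topological_field set" and Y :: "'a ^ 'n :: {finite, wellorder} ^ 'n :: {finite, wellorder}"
  assumes F: "is_subfield F" and Y: "\<And>i j. Y $ i $ j \<in> closure F" "\<And>i j. j < i \<Longrightarrow> Y $ i $ j = 0" "det Y = 1"
  shows "Y \<in> SL_top closure_of carrier (ST_plus F)"
  unfolding in_closure_of
proof (intro conjI allI impI)
  show "Y \<in> topspace SL_top" using Y by simp
  fix Q assume "Y \<in> Q \<and> openin SL_top Q"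
  then have Q: "Y \<in> Q" "openin SL_top Q" by auto
  obtain R where R: "open R" "Q = carrier (SL UNIV) \<inter> R" using Q(2) by (auto simp: openin_open)
  define m :: 'n where "m = Max UNIV"
  define d where "d X = (\<Prod>i\<in>UNIV - {m}. X $ i $ i)" for X :: "'a ^ 'n :: {finite, wellorder} ^ 'n :: {finite, wellorder}"
  define f where "f X = (\<chi> i j. if j < i then 0 else if i = m \<and> j = m then inverse (d X) else X $ i $ j)"
    for X :: "'a ^ 'n :: {finite, wellorder} ^ 'n :: {finite, wellorder}"
  have le: "i \<le> m" for i by (simp add: m_def)
  have det_eq: "det X = d X * X $ m $ m" if "\<And>i j. j < i \<Longrightarrow> X $ i $ j = 0" for X :: "'a ^ 'n :: {finite, wellorder} ^ 'n :: {finite, wellorder}"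
    using that by (simp add: det_upperdiagonal d_def prod.remove[of UNIV m] mult.commute)
  have cd: "continuous_on A d" for A
  proof -
    have "continuous_on A (\<lambda>X :: 'a ^ 'n :: {finite, wellorder} ^ 'n :: {finite, wellorder}. \<Prod>i\<in>I. X $ i $ i)" if "finite I" for I
      using that by (induction I rule: finite_induct) (auto intro!: continuous_intros)
    then show ?thesis unfolding d_def by simp
  qed
  have "d Y * Y $ m $ m = 1" using det_eq[of Y] Y by simp
  then have dY: "d Y \<noteq> 0" "inverse (d Y) = Y $ m $ m" by (auto intro: inverse_unique)
  have fY: "f Y = Y" using Y(2) dY by (auto simp: f_def vec_eq_iff)
  have cf: "continuous_on {X. d X \<noteq> 0} f"
  proof (rule continuous_on_matrixI)
    fix i j
    consider "j < i" | "\<not> j < i" "i = m" "j = m" | "\<not> j < i" "\<not> (i = m \<and> j = m)" by blast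
    then show "continuous_on {X. d X \<noteq> 0} (\<lambda>X. f X $ i $ j)"
    proof cases
      case 2
      then show ?thesis by (simp add: f_def) (intro continuous_on_inverse_field cd, simp)
    next
      case 3
      then have eq: "f X $ i $ j = X $ i $ j" for X by (auto simp: f_def)
      show ?thesis unfolding eq by (rule continuous_on_entry)
    qed (simp add: f_def)
  qed
  have "open {X. d X \<noteq> 0}" by (intro open_Collect_neq cd continuous_on_const)
  then have "open ({X. d X \<noteq> 0} \<inter> f -` R)" using continuous_open_preimage[OF cf _ R(1)] by blast
  then have "open (f -` R \<inter> {X. d X \<noteq> 0})" by (simp add: Int_commute)
  moreover have "Y \<in> f -` R \<inter> {X. d X \<noteq> 0}" using fY dY Q R by auto
  ultimately obtain W where W: "open W" "0 \<in> W"
    "\<And>X. (\<And>i j. X $ i $ j - Y $ i $ j \<in> W) \<Longrightarrow> X \<in> f -` R \<inter> {X. d X \<noteq> 0}"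
    using matrix_neighbourhood by metis
  have "\<exists>x. x \<in> F \<and> x - Y $ i $ j \<in> W" for i j
  proof -
    have "open ((\<lambda>x. x - Y $ i $ j) -` W)" by (intro open_vimage W continuous_intros)
    moreover have "Y $ i $ j \<in> (\<lambda>x. x - Y $ i $ j) -` W" using W by simp
    ultimately show ?thesis using closure_point_meets[OF Y(1)[of i j]] by blast
  qed
  then obtain x where x: "\<And>i j. x i j \<in> F" "\<And>i j. x i j - Y $ i $ j \<in> W" by metis
  define X where "X = (\<chi> i j. x i j)"
  have X: "f X \<in> R" "d X \<noteq> 0" using W(3)[of X] x(2) by (auto simp: X_def)
  have "d X \<in> F" unfolding d_def X_def using x F by (auto intro: is_subfield_prod)
  then have "f X $ i $ j \<in> F" for i j
    using x is_subfieldD[OF F] by (auto simp: f_def X_def)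
  moreover have up: "f X $ i $ j = 0" if "j < i" for i j using that by (simp add: f_def)
  moreover have "det (f X) = 1"
  proof -
    have "d (f X) = d X" unfolding d_def by (intro prod.cong) (auto simp: f_def)
    moreover have "f X $ m $ m = inverse (d X)" by (simp add: f_def)
    ultimately show ?thesis using det_eq[of "f X"] up X by simp
  qed
  ultimately show "\<exists>y. y \<in> carrier (ST_plus F) \<and> y \<in> Q"
    using X R by (intro exI[of _ "f X"]) auto
qed

lemma closure_entries:
  fixes F :: "'a :: topological_field set" and Y :: "'a ^ 'n ^ 'n"
  assumes "Y \<in> SL_top closure_of carrier (SL F)"
  shows "Y $ i $ j \<in> closure F" "det Y = 1"
proof -
  show "det Y = 1" using assms by (auto simp: in_closure_of)
  show "Y $ i $ j \<in> closure F"
  proof (rule ccontr)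
    assume "Y $ i $ j \<notin> closure F"
    then have "Y \<in> {X \<in> carrier (SL UNIV). X $ i $ j \<in> - closure F}" using assms by (auto simp: in_closure_of)
    moreover have "openin SL_top {X \<in> carrier (SL UNIV). X $ i $ j \<in> - closure F}"
      by (intro openin_SL_entry continuous_intros) auto
    ultimately obtain X where "X \<in> carrier (SL F)" "X $ i $ j \<in> - closure F"
      using closure_meets[OF assms] by blast
    then show False using closure_subset[of F] by auto
  qed
qed

lemma closure_unipotent_pattern:
  fixes F :: "'a :: topological_field set" and Y :: "'a ^ 'n :: {finite, wellorder} ^ 'n :: {finite, wellorder}"
  assumes P: "\<And>i j. (i, j) \<in> P \<Longrightarrow> i < j" and Y: "\<And>i j. Y $ i $ j \<in> closure F"
    and YP: "\<And>i j. (i, j) \<notin> P \<Longrightarrow> Y $ i $ j = (if i = j then 1 else 0)" and F: "is_subfield F"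
  shows "Y \<in> SL_top closure_of {X \<in> carrier (ST_plus F). \<forall>i j. (i, j) \<notin> P \<longrightarrow> X $ i $ j = (if i = j then 1 else 0)}"
  unfolding in_closure_of
proof (intro conjI allI impI)
  have det1: "det X = 1 \<and> (\<forall>i j. j < i \<longrightarrow> X $ i $ j = 0)"
    if XP: "\<And>i j. (i, j) \<notin> P \<Longrightarrow> X $ i $ j = (if i = j then 1 else 0)" for X :: "'a ^ 'n :: {finite, wellorder} ^ 'n :: {finite, wellorder}"
  proof -
    have up: "X $ i $ j = 0" if "j < i" for i j
      using that P[of i j] XP[of i j] by (metis order_less_asym order_less_irrefl)
    moreover have "X $ i $ i = 1" for i
      using P[of i i] XP[of i i] by auto
    ultimately show ?thesis by (simp add: det_upperdiagonal)
  qed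
  show "Y \<in> topspace SL_top" using det1[OF YP] by simp
  fix Q assume "Y \<in> Q \<and> openin SL_top Q"
  then have Q: "Y \<in> Q" "openin SL_top Q" by auto
  obtain W where W: "open W" "0 \<in> W" "\<And>X. det X = 1 \<Longrightarrow> (\<And>i j. X $ i $ j - Y $ i $ j \<in> W) \<Longrightarrow> X \<in> Q"
    using SL_top_neighbourhood[OF Q(2,1)] by metis
  have "\<exists>x. x \<in> F \<and> x - Y $ i $ j \<in> W" for i j
  proof -
    have "open ((\<lambda>x. x - Y $ i $ j) -` W)" by (intro open_vimage W continuous_intros)
    moreover have "Y $ i $ j \<in> (\<lambda>x. x - Y $ i $ j) -` W" using W by simp
    ultimately show ?thesis using closure_point_meets[OF Y[of i j]] by blast
  qed
  then obtain x where x: "\<And>i j. x i j \<in> F" "\<And>i j. x i j - Y $ i $ j \<in> W" by metis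
  define X where "X = (\<chi> i j. if (i, j) \<in> P then x i j else if i = j then 1 else 0)"
  have XP: "X $ i $ j = (if i = j then 1 else 0)" if "(i, j) \<notin> P" for i j using that by (simp add: X_def)
  have "X \<in> Q" using det1[of X] XP YP x W(2) by (intro W(3)) (auto simp: X_def)
  moreover have "X \<in> carrier (ST_plus F)"
    using det1[of X] XP x is_subfieldD[OF F] by (auto simp: X_def)
  ultimately show "\<exists>y. y \<in> {X \<in> carrier (ST_plus F). \<forall>i j. (i, j) \<notin> P \<longrightarrow> X $ i $ j = (if i = j then 1 else 0)} \<and> y \<in> Q"
    using XP by (intro exI[of _ X] conjI CollectI) blast+
qed

section \<open>Elimination over a local field\<close>

text \<open>The entry at \<open>(i, j)\<close> is cleared with the pivot at \<open>(j, j)\<close>. The multiplier is the quotient of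
  the two entries; if it is not in the compact set, then its inverse is, and the two rows are exchanged
  (up to a sign, by \<open>w\<close>) before clearing.\<close>

lemma bounded_elimination_step:
  fixes F :: "'a :: local_field set" and i j :: "'n :: finite"
  assumes F: "is_subfield F" and ij: "i \<noteq> j"
  obtains D where "compactin SL_top D"
    "\<And>A :: 'a ^ 'n ^ 'n. A \<in> carrier (SL F) \<Longrightarrow> \<exists>k\<in>D \<inter> carrier (SL F). \<exists>B\<in>carrier (SL F).
      A = k ** B \<and> B $ i $ j = 0 \<and> (\<forall>r l. r \<noteq> i \<longrightarrow> r \<noteq> j \<longrightarrow> B $ r $ l = A $ r $ l) \<and>
      (\<forall>l. A $ i $ l = 0 \<longrightarrow> A $ j $ l = 0 \<longrightarrow> B $ i $ l = 0 \<and> B $ j $ l = 0)"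
proof -
  note F' = is_subfieldD[OF F]
  obtain C0 :: "'a set" where C0: "compact C0" "\<And>x. x \<in> C0 \<or> inverse x \<in> C0"
    using self_or_inverse_in_compact by blast
  define C where "C = insert 0 C0 \<union> (*) (- 1) ` insert 0 C0"
  have C: "compact C" unfolding C_def using C0 by (intro compact_Un compact_mult_image) auto
  let ?e = "transvection i j :: 'a \<Rightarrow> 'a ^ 'n ^ 'n" and ?f = "transvection j i :: 'a \<Rightarrow> 'a ^ 'n ^ 'n"
  define w where "w = ?f (-1) ** ?e 1 ** ?f (-1)"
  have ji: "j \<noteq> i" using ij by simp
  have eF: "?e x \<in> carrier (SL F)" "?f x \<in> carrier (SL F)" if "x \<in> F" for x
    using transvection_SL[OF F ij that] transvection_SL[OF F ji that] .
  have w: "w \<in> carrier (SL F)" unfolding w_def using F' by (intro mult_SL[OF F] eF) auto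
  have w': "w \<in> carrier (SL UNIV)" using w by auto
  define D where "D = {a ** b |a b. a \<in> {mat 1, w} \<and> b \<in> ?e ` C}"
  show ?thesis
  proof (rule that)
    have "compactin SL_top {mat 1, w}"
      using w' by (intro finite_imp_compactin) auto
    from compactin_product_set[OF tg_SL this compactin_transvections[OF C ij]]
    show "compactin SL_top D" by (simp add: D_def)
    fix A :: "'a ^ 'n ^ 'n" assume A: "A \<in> carrier (SL F)"
    then have AF: "A $ k $ l \<in> F" for k l by simp
    let ?x = "A $ j $ j" and ?y = "A $ i $ j"
    show "\<exists>k\<in>D \<inter> carrier (SL F). \<exists>B\<in>carrier (SL F).
      A = k ** B \<and> B $ i $ j = 0 \<and> (\<forall>r l. r \<noteq> i \<longrightarrow> r \<noteq> j \<longrightarrow> B $ r $ l = A $ r $ l) \<and>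
      (\<forall>l. A $ i $ l = 0 \<longrightarrow> A $ j $ l = 0 \<longrightarrow> B $ i $ l = 0 \<and> B $ j $ l = 0)"
    proof (cases "?y = 0 \<or> ?x \<noteq> 0 \<and> ?y / ?x \<in> C0")
      case True
      define c where "c = (if ?y = 0 then 0 else ?y / ?x)"
      have cF: "c \<in> F" using AF F' by (simp add: c_def)
      have cC: "c \<in> C" using True by (auto simp: c_def C_def)
      define B where "B = ?e (- c) ** A"
      have "?e c ** B = A"
        unfolding B_def matrix_mul_assoc transvection_add[OF ij] by simp
      moreover have "mat 1 ** ?e c \<in> D" unfolding D_def using cC by blast
      then have "?e c \<in> D \<inter> carrier (SL F)" using eF cF by simp
      moreover have "B \<in> carrier (SL F)"
        unfolding B_def using A cF F' by (intro mult_SL[OF F] eF) auto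
      moreover have "B $ i $ j = 0" using True by (auto simp: B_def transvection_mult_entry c_def)
      ultimately show ?thesis
        using ij by (intro bexI[of _ "?e c"] bexI[of _ B])
          (auto simp: B_def transvection_mult_entry)
    next
      case False
      then have y: "?y \<noteq> 0" by simp
      define c where "c = ?x / ?y"
      have cF: "c \<in> F" using AF F' by (simp add: c_def)
      have "c \<in> insert 0 C0"
        using False C0(2)[of c] by (auto simp: c_def inverse_eq_divide)
      then have cC: "- c \<in> C" by (auto simp: C_def)
      define B where "B = ?e c ** (?f 1 ** (?e (- 1) ** (?f 1 ** A)))"
      have B: "B $ r $ l = (if r = i then - A $ j $ l + c * A $ i $ l else if r = j then A $ i $ l else A $ r $ l)" for r l
        using ij by (simp add: B_def transvection_mult_entry)
      have "?e x ** (?e (- x) ** X) = X" "?e (- x) ** (?e x ** X) = X"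
           "?f x ** (?f (- x) ** X) = X" "?f (- x) ** (?f x ** X) = X" for x and X :: "'a ^ 'n ^ 'n"
        unfolding matrix_mul_assoc transvection_add[OF ij] transvection_add[OF ji] by simp_all
      note canc = this this(2,4)[of 1] this(1,3)[of 1]
      have "w ** ?e (- c) ** B = A"
        unfolding B_def w_def using canc
        by (simp add: matrix_mul_assoc[symmetric])
      moreover have "w ** ?e (- c) \<in> D" unfolding D_def using cC by blast
      moreover have "w ** ?e (- c) \<in> carrier (SL F)"
        using w cF F' by (intro mult_SL[OF F] eF) auto
      moreover have "B \<in> carrier (SL F)"
        unfolding B_def using A cF F' by (intro mult_SL[OF F] eF) auto
      moreover have "B $ i $ j = 0" using y by (simp add: B c_def)
      ultimately show ?thesis
        using ij by (intro bexI[of _ "w ** ?e (- c)"] bexI[of _ B]) (auto simp: B)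
    qed
  qed
qed

text \<open>A substitute for the compactness of the flag variety: Gaussian elimination, column by column, with
  all row operations taken from a compact set.\<close>

lemma bounded_triangularization:
  fixes F :: "'a :: local_field set"
  assumes F: "is_subfield F"
  obtains K where "compactin SL_top K"
    "\<And>A :: 'a ^ 'n :: {finite, wellorder} ^ 'n :: {finite, wellorder}. A \<in> carrier (SL F) \<Longrightarrow>
      \<exists>k\<in>K \<inter> carrier (SL F). \<exists>B\<in>carrier (ST_plus F). A = k ** B"
proof -
  \<comment> \<open>the identity \<open>?M\<close> only serves to fix the type of matrices\<close>
  let ?M = "\<lambda>A :: 'a ^ 'n :: {finite, wellorder} ^ 'n :: {finite, wellorder}. A"
  define low where "low J A \<longleftrightarrow> (\<forall>l\<in>J. \<forall>k>l. ?M A $ k $ l = 0)" for J A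
  \<comment> \<open>\<open>red P Q\<close>: bounded row operations lead from matrices with zero pattern \<open>P\<close> to pattern \<open>Q\<close>\<close>
  define red where "red P Q \<longleftrightarrow> (\<exists>D. compactin SL_top D \<and> (\<forall>A\<in>carrier (SL F). P A \<longrightarrow>
     (\<exists>k\<in>D \<inter> carrier (SL F). \<exists>B\<in>carrier (SL F). ?M A = k ** B \<and> Q B)))" for P Q
  have refl: "red P P" for P
  proof -
    have one: "?M (mat 1) \<in> carrier (SL F)" by (simp add: mat_1_entry[OF F])
    have "compactin SL_top {?M (mat 1)}" by simp
    moreover have "\<exists>k\<in>{mat 1} \<inter> carrier (SL F). \<exists>B\<in>carrier (SL F). ?M A = k ** B \<and> P B"
      if "A \<in> carrier (SL F)" "P A" for A
      using that one by (intro bexI[of _ "mat 1"] bexI[of _ A]) auto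
    ultimately show ?thesis unfolding red_def by blast
  qed
  have trans: "red P R" if PQ: "red P Q" and QR: "red Q R" for P Q R
  proof -
    obtain D where D: "compactin SL_top D" "\<And>A. A \<in> carrier (SL F) \<Longrightarrow> P A \<Longrightarrow>
      \<exists>k\<in>D \<inter> carrier (SL F). \<exists>B\<in>carrier (SL F). ?M A = k ** B \<and> Q B"
      using PQ unfolding red_def by blast
    obtain E where E: "compactin SL_top E" "\<And>A. A \<in> carrier (SL F) \<Longrightarrow> Q A \<Longrightarrow>
      \<exists>k\<in>E \<inter> carrier (SL F). \<exists>B\<in>carrier (SL F). ?M A = k ** B \<and> R B"
      using QR unfolding red_def by blast
    have "compactin SL_top {a ** b |a b. a \<in> D \<and> b \<in> E}"
      using compactin_product_set[OF tg_SL D(1) E(1)] by simp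
    moreover have "\<exists>k\<in>{a ** b |a b. a \<in> D \<and> b \<in> E} \<inter> carrier (SL F). \<exists>B\<in>carrier (SL F). ?M A = k ** B \<and> R B"
      if A: "A \<in> carrier (SL F)" "P A" for A
    proof -
      obtain k B where k: "k \<in> D" "k \<in> carrier (SL F)" "B \<in> carrier (SL F)" "?M A = k ** B" "Q B"
        using D(2)[OF A] by blast
      obtain k' B' where k': "k' \<in> E" "k' \<in> carrier (SL F)" "B' \<in> carrier (SL F)" "?M B = k' ** B'" "R B'"
        using E(2)[OF k(3,5)] by blast
      have "A = (k ** k') ** B'" using k(4) k'(4) by (simp add: matrix_mul_assoc)
      moreover have "k ** k' \<in> carrier (SL F)" using k(2) k'(2) by (rule mult_SL[OF F])
      ultimately show ?thesis using k(1) k'(1,3,5) by blast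
    qed
    ultimately show ?thesis unfolding red_def by blast
  qed
  have step: "red (\<lambda>A. low {..<j} A \<and> (\<forall>r\<in>I. A $ r $ j = 0))
      (\<lambda>A. low {..<j} A \<and> (\<forall>r\<in>insert i I. A $ r $ j = 0))" if i: "j < i" "i \<notin> I" "j \<notin> I" for i j I
  proof -
    have ij: "i \<noteq> j" using i by simp
    obtain D where D: "compactin SL_top D"
     "\<And>A. A \<in> carrier (SL F) \<Longrightarrow> \<exists>k\<in>D \<inter> carrier (SL F). \<exists>B\<in>carrier (SL F).
        ?M A = k ** B \<and> B $ i $ j = 0 \<and> (\<forall>r l. r \<noteq> i \<longrightarrow> r \<noteq> j \<longrightarrow> B $ r $ l = A $ r $ l) \<and>
        (\<forall>l. A $ i $ l = 0 \<longrightarrow> A $ j $ l = 0 \<longrightarrow> B $ i $ l = 0 \<and> B $ j $ l = 0)"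
      by (rule bounded_elimination_step[OF F ij]) blast
    have "\<exists>k\<in>D \<inter> carrier (SL F). \<exists>B\<in>carrier (SL F). ?M A = k ** B \<and>
         low {..<j} B \<and> (\<forall>r\<in>insert i I. B $ r $ j = 0)"
      if A: "A \<in> carrier (SL F)" "low {..<j} A" "\<forall>r\<in>I. A $ r $ j = 0" for A
    proof -
      obtain k B where k: "k \<in> D \<inter> carrier (SL F)" "B \<in> carrier (SL F)" "A = k ** B" "B $ i $ j = 0"
         and B: "\<And>r l. r \<noteq> i \<Longrightarrow> r \<noteq> j \<Longrightarrow> B $ r $ l = A $ r $ l"
         "\<And>l. A $ i $ l = 0 \<Longrightarrow> A $ j $ l = 0 \<Longrightarrow> B $ i $ l = 0 \<and> B $ j $ l = 0"
        using D(2)[OF A(1)] by blast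
      have "low {..<j} B"
        unfolding low_def
      proof (intro ballI allI impI)
        fix l r assume l: "l \<in> {..<j}" "l < r"
        have "l < i" "l < j" using l i by auto
        then have "A $ r $ l = 0" "A $ i $ l = 0" "A $ j $ l = 0"
          using A(2) l unfolding low_def by blast+
        then show "B $ r $ l = 0" using B by (cases "r = i \<or> r = j") auto
      qed
      moreover have "\<forall>r\<in>insert i I. B $ r $ j = 0"
      proof
        fix r assume r: "r \<in> insert i I"
        show "B $ r $ j = 0"
        proof (cases "r = i")
          case False
          then have "r \<noteq> j" "A $ r $ j = 0" using r i A(3) by auto
          then show ?thesis using B(1)[of r j] False by simp
        qed (use k in simp)
      qed
      ultimately show ?thesis using k by blast
    qed
    then show ?thesis unfolding red_def using D(1) by blast
  qed
  have column: "red (low {..<j}) (\<lambda>A. low {..<j} A \<and> (\<forall>r\<in>I. A $ r $ j = 0))"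
    if "finite I" "I \<subseteq> {j<..}" for j I
    using that
  proof (induction I rule: finite_induct)
    case empty
    then show ?case using refl[of "low {..<j}"] by simp
  next
    case (insert i I)
    then have "red (low {..<j}) (\<lambda>A. low {..<j} A \<and> (\<forall>r\<in>I. A $ r $ j = 0))" by simp
    moreover have "red (\<lambda>A. low {..<j} A \<and> (\<forall>r\<in>I. A $ r $ j = 0))
      (\<lambda>A. low {..<j} A \<and> (\<forall>r\<in>insert i I. A $ r $ j = 0))"
      using insert by (intro step) auto
    ultimately show ?case by (rule trans)
  qed
  have "red (\<lambda>_. True) (low {..<j})" for j
  proof (induction j rule: less_induct)
    case (less j)
    show ?case
    proof (cases "{..<j} = {}")
      case True
      then show ?thesis using refl[of "\<lambda>_. True"] by (simp add: low_def)
    next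
      case False
      define i where "i = Max {..<j}"
      have i: "i < j" using Max_in[OF _ False] by (simp add: i_def)
      have eq: "{..<j} = insert i {..<i}"
      proof -
        have "l \<le> i" if "l < j" for l using that by (simp add: i_def)
        then show ?thesis using i by force
      qed
      have "red (low {..<i}) (\<lambda>A. low {..<i} A \<and> (\<forall>r\<in>{i<..}. A $ r $ i = 0))"
        by (rule column) auto
      also have "(\<lambda>A. low {..<i} A \<and> (\<forall>r\<in>{i<..}. A $ r $ i = 0)) = low {..<j}"
        unfolding eq by (auto simp: low_def fun_eq_iff)
      finally show ?thesis using trans less[OF i] by blast
    qed
  qed
  note all = this
  define m :: 'n where "m = Max UNIV"
  have le: "l \<le> m" for l by (simp add: m_def)
  obtain D where D: "compactin SL_top D" "\<And>A. A \<in> carrier (SL F) \<Longrightarrow>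
      \<exists>k\<in>D \<inter> carrier (SL F). \<exists>B\<in>carrier (SL F). ?M A = k ** B \<and> low {..<m} B"
    using all[of m] unfolding red_def by blast
  have "B \<in> carrier (ST_plus F)" if B: "B \<in> carrier (SL F)" "low {..<m} B" for B
  proof -
    have "B $ i $ j = 0" if "j < i" for i j
      using B(2) le[of i] that unfolding low_def by (metis lessThan_iff order_less_le_trans)
    then show ?thesis using B(1) by simp
  qed
  then show ?thesis using D by (intro that[of D]) blast+
qed

section \<open>Leading positions\<close>

definition unitriangular :: "'a :: field set \<Rightarrow> ('a ^ 'n :: {finite, wellorder} ^ 'n :: {finite, wellorder}) set" where
  "unitriangular E = {b. (\<forall>i j. b $ i $ j \<in> E) \<and> (\<forall>i. b $ i $ i = 1) \<and> (\<forall>i j. j < i \<longrightarrow> b $ i $ j = 0)}"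

lemma unitriangular_ST_plus: "unitriangular E \<subseteq> carrier (ST_plus E)"
  by (auto simp: unitriangular_def det_upperdiagonal)

text \<open>Half of the Bruhat decomposition. Among all unitriangular \<open>b\<close> choose one for which the leading
  zeros of the rows of \<open>b ** g\<close> are as many as possible in total. If two rows began at the same position,
  subtracting a multiple of the lower one from the upper one would produce more zeros.\<close>

lemma bruhat_leading_positions:
  fixes g :: "'a :: field ^ 'n :: {finite, wellorder} ^ 'n :: {finite, wellorder}"
  assumes E: "is_subfield E" and g: "g \<in> carrier (SL E)"
  obtains b p where "b \<in> unitriangular E" "inj p"
    "\<And>i. (b ** g) $ i $ p i \<noteq> 0" "\<And>i l. l < p i \<Longrightarrow> (b ** g) $ i $ l = 0"
proof -
  note E' = is_subfieldD[OF E]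
  define lead where "lead b i = (LEAST l. (b ** g) $ i $ l \<noteq> 0)" for b :: "'a ^ 'n :: {finite, wellorder} ^ 'n :: {finite, wellorder}" and i
  define size where "size b = (\<Sum>i\<in>UNIV. card {..<lead b i})" for b
  have row: "\<exists>l. (b ** g) $ i $ l \<noteq> 0" if b: "b \<in> unitriangular E" for b i
  proof (rule ccontr)
    assume "\<not> ?thesis"
    then have "row i (b ** g) = 0" by (simp add: row_def vec_eq_iff)
    then have "det (b ** g) = 0" by (rule det_zero_row(2))
    moreover have "det b = 1" using b unitriangular_ST_plus by auto
    ultimately show False using g by (simp add: det_mul)
  qed
  have lead: "(b ** g) $ i $ lead b i \<noteq> 0" if "b \<in> unitriangular E" for b i
    unfolding lead_def by (rule LeastI_ex[OF row[OF that]])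
  have lead0: "(b ** g) $ i $ l = 0" if "l < lead b i" for b i l
    using not_less_Least[of l "\<lambda>l. (b ** g) $ i $ l \<noteq> 0"] that unfolding lead_def by blast
  have "size b \<le> (\<Sum>i\<in>(UNIV :: 'n set). card (UNIV :: 'n set))" for b
    unfolding size_def by (intro sum_mono card_mono) auto
  moreover have "mat 1 \<in> unitriangular E"
    using mat_1_entry[OF E] by (auto simp: unitriangular_def mat_def E')
  ultimately obtain b where b: "b \<in> unitriangular E" "\<And>c. c \<in> unitriangular E \<Longrightarrow> size c \<le> size b"
    using ex_has_greatest_nat[of "\<lambda>b. b \<in> unitriangular E" "mat 1" size] by (metis le_imp_less_Suc)
  have False if ij: "i < j" "lead b i = lead b j" for i j
  proof -
    define l where "l = lead b i"
    define x where "x = - ((b ** g) $ i $ l / (b ** g) $ j $ l)"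
    define c where "c = transvection i j x ** b"
    have bg: "(b ** g) $ k $ r \<in> E" for k r
      using b(1) g by (intro matrix_mult_in_subfield[OF E]) (auto simp: unitriangular_def)
    have "x \<in> E" unfolding x_def by (intro E' bg)
    then have c: "c \<in> unitriangular E"
      using b(1) ij(1) E' unfolding unitriangular_def c_def
      by (auto simp: transvection_mult_entry)
    have cg: "(c ** g) $ k $ r = (b ** g) $ k $ r + (if k = i then x * (b ** g) $ j $ r else 0)" for k r
      unfolding c_def matrix_mul_assoc[symmetric] by (rule transvection_mult_entry)
    have other: "lead c k = lead b k" if "k \<noteq> i" for k using that by (simp add: lead_def cg)
    have "(c ** g) $ i $ r = 0" if "r \<le> l" for r
    proof (cases "r = l")
      case True
      have "(b ** g) $ j $ l \<noteq> 0" using lead[OF b(1), of j] ij by (simp add: l_def)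
      then show ?thesis using True by (simp add: cg x_def)
    next
      case False
      then have "r < lead b i" "r < lead b j" using that ij by (auto simp: l_def)
      then show ?thesis using lead0 by (simp add: cg)
    qed
    then have gt: "lead b i < lead c i" using lead[OF c, of i] unfolding l_def by (metis not_le)
    have "size b < size c"
      unfolding size_def
    proof (rule sum_strict_mono_ex1)
      have "{..<lead b i} \<subset> {..<lead c i}" using gt by auto
      then show "\<exists>k\<in>UNIV. card {..<lead b k} < card {..<lead c k}"
        by (intro bexI[of _ i] psubset_card_mono) auto
      show "\<forall>k\<in>UNIV. card {..<lead b k} \<le> card {..<lead c k}"
      proof
        fix k show "card {..<lead b k} \<le> card {..<lead c k}"
          using gt other[of k] by (cases "k = i") (auto intro!: card_mono)
      qed
    qed simp
    then show False using b(2)[OF c] by simp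
  qed
  then have "inj (lead b)" by (intro linorder_injI) blast
  then show ?thesis using that[of b "lead b"] b(1) lead lead0 by blast
qed

text \<open>After a permutation of its rows \<open>m\<close> is upper triangular with nonzero diagonal, so \<open>X\<close>, which is
  conjugate to a diagonal matrix by it, is upper triangular with the permuted diagonal.\<close>

lemma triangular_of_intertwining:
  fixes m X :: "'a :: field ^ 'n :: {finite, wellorder} ^ 'n :: {finite, wellorder}"
  assumes p: "inj p" "\<And>i. m $ i $ p i \<noteq> 0" "\<And>i l. l < p i \<Longrightarrow> m $ i $ l = 0"
    and X: "\<And>i l. (m ** X) $ i $ l = t i * m $ i $ l"
  shows "l < k \<Longrightarrow> X $ k $ l = 0" and "X $ p i $ p i = t i"
proof -
  have surj: "surj p" using p(1) by (simp add: finite_UNIV_inj_surj)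
  have expand: "m $ i $ p i * X $ p i $ l = t i * m $ i $ l"
    if "\<And>r. p i < r \<Longrightarrow> X $ r $ l = 0" for i l
  proof -
    have "t i * m $ i $ l = (\<Sum>r\<in>UNIV. m $ i $ r * X $ r $ l)"
      unfolding X[symmetric] by (simp add: matrix_matrix_mult_def)
    also have "\<dots> = (\<Sum>r\<in>UNIV. if r = p i then m $ i $ p i * X $ p i $ l else 0)"
    proof (intro sum.cong refl)
      fix r show "m $ i $ r * X $ r $ l = (if r = p i then m $ i $ p i * X $ p i $ l else 0)"
        using that[of r] p(3)[of r i] by (cases r "p i" rule: linorder_cases) auto
    qed
    finally show ?thesis by simp
  qed
  have wf: "wf ({(x, y). (y :: 'n) < x} :: 'n rel)"
    by (rule finite_acyclic_wf) (auto intro!: acyclicI_order[where f = id])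
  have upper: "\<forall>l < k. X $ k $ l = 0" for k
    using wf
  proof (induction k rule: wf_induct_rule)
    case (less k)
    obtain i where i: "k = p i" using surj by auto
    show ?case
    proof (intro allI impI)
      fix l assume l: "l < k"
      have "m $ i $ p i * X $ p i $ l = t i * m $ i $ l"
        using less l i by (intro expand) auto
      then show "X $ k $ l = 0" using p(2,3) l i by simp
    qed
  qed
  then show "l < k \<Longrightarrow> X $ k $ l = 0" by blast
  have "m $ i $ p i * X $ p i $ p i = t i * m $ i $ p i"
    using upper by (intro expand) auto
  then show "X $ p i $ p i = t i" using p(2) by simp
qed

section \<open>Torus elements\<close>

definition torus_element :: "'n \<Rightarrow> 'n \<Rightarrow> 'a \<Rightarrow> 'a :: field ^ 'n ^ 'n" where
  "torus_element i j s = (\<chi> k l. if k = l then (if k = i then s else if k = j then inverse s else 1) else 0)"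

lemma torus_element_ST_plus:
  fixes i j :: "'n :: {finite, wellorder}"
  assumes F: "is_subfield F" and ij: "i \<noteq> j" and s: "s \<in> F" "s \<noteq> 0"
  shows "torus_element i j s \<in> carrier (ST_plus F)"
proof -
  let ?t = "\<lambda>k. if k = i then s else if k = j then inverse s else 1"
  have "det (torus_element i j s) = prod ?t UNIV" by (simp add: torus_element_def det_upperdiagonal)
  also have "\<dots> = ?t i * (?t j * prod ?t (UNIV - {i} - {j}))"
    using ij by (simp add: prod.remove[of UNIV i] prod.remove[of "UNIV - {i}" j])
  also have "prod ?t (UNIV - {i} - {j}) = 1" by (rule prod.neutral) simp
  finally have "det (torus_element i j s) = 1" using s ij by simp
  then show ?thesis using s is_subfieldD[OF F] by (simp add: torus_element_def)
qed

lemma torus_element_mult: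
  "(torus_element i j s ** M) $ k $ l = torus_element i j s $ k $ k * M $ k $ l"
  "(M ** torus_element i j s) $ k $ l = M $ k $ l * torus_element i j s $ l $ l"
  unfolding matrix_matrix_mult_def torus_element_def vec_lambda_beta
  by (simp_all add: if_distrib[of "\<lambda>x. x * _"] if_distrib[of "\<lambda>x. _ * x"] cong: if_cong)

lemma infinite_field_scalar:
  fixes F :: "'a :: field set"
  assumes "infinite F" "is_subfield F"
  obtains a where "a \<in> F" "a \<noteq> 0" "a \<noteq> inverse a"
proof -
  have "infinite (F - {0, 1, - 1})" using assms(1) by simp
  then obtain a where a: "a \<in> F" "a \<noteq> 0" "a \<noteq> 1" "a \<noteq> - 1"
    by (metis DiffE ex_in_conv finite.emptyI insertCI)
  moreover have "a \<noteq> inverse a"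
  proof
    assume "a = inverse a"
    then have "a * a = 1" using a(2) by (metis right_inverse)
    then have "(a - 1) * (a + 1) = 0" by (simp add: algebra_simps)
    then show False using a by (simp add: eq_neg_iff_add_eq_0)
  qed
  ultimately show ?thesis using that by blast
qed

section \<open>From the triangular group to the special linear group\<close>

lemma topological_group_subgroup:
  fixes G (structure)
  assumes G: "topological_group G T" and H: "subgroup H G"
  shows "topological_group (G\<lparr>carrier := H\<rparr>) (subtopology T H)"
proof -
  interpret group G using G by (simp add: topological_group_def)
  interpret H: subgroup H G by fact
  have top: "topspace T = carrier G" and haus: "Hausdorff_space T"
    and m: "continuous_map (prod_topology T T) T (\<lambda>(x, y). x \<otimes> y)"
    and i: "continuous_map T T (\<lambda>x. inv x)"
    using G unfolding topological_group_def by blast+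
  have "continuous_map (prod_topology (subtopology T H) (subtopology T H)) (subtopology T H) (\<lambda>(x, y). x \<otimes> y)"
    unfolding continuous_map_in_subtopology prod_topology_subtopology subtopology_subtopology
    using m by (auto intro: continuous_map_from_subtopology)
  moreover have "continuous_map (subtopology T H) (subtopology T H) (\<lambda>x. inv x)"
    unfolding continuous_map_in_subtopology
    using i by (auto intro: continuous_map_from_subtopology)
  then have "continuous_map (subtopology T H) (subtopology T H) (\<lambda>x. inv\<^bsub>G\<lparr>carrier := H\<rparr>\<^esub> x)"
    by (rule continuous_map_eq) (simp add: m_inv_consistent[OF H])
  moreover have "topspace (subtopology T H) = H" using top H.subset by auto
  ultimately show ?thesis
    using H.subgroup_is_group[OF is_group] Hausdorff_space_subtopology[OF haus]
    by (simp add: topological_group_def)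
qed

lemma SL_top_locally_compact:
  obtains Q and K :: "('a :: local_field ^ 'n ^ 'n) set" where
    "openin SL_top Q" "mat 1 \<in> Q" "Q \<subseteq> K" "compactin SL_top K"
proof -
  obtain U C :: "'a set" where U: "open U" "compact C" "0 \<in> U" "U \<subseteq> C"
    using locally_compact[of 0] by blast
  have cont: "continuous_on UNIV (\<lambda>x :: 'a. 1 + x)" by (intro continuous_intros)
  have "compact ((\<lambda>x. 1 + x) ` C)"
    using U(2) continuous_on_subset[OF cont] by (intro compact_continuous_image) auto
  then have C': "compact (C \<union> (\<lambda>x. 1 + x) ` C)" using U(2) by (rule compact_Un[rotated])
  define Q where "Q = (\<Inter>i. \<Inter>j. (\<lambda>X :: 'a ^ 'n ^ 'n. X $ i $ j - mat 1 $ i $ j) -` U)"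
  have "open Q"
    unfolding Q_def by (intro open_INT finite open_vimage ballI U continuous_intros)
  then have "openin SL_top (carrier (SL UNIV) \<inter> Q)" by (auto simp: openin_open)
  moreover have "mat 1 \<in> carrier (SL UNIV) \<inter> Q" using U by (simp add: Q_def)
  moreover have "carrier (SL UNIV) \<inter> Q \<subseteq> {X. det X = 1 \<and> (\<forall>i j. X $ i $ j \<in> C \<union> (\<lambda>x. 1 + x) ` C)}"
  proof clarify
    fix X assume X: "X \<in> carrier (SL UNIV)" "X \<in> Q"
    have "X $ i $ j \<in> C \<union> (\<lambda>x. 1 + x) ` C" for i j
    proof -
      have *: "X $ i $ j - mat 1 $ i $ j \<in> C"
        using X(2) U(4) unfolding Q_def by blast
      then show ?thesis
        by (cases "i = j") (auto simp: mat_def intro!: image_eqI[of _ _ "X $ i $ j - 1"])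
    qed
    then show "det X = 1 \<and> (\<forall>i j. X $ i $ j \<in> C \<union> (\<lambda>x. 1 + x) ` C)" using X by simp
  qed
  ultimately show ?thesis using that compactin_SL[OF C'] by blast
qed

text \<open>By minimality a coarser topology agrees with the original one on the triangular group \<open>B\<close>, so
  bounded triangularization provides a relatively compact neighbourhood and the residue meets the closure
  of \<open>B\<close> trivially. It remains to see that the residue is trivial. An element \<open>g\<close> of it maps the
  standard flag to another one, and both flags are fixed by a common torus, whose elements \<open>s\<close> are
  triangular. The commutator of \<open>s\<close> and \<open>g\<close> lies in the residue and is triangular, so \<open>g\<close> commutes with
  that torus. As the torus elements have different diagonal entries, this forces the two flags to
  coincide, so \<open>g\<close> is triangular itself.\<close>

theorem ST_minimal_imp_SL_minimal:
  fixes F :: "'a :: local_field set"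
  assumes F: "is_subfield F" and inf: "infinite F"
    and min: "minimal_topological_group
       (ST_plus F :: ('a ^ 'n :: {finite, wellorder} ^ 'n :: {finite, wellorder}) monoid)
       (top_of_set (carrier (ST_plus F)))"
  shows "minimal_topological_group
       (SL F :: ('a ^ 'n :: {finite, wellorder} ^ 'n :: {finite, wellorder}) monoid)
       (top_of_set (carrier (SL F)))"
  unfolding minimal_topological_group_iff_coarser
proof (intro conjI allI impI topological_group_SL F)
  let ?G = "SL UNIV :: ('a ^ 'n :: {finite, wellorder} ^ 'n :: {finite, wellorder}) monoid"
  let ?H = "carrier (SL F) :: ('a ^ 'n :: {finite, wellorder} ^ 'n :: {finite, wellorder}) set"
  let ?B = "carrier (ST_plus F) :: ('a ^ 'n :: {finite, wellorder} ^ 'n :: {finite, wellorder}) set"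
  let ?inv = "m_inv ?G"
  fix S assume S_coarser: "topological_group (SL F) S \<and> (\<forall>U. openin S U \<longrightarrow> openin (top_of_set ?H) U)"
  interpret coarser_group_topology ?G SL_top ?H S
  proof (rule coarser_group_topology.intro)
    show "topological_group ?G SL_top" by (rule tg_SL)
    show "subgroup ?H ?G" by (rule subgroup_SL[OF F])
    show "topological_group (?G\<lparr>carrier := ?H\<rparr>) S"
      unfolding SL_carrier_update(1)[symmetric] using S_coarser by blast
    fix U assume "openin S U"
    then show "openin (subtopology SL_top ?H) U"
      using S_coarser unfolding subtopology_SL_top by blast
  qed
  have sub: "?B \<subseteq> ?H" by auto
  have agB: "agree ?B"
  proof -
    have "subgroup ?B (SL F)"
      using subgroup_incl[OF subgroup_ST[OF F] subgroup_SL[OF F] sub]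
      unfolding SL_carrier_update(1)[symmetric] .
    then have "topological_group ((SL F)\<lparr>carrier := ?B\<rparr>) (subtopology S ?B)"
      using S_coarser topological_group_subgroup by blast
    also have "(SL F)\<lparr>carrier := ?B\<rparr> = ST_plus F" by (simp add: SL_def ST_plus_def)
    finally have "topological_group (ST_plus F) (subtopology S ?B)" .
    moreover have "openin (top_of_set ?B) U" if U: "openin (subtopology S ?B) U" for U
    proof -
      obtain V where V: "openin S V" "U = V \<inter> ?B" using U unfolding openin_subtopology by blast
      obtain Q where Q: "openin SL_top Q" "V = Q \<inter> ?H" using openS_T[OF V(1)] .
      have "U = Q \<inter> ?B" using V Q sub by blast
      then show ?thesis using Q(1) unfolding subtopology_SL_top(2)[symmetric] openin_subtopology by blast
    qed
    ultimately have eq: "subtopology S ?B = top_of_set ?B"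
      using min unfolding minimal_topological_group_iff_coarser by blast
    show ?thesis
      unfolding agree_def
    proof (intro allI impI, elim conjE)
      fix Q assume Q: "openin SL_top Q" "\<one>\<^bsub>?G\<^esub> \<in> Q"
      have "openin (top_of_set ?B) (Q \<inter> ?B)"
        using Q(1) unfolding subtopology_SL_top(2)[symmetric] openin_subtopology by blast
      then obtain V where V: "openin S V" "Q \<inter> ?B = V \<inter> ?B"
        unfolding eq[symmetric] openin_subtopology by blast
      have "\<one>\<^bsub>?G\<^esub> \<in> ?B" using subgroup.one_closed[OF subgroup_ST[OF F]] .
      then show "\<exists>V. openin S V \<and> \<one>\<^bsub>?G\<^esub> \<in> V \<and> V \<inter> ?B \<subseteq> Q"
        using V Q by (intro exI[of _ V]) blast
    qed
  qed
  obtain K where K: "compactin SL_top K" "\<And>A. A \<in> ?H \<Longrightarrow> \<exists>k\<in>K \<inter> ?H. \<exists>B\<in>?B. A = k ** B"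
    by (rule bounded_triangularization[OF F]) blast
  obtain Q C where Q: "openin SL_top Q" "mat 1 \<in> Q" "Q \<subseteq> C" "compactin (SL_top :: ('a ^ 'n :: {finite, wellorder} ^ 'n :: {finite, wellorder}) topology) C"
    by (rule SL_top_locally_compact)
  obtain V0 where V0: "openin S V0" "\<one>\<^bsub>?G\<^esub> \<in> V0" "V0 \<inter> ?B \<subseteq> Q"
    using agreeD[OF agB Q(1)] Q(2) by (metis SL_sel(3))
  have V0C: "V0 \<inter> ?B \<subseteq> C" using V0 Q by blast
  have fac: "\<exists>m\<in>K \<inter> ?H. \<exists>l\<in>?B. x = m \<otimes>\<^bsub>?G\<^esub> l" if "x \<in> ?H" for x
    using K(2)[OF that] unfolding SL_sel(2) .
  obtain V D where V: "openin S V" "\<one>\<^bsub>?G\<^esub> \<in> V" "V \<subseteq> D" "compactin SL_top D"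
    using bounded_of_factorization[OF V0(1,2) V0C Q(4) openS_H H.one_closed fac Int_lower1 K(1) Int_lower2
        subgroup_ST[OF F] sub] by blast

  have normal: "h \<otimes>\<^bsub>?G\<^esub> g \<otimes>\<^bsub>?G\<^esub> ?inv h \<in> residue ?H" if "g \<in> residue ?H" "h \<in> SL_top closure_of ?H" for g h
    by (rule residue_conj[OF subset_refl _ that(2,1)]) (intro H.m_closed H.m_inv_closed)
  have closB: "Y \<in> SL_top closure_of ?B"
    if "Y \<in> SL_top closure_of ?H" "\<And>i j. j < i \<Longrightarrow> Y $ i $ j = 0" for Y
    using closure_ST_plus[OF F closure_entries(1)[OF that(1)] that(2) closure_entries(2)[OF that(1)]] .
  have BH: "SL_top closure_of ?B \<subseteq> SL_top closure_of ?H" using sub by (rule closure_of_mono)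
  have resB: "Y = mat 1" if "Y \<in> residue ?H" "\<And>i j. j < i \<Longrightarrow> Y $ i $ j = 0" for Y
    using residue_Int_closure[OF agB sub that(1) closB[OF residue_closure[OF that(1)] that(2)]] by simp
  have "g = mat 1" if g: "g \<in> residue ?H" for g
  proof -
    let ?E = "closure F"
    have E: "is_subfield ?E" by (rule is_subfield_closure[OF F])
    have gE: "g \<in> carrier (SL ?E)" using closure_entries[OF residue_closure[OF g]] by simp
    obtain b p where b: "b \<in> unitriangular ?E" and p: "inj p"
      "\<And>i. (b ** g) $ i $ p i \<noteq> 0" "\<And>i l. l < p i \<Longrightarrow> (b ** g) $ i $ l = 0"
      by (rule bruhat_leading_positions[OF E gE]) blast
    have bE: "b \<in> carrier (ST_plus ?E)" using b unitriangular_ST_plus by blast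
    have bB: "b \<in> SL_top closure_of ?B" using bE by (intro closure_ST_plus[OF F]) auto
    have c: "g \<in> carrier ?G" "b \<in> carrier ?G" using gE bE by auto
    have inv_b: "?inv b \<in> carrier (ST_plus ?E)"
      using subgroup.m_inv_closed[OF subgroup_ST[OF E] bE] .
    have p_id: "p i = i" for i
    proof (rule ccontr)
      assume ne: "p i \<noteq> i"
      obtain a where a: "a \<in> F" "a \<noteq> 0" "a \<noteq> inverse a" by (rule infinite_field_scalar[OF inf F])
      define d where "d = torus_element i (p i) a"
      define t where "t k = d $ k $ k" for k
      have dB: "d \<in> ?B" unfolding d_def using ne by (intro torus_element_ST_plus[OF F _ a(1,2)]) simp
      have dE: "d \<in> carrier (ST_plus ?E)" using dB closure_subset[of F] by auto
      have dc: "d \<in> carrier ?G" using dB by simp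
      \<comment> \<open>\<open>s\<close> fixes the standard flag, being triangular, and its image under \<open>g\<close>, since \<open>X\<close> will be triangular\<close>
      define s where "s = ?inv b ** d ** b"
      have sE: "s \<in> carrier (ST_plus ?E)"
        unfolding s_def
        using subgroup.m_closed[OF subgroup_ST[OF E] subgroup.m_closed[OF subgroup_ST[OF E] inv_b dE] bE]
        by (simp only: SL_sel(2))
      have sc: "s \<in> carrier ?G" using sE by simp
      have sH: "s \<in> SL_top closure_of ?H" 
        using sE BH by (intro subsetD[OF BH] closure_ST_plus[OF F]) auto
      define X where "X = ?inv g ** s ** g"
      have Xc: "X \<in> carrier ?G" unfolding X_def using c sc m_closed inv_closed by (metis SL_sel(2))
      have dm: "(d ** M) $ k $ l = t k * M $ k $ l" for M :: "'a ^ 'n :: {finite, wellorder} ^ 'n :: {finite, wellorder}" and k l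
        unfolding t_def d_def by (rule torus_element_mult)
      have bs: "b ** s = d ** b"
        unfolding s_def using c dc r_inv[OF c(2)] by (simp add: matrix_mul_assoc)
      have mX: "(b ** g) ** X = d ** (b ** g)"
      proof -
        have "(b ** g) ** X = b ** ((g ** ?inv g) ** s) ** g"
          unfolding X_def by (simp add: matrix_mul_assoc)
        also have "\<dots> = d ** (b ** g)" using bs r_inv[OF c(1)] by (simp add: matrix_mul_assoc)
        finally show ?thesis .
      qed
      have Xt: "X $ p k $ p k = t k" and Xup: "l < k \<Longrightarrow> X $ k $ l = 0" for k l
        using triangular_of_intertwining[OF p, of X t] mX dm by auto
      have st: "s $ k $ k = t k" for k
        using triangular_of_intertwining(2)[of id b s t k] b bs dm
        by (auto simp: unitriangular_def)
      define Y where "Y = ?inv s ** X"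
      have sinv: "?inv s \<in> carrier (ST_plus ?E)" using subgroup.m_inv_closed[OF subgroup_ST[OF E] sE] .
      have "Y \<in> residue ?H"
      proof -
        have "?inv s \<in> SL_top closure_of ?H"
          using sinv by (intro subsetD[OF BH] closure_ST_plus[OF F]) auto
        moreover have gi: "?inv g \<in> residue ?H" by (rule residue_inv[OF H.m_inv_closed g])
        ultimately have "?inv s \<otimes>\<^bsub>?G\<^esub> ?inv g \<otimes>\<^bsub>?G\<^esub> ?inv (?inv s) \<in> residue ?H" using normal by blast
        then have "?inv s ** ?inv g ** s \<in> residue ?H" using sc by simp
        from residue_mult[OF H.m_closed this g] have "?inv s ** ?inv g ** s ** g \<in> residue ?H"
          unfolding SL_sel(2) .
        then show ?thesis by (simp add: Y_def X_def matrix_mul_assoc)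
      qed
      moreover have "Y $ k $ l = 0" if "l < k" for k l
        unfolding Y_def matrix_matrix_mult_def vec_lambda_beta
      proof (rule sum.neutral, rule ballI)
        fix r show "?inv s $ k $ r * X $ r $ l = 0"
          using sinv Xup[of l r] that by (cases "r < k") auto
      qed
      ultimately have "Y = mat 1" by (rule resB)
      then have "s ** Y = s" by simp
      moreover have "s ** Y = X"
        unfolding Y_def using r_inv[OF sc] by (simp add: matrix_mul_assoc)
      ultimately have "X = s" by simp
      then have "t i = t (p i)" using Xt[of i] st[of "p i"] by simp
      then show False using ne a by (simp add: t_def d_def torus_element_def)
    qed
    have "(?inv b ** (b ** g)) $ k $ l = 0" if "l < k" for k l
      unfolding matrix_matrix_mult_def[of "?inv b"] vec_lambda_beta
    proof (rule sum.neutral, rule ballI)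
      fix r show "?inv b $ k $ r * (b ** g) $ r $ l = 0"
        using inv_b p(3)[of l r] p_id that by (cases "r < k") auto
    qed
    moreover have "?inv b ** (b ** g) = g" using l_inv[OF c(2)] by (simp add: matrix_mul_assoc)
    ultimately show ?thesis using resB[OF g] by simp
  qed
  then have "residue ?H \<subseteq> {\<one>\<^bsub>?G\<^esub>}" by auto
  then have "agree ?H" using agree_of_compact[OF V(1,2) _ V(4), of ?H] V(3) by blast
  then show "S = top_of_set ?H" using topologies_equal subtopology_SL_top(1) by metis
qed

section \<open>From the special linear group to the triangular group\<close>

lemma group_conj_eq:
  fixes G (structure)
  assumes "group G" "x \<in> carrier G" "y \<in> carrier G" "z \<in> carrier G" "x \<otimes> y = z \<otimes> x"
  shows "x \<otimes> y \<otimes> inv x = z"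
proof -
  interpret group G by fact
  show ?thesis using assms(2-4) unfolding assms(5) by (simp add: m_assoc)
qed

lemma compact_bounded_products:
  fixes C :: "'a :: topological_field set"
  assumes "compact C" "finite I"
  shows "\<exists>D. compact D \<and> (\<forall>f. (\<forall>i\<in>I. f i \<in> C) \<longrightarrow> prod f I \<in> D)"
  using assms(2)
proof (induction I rule: finite_induct)
  case empty
  then show ?case by (intro exI[of _ "{1}"]) simp
next
  case (insert i I)
  then obtain D where D: "compact D" "\<And>f. (\<forall>i\<in>I. f i \<in> C) \<Longrightarrow> prod f I \<in> D" by blast
  have "compact ((\<lambda>p. fst p * snd p) ` (C \<times> D))"
    using assms(1) D(1) by (intro compact_continuous_image compact_Times continuous_intros)
  moreover have "prod f (insert i I) \<in> (\<lambda>p. fst p * snd p) ` (C \<times> D)" if "\<forall>i\<in>insert i I. f i \<in> C" for f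
  proof -
    have "(f i, prod f I) \<in> C \<times> D" using that D(2)[of f] by simp
    then have "fst (f i, prod f I) * snd (f i, prod f I) \<in> (\<lambda>p. fst p * snd p) ` (C \<times> D)" by (rule imageI)
    then show ?thesis using insert by simp
  qed
  ultimately show ?case by blast
qed

lemma finite_roots_of_unity: "n > 0 \<Longrightarrow> finite {z :: 'a :: field. z ^ n = 1}"
proof -
  assume n: "n > 0"
  define p :: "'a poly" where "p = monom 1 n - 1"
  have "coeff p n = 1" using n by (simp add: p_def)
  then have "p \<noteq> 0" by auto
  then have "finite {z. poly p z = 0}" by (rule poly_roots_finite)
  then show ?thesis by (simp add: p_def poly_monom)
qed

lemma near_one_inverse:
  fixes c :: "'a :: topological_field"
  assumes W: "open W" "0 \<in> W"
  shows "\<forall>\<^sub>F y in nhds 0. 1 + c * y \<noteq> 0 \<and> c * y \<in> W \<and> inverse (1 + c * y) - 1 \<in> W"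
proof -
  have l1: "((\<lambda>y. c * y) \<longlongrightarrow> c * 0) (nhds 0)" by (intro tendsto_mult tendsto_const filterlim_ident)
  then have l2: "((\<lambda>y. 1 + c * y) \<longlongrightarrow> 1 + c * 0) (nhds 0)" by (intro tendsto_add tendsto_const)
  have l3: "((\<lambda>y. inverse (1 + c * y) - 1) \<longlongrightarrow> inverse (1 + c * 0) - 1) (nhds 0)"
    by (intro tendsto_diff tendsto_const tendsto_inverse_field l2) simp
  have "\<forall>\<^sub>F y in nhds 0. 1 + c * y \<in> - {0}" using l2 by (rule topological_tendstoD) auto
  moreover have "\<forall>\<^sub>F y in nhds 0. c * y \<in> W" using l1 W by (intro topological_tendstoD[OF l1]) auto
  moreover have "\<forall>\<^sub>F y in nhds 0. inverse (1 + c * y) - 1 \<in> W"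
    using W by (intro topological_tendstoD[OF l3]) auto
  ultimately show ?thesis by eventually_elim simp
qed

definition pattern_group ::
  "'a :: field set \<Rightarrow> ('n \<times> 'n) set \<Rightarrow> ('a ^ 'n :: {finite, wellorder} ^ 'n :: {finite, wellorder}) set" where
  "pattern_group F P = {X \<in> carrier (ST_plus F). \<forall>i j. (i, j) \<notin> P \<longrightarrow> X $ i $ j = (if i = j then 1 else 0)}"

text \<open>The first index \<open>lo\<close> and the last index \<open>hi\<close> single out the corner root group, the matrices
  \<open>e lo hi x\<close>, which is central in the unitriangular group.\<close>

locale coarser_on_ST =
  coarser_group_topology "SL UNIV :: ('a ^ 'n :: {finite, wellorder} ^ 'n :: {finite, wellorder}) monoid" SL_top "carrier (ST_plus F)" S
  for F :: "'a :: local_field set" and S :: "('a ^ 'n :: {finite, wellorder} ^ 'n :: {finite, wellorder}) topology" +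
  fixes lo hi :: 'n
  assumes F: "is_subfield F" and two: "(2 :: 'a) \<noteq> 0" and inf: "infinite F"
    and lo: "lo \<le> i" and hi: "i \<le> hi" and lo_ne_hi: "lo \<noteq> hi"
begin

abbreviation "B \<equiv> carrier (ST_plus F) :: ('a ^ 'n :: {finite, wellorder} ^ 'n :: {finite, wellorder}) set"
abbreviation "minv \<equiv> m_inv (SL UNIV :: ('a ^ 'n :: {finite, wellorder} ^ 'n :: {finite, wellorder}) monoid)"
abbreviation e :: "'n \<Rightarrow> 'n \<Rightarrow> 'a \<Rightarrow> 'a ^ 'n :: {finite, wellorder} ^ 'n :: {finite, wellorder}" where "e \<equiv> transvection"
abbreviation "corner \<equiv> pattern_group F {(lo, hi)} :: ('a ^ 'n :: {finite, wellorder} ^ 'n :: {finite, wellorder}) set"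

lemmas F_simps = is_subfieldD[OF F]

lemma lo_less_hi: "lo < hi" and hi_ne_lo: "hi \<noteq> lo"
  using lo[of hi] lo_ne_hi by auto

lemma not_less_lo: "\<not> i < lo" and not_hi_less: "\<not> hi < i"
  using lo[of i] hi[of i] by auto

lemmas multS = continuous_multS[unfolded SL_sel(2)]
lemmas contS = multS continuous_invS continuous_constS continuous_map_fst continuous_map_snd continuous_map_id[unfolded id_def]
lemmas res_mult = residue_mult[unfolded SL_sel(2)]
lemmas res_conj = residue_conj[unfolded SL_sel(2)]
lemmas small_nbS = small_neighbourhoodS[unfolded SL_sel(2,3)]
lemmas agD = agreeD[unfolded SL_sel(3)]
lemmas conj_eq = group_conj_eq[OF group_SL, unfolded SL_sel(2)]
lemmas B_mult = H.m_closed[unfolded SL_sel(2)] and B_one = H.one_closed[unfolded SL_sel(3)]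

lemma in_G: "x \<in> B \<Longrightarrow> x \<in> carrier (SL UNIV)" by simp

lemma minv_mult: "x \<in> carrier (SL UNIV) \<Longrightarrow> minv x ** x = mat 1" "x \<in> carrier (SL UNIV) \<Longrightarrow> x ** minv x = mat 1"
  using l_inv[of x] r_inv[of x] unfolding SL_sel(2,3) by blast+

lemma commutator_eq:
  assumes "x \<in> carrier (SL UNIV)" "y \<in> carrier (SL UNIV)" "x ** y = c ** y ** x"
  shows "x ** y ** minv x ** minv y = c"
proof -
  have "x ** y ** minv x ** minv y = c ** (y ** ((x ** minv x) ** minv y))"
    unfolding assms(3) by (simp add: matrix_mul_assoc)
  then show ?thesis using minv_mult assms by simp
qed

lemma e_B: "i < j \<Longrightarrow> x \<in> F \<Longrightarrow> e i j x \<in> B"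
  by (rule transvection_ST[OF F])

lemma e_G: "i \<noteq> j \<Longrightarrow> e i j x \<in> carrier (SL UNIV)"
  by simp

lemma e_corner: "x \<in> F \<Longrightarrow> e lo hi x \<in> corner"
  using e_B[OF lo_less_hi] by (auto simp: pattern_group_def transvection_entry)

lemma corner_e: "X \<in> corner \<Longrightarrow> X = e lo hi (X $ lo $ hi)"
  using lo_ne_hi unfolding pattern_group_def vec_eq_iff transvection_entry by auto

lemma corner_B: "pattern_group F P \<subseteq> B" by (auto simp: pattern_group_def)

lemma entry_F: "X \<in> B \<Longrightarrow> X $ i $ j \<in> F" by simp

lemma minv_e: "i \<noteq> j \<Longrightarrow> minv (e i j x) = e i j (- x)"
  by (rule inv_equality) (simp_all add: transvection_add)

lemma subgroup_corner: "subgroup corner (SL UNIV)"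
proof (rule subgroupI)
  show "corner \<subseteq> carrier (SL UNIV)" by (auto simp: pattern_group_def)
  show "corner \<noteq> {}" using e_corner[OF F_simps(1)] by blast
  fix a assume a: "a \<in> corner"
  then have aF: "a $ lo $ hi \<in> F" using corner_B entry_F by blast
  show "minv a \<in> corner"
    using corner_e[OF a] minv_e[OF lo_ne_hi] e_corner[OF F_simps(5)[OF aF]] by metis
  fix b assume b: "b \<in> corner"
  then have bF: "b $ lo $ hi \<in> F" using corner_B entry_F by blast
  show "a \<otimes>\<^bsub>SL UNIV\<^esub> b \<in> corner"
    unfolding SL_sel(2) using corner_e[OF a] corner_e[OF b] transvection_add[OF lo_ne_hi]
      e_corner[OF F_simps(3)[OF aF bF]] by metis
qed

subsection \<open>The corner root group\<close>

abbreviation dg :: "'a \<Rightarrow> 'a ^ 'n :: {finite, wellorder} ^ 'n :: {finite, wellorder}" where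
  "dg \<equiv> torus_element lo hi"

lemmas dg_B = torus_element_ST_plus[OF F lo_ne_hi]

lemma conj_corner:
  assumes A: "A \<in> carrier (ST_plus UNIV)" and nz: "A $ hi $ hi \<noteq> 0"
  shows "A ** e lo hi x = e lo hi (x * A $ lo $ lo / A $ hi $ hi) ** A"
proof -
  have 0: "A $ k $ lo = 0" if "k \<noteq> lo" for k using A that lo[of k] by simp
  have 1: "A $ hi $ l = 0" if "l \<noteq> hi" for l using A that hi[of l] by simp
  show ?thesis
    unfolding vec_eq_iff
  proof (intro allI)
    fix k l
    show "(A ** e lo hi x) $ k $ l = (e lo hi (x * A $ lo $ lo / A $ hi $ hi) ** A) $ k $ l"
      using 0[of k] 1[of l] nz by (auto simp: mult_transvection_entry transvection_mult_entry)
  qed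
qed

lemma conj_corner_dg:
  assumes "s \<in> F" "s \<noteq> 0"
  shows "dg s ** e lo hi x ** minv (dg s) = e lo hi (s * s * x)"
proof (rule conj_eq)
  show d: "dg s \<in> carrier (SL UNIV)" using dg_B[OF assms] by (rule in_G)
  show "e lo hi x \<in> carrier (SL UNIV)" "e lo hi (s * s * x) \<in> carrier (SL UNIV)"
    using e_G[OF lo_ne_hi] by blast+
  have "dg s $ lo $ lo = s" "dg s $ hi $ hi = inverse s" using hi_ne_lo by (simp_all add: torus_element_def)
  moreover have "dg s \<in> carrier (ST_plus UNIV)" using dg_B[OF assms] by simp
  ultimately show "dg s ** e lo hi x = e lo hi (s * s * x) ** dg s"
    using conj_corner[of "dg s" x] assms by (simp add: divide_inverse mult.commute mult.left_commute)
qed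

lemma four: "(4 :: 'a) \<noteq> 0"
  using two mult_eq_0_iff[of "2 :: 'a" 2] by simp

lemma numeral_F: "2 \<in> F" "4 \<in> F"
  using F_simps(3)[OF F_simps(2,2)] F_simps(3)[of 2 2] by simp_all

text \<open>Conjugation by the torus element \<open>dg s\<close> multiplies the corner entry by \<open>s * s\<close>, and for \<open>s\<close> near
  one it is jointly continuous for \<open>S\<close>. A small scalar \<open>y\<close> is the difference of the squares of
  \<open>1 + y / 4\<close> and \<open>1 - y / 4\<close>. This is where the characteristic must differ from two.\<close>

lemma corner_scaling:
  assumes V: "openin S V" "mat 1 \<in> V"
  obtains V' U where "openin S V'" "mat 1 \<in> V'" "open U" "0 \<in> U"
    "\<And>x y. x \<in> F \<Longrightarrow> y \<in> F \<Longrightarrow> y \<in> U \<Longrightarrow> e lo hi x \<in> V' \<Longrightarrow> e lo hi (y * x) \<in> V"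
proof -
  obtain V2 where V2: "openin S V2" "mat 1 \<in> V2" "\<And>x y. x \<in> V2 \<Longrightarrow> y \<in> V2 \<Longrightarrow> x ** minv y \<in> V"
    using small_nbS[OF V] by metis
  have c: "continuous_map (prod_topology S S) S (\<lambda>p. fst p ** snd p ** minv (fst p))"
    by (intro contS)
  have one: "mat 1 ** mat 1 ** minv (mat 1) \<in> V2" using V2(2) inv_one unfolding SL_sel(3) by simp
  have oneS: "mat 1 \<in> topspace S" unfolding topS by (rule B_one)
  obtain P V' where PV: "openin S P" "openin S V'" "mat 1 \<in> P" "mat 1 \<in> V'"
      "\<And>p q. p \<in> P \<Longrightarrow> q \<in> V' \<Longrightarrow> p ** q ** minv p \<in> V2"
    using open_preimage_prod[where f = "\<lambda>p q. p ** q ** minv p", OF c V2(1) one oneS oneS] by blast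
  obtain Q where Q: "openin SL_top Q" "P = Q \<inter> B" using openS_T[OF PV(1)] .
  have "mat 1 \<in> Q" using PV Q by blast
  then obtain W where W: "open W" "0 \<in> W"
    "\<And>X. det X = 1 \<Longrightarrow> (\<And>i j. X $ i $ j - mat 1 $ i $ j \<in> W) \<Longrightarrow> X \<in> Q"
    using SL_top_neighbourhood[OF Q(1)] by metis
  let ?q = "inverse 4 :: 'a"
  have "\<forall>\<^sub>F y in nhds 0. (1 + ?q * y \<noteq> 0 \<and> ?q * y \<in> W \<and> inverse (1 + ?q * y) - 1 \<in> W) \<and>
     (1 + - ?q * y \<noteq> 0 \<and> - ?q * y \<in> W \<and> inverse (1 + - ?q * y) - 1 \<in> W)"
    by (intro eventually_conj near_one_inverse W(1,2))
  then obtain U where U: "open U" "0 \<in> U" "\<And>y. y \<in> U \<Longrightarrow>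
     (1 + ?q * y \<noteq> 0 \<and> ?q * y \<in> W \<and> inverse (1 + ?q * y) - 1 \<in> W) \<and>
     (1 + - ?q * y \<noteq> 0 \<and> - ?q * y \<in> W \<and> inverse (1 + - ?q * y) - 1 \<in> W)"
    unfolding eventually_nhds by blast
  have dgP: "dg s \<in> P" if "s \<in> F" "s \<noteq> 0" "s - 1 \<in> W" "inverse s - 1 \<in> W" for s
  proof -
    have "dg s \<in> Q"
      using dg_B[OF that(1,2)] that W(2) by (intro W(3)) (auto simp: torus_element_def mat_def)
    then show ?thesis using Q(2) dg_B[OF that(1,2)] by blast
  qed
  show ?thesis
  proof (rule that[OF PV(2,4) U(1,2)])
    fix x y assume xy: "x \<in> F" "y \<in> F" "y \<in> U" "e lo hi x \<in> V'"
    define s where "s = 1 + ?q * y" define r where "r = 1 + - ?q * y"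
    note Uy = U(3)[OF xy(3)]
    have qF: "?q * y \<in> F" using xy(2) numeral_F F_simps(4,6) by blast
    have s: "s \<in> F" "s \<noteq> 0" "dg s \<in> P"
      using Uy qF F_simps(2,3) by (auto simp: s_def intro!: dgP)
    have "- (?q * y) \<in> F" using qF by (rule F_simps(5))
    then have r: "r \<in> F" "r \<noteq> 0" "dg r \<in> P"
      using Uy F_simps(2) F_simps(3)[of 1 "- (?q * y)"] by (auto simp: r_def intro!: dgP)
    have "e lo hi (s * s * x) \<in> V2" "e lo hi (r * r * x) \<in> V2"
      using PV(5)[OF s(3) xy(4)] PV(5)[OF r(3) xy(4)] conj_corner_dg[OF s(1,2)] conj_corner_dg[OF r(1,2)] by simp_all
    then have "e lo hi (s * s * x) ** minv (e lo hi (r * r * x)) \<in> V" by (rule V2(3))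
    also have "e lo hi (s * s * x) ** minv (e lo hi (r * r * x)) = e lo hi (s * s * x - r * r * x)"
      unfolding minv_e[OF lo_ne_hi] transvection_add[OF lo_ne_hi] by simp
    also have "s * s * x - r * r * x = 4 * ?q * (y * x)"
      by (simp add: s_def r_def algebra_simps)
    also have "\<dots> = y * x" using four by simp
    finally show "e lo hi (y * x) \<in> V" .
  qed
qed

text \<open>Otherwise there would be \<open>S\<close>-small corner matrices with entry \<open>x\<close> so large that \<open>inverse x\<close> is
  an admissible scalar in the scaling lemma, and the fixed matrix with entry \<open>1\<close> would be \<open>S\<close>-small.\<close>

lemma corner_bounded:
  obtains V C where "openin S V" "mat 1 \<in> V" "V \<inter> corner \<subseteq> C" "compactin SL_top C"
proof -
  have e1: "e lo hi 1 \<in> B" using e_B[OF lo_less_hi F_simps(2)] .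
  have "e lo hi 1 \<noteq> mat 1"
  proof
    assume "e lo hi 1 = mat 1"
    then have "e lo hi 1 $ lo $ hi = mat 1 $ lo $ hi" by simp
    then show False using lo_ne_hi by (simp add: transvection_entry mat_def)
  qed
  then obtain V V1 where V: "openin S V" "openin S V1" "mat 1 \<in> V" "e lo hi 1 \<in> V1" "disjnt V V1"
    using Hausdorff_S e1 B_one unfolding Hausdorff_space_def topS by metis
  obtain V' U where U: "openin S V'" "mat 1 \<in> V'" "open U" "0 \<in> U"
    "\<And>x y. x \<in> F \<Longrightarrow> y \<in> F \<Longrightarrow> y \<in> U \<Longrightarrow> e lo hi x \<in> V' \<Longrightarrow> e lo hi (y * x) \<in> V"
    using corner_scaling[OF V(1,3)] by metis
  obtain C where C: "compact C" "\<And>x. x \<notin> C \<Longrightarrow> inverse x \<in> U"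
    using inverse_near_0_outside_compact[OF U(3,4)] by metis
  have "V' \<inter> corner \<subseteq> e lo hi ` insert 0 C"
  proof
    fix X assume X: "X \<in> V' \<inter> corner"
    define x where "x = X $ lo $ hi"
    have Xe: "X = e lo hi x" using corner_e X x_def by blast
    have xF: "x \<in> F" using X corner_B entry_F x_def by blast
    have "x \<in> insert 0 C"
    proof (rule ccontr)
      assume n: "x \<notin> insert 0 C"
      then have "e lo hi (inverse x * x) \<in> V"
        using C(2)[of x] X Xe xF F_simps(6) by (intro U(5)) auto
      then show False using n V(4,5) by (auto simp: disjnt_iff)
    qed
    then show "X \<in> e lo hi ` insert 0 C" using Xe by blast
  qed
  moreover have "compactin SL_top (e lo hi ` insert 0 C)"
    using C(1) by (intro compactin_transvections lo_ne_hi) simp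
  ultimately show ?thesis using that U(1,2) by blast
qed

lemma closure_pattern:
  assumes "X \<in> SL_top closure_of pattern_group F P"
  shows "(i, j) \<notin> P \<Longrightarrow> X $ i $ j = (if i = j then 1 else 0)" and "X $ i $ j \<in> closure F"
proof -
  show "X $ i $ j = (if i = j then 1 else 0)" if ij: "(i, j) \<notin> P"
  proof (rule ccontr)
    assume ne: "X $ i $ j \<noteq> (if i = j then 1 else 0)"
    have "openin SL_top {Y \<in> carrier (SL UNIV). Y $ i $ j \<in> - {if i = j then 1 else 0}}"
      by (intro openin_SL_entry continuous_intros)
    moreover have "X \<in> {Y \<in> carrier (SL UNIV). Y $ i $ j \<in> - {if i = j then 1 else 0}}"
      using ne assms by (auto simp: in_closure_of)
    ultimately obtain Y where "Y \<in> pattern_group F P" "Y $ i $ j \<noteq> (if i = j then 1 else 0)"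
      using closure_meets[OF assms] by blast
    then show False using ij by (simp add: pattern_group_def)
  qed
  have "pattern_group F P \<subseteq> carrier (SL F)" by (auto simp: pattern_group_def)
  then have "X \<in> SL_top closure_of carrier (SL F)" using assms closure_of_mono by blast
  then show "X $ i $ j \<in> closure F" by (rule closure_entries)
qed

text \<open>The entries of the residue form a closed additive group that is stable under multiplication by
  squares from \<open>F\<close>, hence by \<open>F\<close>, since every element of \<open>F\<close> is a difference of two squares. If it contained
  some \<open>z \<noteq> 0\<close>, it would contain \<open>1\<close>, because \<open>inverse z\<close> is a limit of elements of \<open>F\<close>.\<close>

lemma residue_corner: "residue corner \<subseteq> {mat 1}"
proof
  fix g assume g: "g \<in> residue corner"
  define z where "z = g $ lo $ hi"
  note gc = closure_pattern[OF residue_closure[OF g]]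
  have ge: "g = e lo hi z"
    unfolding vec_eq_iff transvection_entry z_def using gc(1) lo_ne_hi by auto
  have zF: "z \<in> closure F" unfolding z_def by (rule gc(2))
  have invol: "e lo hi (- x) \<in> residue corner" if "e lo hi x \<in> residue corner" for x
    using residue_inv[OF subgroup.m_inv_closed[OF subgroup_corner] that] minv_e[OF lo_ne_hi] by simp
  have sq: "e lo hi (s * s * z) \<in> residue corner" if s: "s \<in> F" for s
  proof (cases "s = 0")
    case True
    have "mat 1 \<in> corner" using e_corner[OF F_simps(1)] by simp
    then show ?thesis using True one_residue by simp
  next
    case False
    have "dg s ** x ** minv (dg s) \<in> corner" if x: "x \<in> corner" for x
    proof -
      have "x $ lo $ hi \<in> F" using x corner_B entry_F by blast
      then have "e lo hi (s * s * x $ lo $ hi) \<in> corner" using s F_simps(4) by (intro e_corner) blast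
      then show ?thesis using conj_corner_dg[OF s False, of "x $ lo $ hi"] corner_e[OF x] by metis
    qed
    moreover have dc: "dg s \<in> SL_top closure_of {dg s}"
      using closure_of_subset[of "{dg s}" SL_top] dg_B[OF s False] in_G topT by simp
    ultimately have "dg s ** g ** minv (dg s) \<in> residue corner"
      using dg_B[OF s False] by (intro res_conj[OF _ _ dc g]) auto
    then show ?thesis using conj_corner_dg[OF s False] ge by simp
  qed
  have mult: "e lo hi (y * z) \<in> residue corner" if y: "y \<in> F" for y
  proof -
    define s where "s = (y + 1) / 2" define r where "r = (y - 1) / 2"
    have sr: "s \<in> F" "r \<in> F"
      unfolding s_def r_def by (intro F_simps(2,3,7,8) y numeral_F)+
    have "e lo hi (s * s * z) ** e lo hi (- (r * r * z)) \<in> residue corner"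
      by (rule res_mult[OF subgroup.m_closed[OF subgroup_corner, unfolded SL_sel(2)]
            sq[OF sr(1)] invol[OF sq[OF sr(2)]]])
    also have "e lo hi (s * s * z) ** e lo hi (- (r * r * z)) = e lo hi ((s * s - r * r) * z)"
      unfolding transvection_add[OF lo_ne_hi] by (simp add: algebra_simps)
    also have "s * s - r * r = y"
    proof -
      have "s * s - r * r = (s + r) * (s - r)" by (simp add: algebra_simps)
      moreover have "s + r = y" "s - r = 1" unfolding s_def r_def
        using two by (simp_all add: add_divide_distrib[symmetric] diff_divide_distrib[symmetric] mult_2[symmetric])
      ultimately show ?thesis by simp
    qed
    finally show ?thesis .
  qed
  have "z = 0"
  proof (rule ccontr)
    assume z: "z \<noteq> 0"
    have "e lo hi 1 \<in> residue corner"
    proof (rule residueI)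
      show "e lo hi 1 \<in> carrier (SL UNIV)" by (rule e_G[OF lo_ne_hi])
      fix V Q assume VQ: "openin S V" "\<one>\<^bsub>SL UNIV\<^esub> \<in> V" "openin SL_top Q" "e lo hi 1 \<in> Q"
      obtain W where W: "open W" "0 \<in> W" "\<And>X. det X = 1 \<Longrightarrow> (\<And>i j. X $ i $ j - e lo hi 1 $ i $ j \<in> W) \<Longrightarrow> X \<in> Q"
        using SL_top_neighbourhood[OF VQ(3,4)] by metis
      have "open ((\<lambda>y. y * z - 1) -` W)" by (intro open_vimage W continuous_intros)
      moreover have "inverse z \<in> (\<lambda>y. y * z - 1) -` W" using z W by simp
      moreover have "inverse z \<in> closure F" using is_subfieldD(6)[OF is_subfield_closure[OF F] zF] .
      ultimately obtain y where y: "y \<in> F" "y * z - 1 \<in> W" using closure_point_meets by blast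
      have "e lo hi (y * z) \<in> Q"
        using y(2) W(2) det_transvection[OF lo_ne_hi] by (intro W(3)) (auto simp: transvection_entry)
      then obtain x where "x \<in> V" "x \<in> corner" "x \<in> Q"
        using residueD[OF mult[OF y(1)] VQ(1,2,3)] by blast
      then show "\<exists>x. x \<in> V \<and> x \<in> corner \<and> x \<in> Q" by blast
    qed
    then have "e lo hi 1 \<in> residue B" using residue_mono[OF corner_B] by blast
    then have "e lo hi 1 = mat 1" using residue_Int_H[OF _ e_B[OF lo_less_hi F_simps(2)]] by simp
    then have "e lo hi 1 $ lo $ hi = mat 1 $ lo $ hi" by simp
    then show False using lo_ne_hi by (simp add: transvection_entry mat_def)
  qed
  then show "g \<in> {mat 1}" using ge by simp
qed

lemma agree_corner: "agree corner"
proof -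
  obtain V C where "openin S V" "mat 1 \<in> V" "V \<inter> corner \<subseteq> C" "compactin SL_top C"
    by (rule corner_bounded)
  then show ?thesis using agree_of_compact[of V corner C] residue_corner by simp
qed

subsection \<open>The last column and the first row\<close>

lemma openS_finite_Inter:
  assumes "finite I" "\<And>i. i \<in> I \<Longrightarrow> openin S (V i) \<and> mat 1 \<in> V i"
  shows "openin S (B \<inter> \<Inter> (V ` I))" "mat 1 \<in> B \<inter> \<Inter> (V ` I)"
  using assms openS_H B_one by (auto intro!: openin_Int_Inter simp del: ST_plus_sel(1))

lemma agree_entry:
  assumes "agree L" "open W" "0 \<in> W"
  obtains V where "openin S V" "mat 1 \<in> V"
    "\<And>X. X \<in> V \<Longrightarrow> X \<in> L \<Longrightarrow> X $ i $ j - (if i = j then 1 else 0) \<in> W"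
proof -
  let ?f = "\<lambda>X :: 'a ^ 'n :: {finite, wellorder} ^ 'n :: {finite, wellorder}. X $ i $ j - (if i = j then 1 else 0)"
  have "openin SL_top {X \<in> carrier (SL UNIV). ?f X \<in> W}"
    using assms(2) by (intro openin_SL_entry continuous_intros)
  moreover have "?f (mat 1) \<in> W" using assms(3) by (simp add: mat_def)
  then have "mat 1 \<in> {X \<in> carrier (SL UNIV). ?f X \<in> W}" using in_G[OF B_one] by blast
  ultimately obtain V where "openin S V" "mat 1 \<in> V" "V \<inter> L \<subseteq> {X \<in> carrier (SL UNIV). ?f X \<in> W}"
    using agD[OF assms(1)] by blast
  then show ?thesis by (intro that[of V]) blast+
qed

text \<open>If an entry is small on the members of \<open>L\<close> near the identity, it is small on the commutators with a
  fixed \<open>c\<close> of all elements near the identity, provided that these commutators belong to \<open>L\<close>.\<close>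

lemma commutator_nbhd:
  assumes "agree L" "open W" "0 \<in> W" "c \<in> B"
  obtains V where "openin S V" "mat 1 \<in> V" "V \<subseteq> B"
    "\<And>X. X \<in> V \<Longrightarrow> X ** c ** minv X ** minv c \<in> L \<Longrightarrow>
       (X ** c ** minv X ** minv c) $ i $ j - (if i = j then 1 else 0) \<in> W"
proof -
  obtain V0 where V0: "openin S V0" "mat 1 \<in> V0"
    "\<And>X. X \<in> V0 \<Longrightarrow> X \<in> L \<Longrightarrow> X $ i $ j - (if i = j then 1 else 0) \<in> W"
    using agree_entry[OF assms(1-3)] by metis
  let ?V = "{X \<in> B. X ** c ** minv X ** minv c \<in> V0}"
  have "continuous_map S S (\<lambda>X. X ** c ** minv X ** minv c)"
    by (intro contS H.m_inv_closed assms(4))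
  then have "openin S ?V" using V0(1) by (rule open_preimageS)
  moreover have "mat 1 ** c ** minv (mat 1) ** minv c = mat 1"
    using minv_mult(2)[OF in_G[OF assms(4)]] inv_one unfolding SL_sel(3) by simp
  then have "mat 1 ** c ** minv (mat 1) ** minv c \<in> V0" using V0(2) by simp
  then have "mat 1 \<in> ?V" using B_one by blast
  ultimately show ?thesis using V0(3) by (intro that[of ?V]) blast+
qed

text \<open>If all entries except the corner entry are known to be \<open>T\<close>-small near the identity of \<open>S\<close>, a member
  of the group is a \<open>T\<close>-small element times a corner matrix, and the corner has been dealt with.\<close>

lemma agree_pattern:
  assumes P: "(lo, hi) \<in> P" "\<And>i j. (i, j) \<in> P \<Longrightarrow> i < j"
    and near: "\<And>i j W. (i, j) \<in> P \<Longrightarrow> (i, j) \<noteq> (lo, hi) \<Longrightarrow> open W \<Longrightarrow> 0 \<in> W \<Longrightarrow>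
      \<exists>V. openin S V \<and> mat 1 \<in> V \<and> (\<forall>X\<in>V \<inter> pattern_group F P. X $ i $ j \<in> W)"
  shows "agree (pattern_group F P)"
proof (rule agree_of_factorization[OF agree_corner corner_B corner_B])
  fix Q :: "('a ^ 'n :: {finite, wellorder} ^ 'n :: {finite, wellorder}) set"
  assume Q: "openin SL_top Q" "\<one>\<^bsub>SL UNIV\<^esub> \<in> Q"
  then have Q1: "mat 1 \<in> Q" by simp
  obtain W where W: "open W" "0 \<in> W" "\<And>X. det X = 1 \<Longrightarrow> (\<And>i j. X $ i $ j - mat 1 $ i $ j \<in> W) \<Longrightarrow> X \<in> Q"
    using SL_top_neighbourhood[OF Q(1) Q1] by metis
  have "\<exists>V. openin S V \<and> mat 1 \<in> V \<and> (\<forall>X\<in>V \<inter> pattern_group F P. X $ fst q $ snd q \<in> W)" if "q \<in> P - {(lo, hi)}" for q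
    using near[of "fst q" "snd q" W] W that by simp
  then obtain V where V: "\<And>q. q \<in> P - {(lo, hi)} \<Longrightarrow>
     openin S (V q) \<and> mat 1 \<in> V q \<and> (\<forall>X\<in>V q \<inter> pattern_group F P. X $ fst q $ snd q \<in> W)"
    by metis
  let ?V = "B \<inter> \<Inter> (V ` (P - {(lo, hi)}))"
  have "openin S ?V" "mat 1 \<in> ?V" using V by (intro openS_finite_Inter; simp)+
  moreover have "\<exists>a\<in>Q \<inter> B. \<exists>b\<in>corner. X = a \<otimes>\<^bsub>SL UNIV\<^esub> b" if X: "X \<in> ?V \<inter> pattern_group F P" for X
  proof -
    define x where "x = X $ lo $ hi"
    have XB: "X \<in> B" using X by blast
    have xF: "x \<in> F" unfolding x_def by (rule entry_F[OF XB])
    have Xp: "X $ i $ j = (if i = j then 1 else 0)" if "(i, j) \<notin> P" for i j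
      using X that unfolding pattern_group_def by blast
    have XW: "X $ i $ j \<in> W" if "(i, j) \<in> P" "(i, j) \<noteq> (lo, hi)" for i j
      using V[of "(i, j)"] X that by auto
    define a where "a = X ** e lo hi (- x)"
    have lo1: "X $ k $ lo = (if k = lo then 1 else 0)" for k
    proof -
      have "(k, lo) \<notin> P" using P(2)[of k lo] not_less_lo by blast
      then show ?thesis by (rule Xp)
    qed
    have ae: "a $ k $ l = (if (k, l) = (lo, hi) then 0 else X $ k $ l)" for k l
      unfolding a_def mult_transvection_entry using lo1 by (simp add: x_def)
    have aB: "a \<in> B" unfolding a_def by (intro B_mult XB e_B[OF lo_less_hi] F_simps(5) xF)
    have "a \<in> Q"
    proof (rule W(3))
      show "det a = 1" using aB by simp
      fix k l
      show "a $ k $ l - mat 1 $ k $ l \<in> W"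
      proof (cases "(k, l) \<in> P \<and> (k, l) \<noteq> (lo, hi)")
        case True
        then have "k \<noteq> l" using P(2)[of k l] by auto
        then show ?thesis using True XW[of k l] unfolding ae by (auto simp: mat_def)
      next
        case False
        show ?thesis
        proof (cases "(k, l) = (lo, hi)")
          case True
          then show ?thesis using W(2) lo_ne_hi by (simp add: ae mat_def)
        next
          case ne: False
          then have "X $ k $ l = (if k = l then 1 else 0)" using False by (intro Xp) blast
          then show ?thesis using ne W(2) by (auto simp: ae mat_def)
        qed
      qed
    qed
    moreover have "X = a ** e lo hi x"
      unfolding a_def matrix_mul_assoc[symmetric] transvection_add[OF lo_ne_hi] by simp
    ultimately show ?thesis using aB e_corner[OF xF] unfolding SL_sel(2) by blast
  qed
  ultimately show "\<exists>V. openin S V \<and> \<one>\<^bsub>SL UNIV\<^esub> \<in> V \<and> (\<forall>X\<in>V \<inter> pattern_group F P. \<exists>a\<in>Q \<inter> B. \<exists>b\<in>corner. X = a \<otimes>\<^bsub>SL UNIV\<^esub> b)"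
    unfolding SL_sel(3) by (intro exI[of _ ?V] conjI ballI)
qed

abbreviation "last_column \<equiv> {(i, hi) |i. i < hi}"
abbreviation "first_row \<equiv> {(lo, j) |j. lo < j}"

text \<open>The commutator of a member of this group with the root element at \<open>(lo, i)\<close> is the corner matrix
  whose entry is the one at \<open>(i, hi)\<close>, up to a sign that the choice \<open>- 1\<close> of the scalar removes.\<close>

lemma agree_last_column: "agree (pattern_group F last_column)"
proof (rule agree_pattern)
  show "(lo, hi) \<in> last_column" using lo_less_hi by blast
  show "i < j" if "(i, j) \<in> last_column" for i j using that by blast
  fix i j W assume ij: "(i, j) \<in> last_column" "(i, j) \<noteq> (lo, hi)" and W: "open W" "(0 :: 'a) \<in> W"
  then have i: "j = hi" "i < hi" "i \<noteq> lo" by auto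
  then have lo_i: "lo < i" using lo[of i] by simp
  define c where "c = e lo i (- 1)"
  have cB: "c \<in> B" unfolding c_def by (intro e_B lo_i F_simps(5) F_simps(2))
  have ci: "minv c = e lo i 1" unfolding c_def using minv_e[of lo i "- 1"] lo_i by simp
  obtain V where V: "openin S V" "mat 1 \<in> V" "V \<subseteq> B"
    "\<And>X. X \<in> V \<Longrightarrow> X ** c ** minv X ** minv c \<in> corner \<Longrightarrow>
       (X ** c ** minv X ** minv c) $ lo $ hi - (if lo = hi then 1 else 0) \<in> W"
    using commutator_nbhd[OF agree_corner W cB] by metis
  have "X $ i $ hi \<in> W" if X: "X \<in> V" "X \<in> pattern_group F last_column" for X
  proof -
    have XB: "X \<in> B" using X V by blast
    have Xp: "X $ k $ l = (if k = l then 1 else 0)" if "l \<noteq> hi \<or> \<not> k < hi" for k l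
      using X(2) that unfolding pattern_group_def by auto
    have hi0: "X $ hi $ l = 0" if "l \<noteq> hi" for l using Xp[of l hi] that by auto
    have "X ** c = e lo hi (X $ i $ hi) ** c ** X"
      unfolding vec_eq_iff
    proof (intro allI)
      fix k l show "(X ** c) $ k $ l = (e lo hi (X $ i $ hi) ** c ** X) $ k $ l"
        unfolding c_def matrix_mul_assoc[symmetric]
        using Xp[of l k] Xp[of l i] Xp[of lo k] Xp[of k lo] Xp[of i l] Xp[of hi l] i lo_ne_hi lo_i
        by (cases "l = hi") (auto simp: mult_transvection_entry transvection_mult_entry hi0)
    qed
    then have "X ** c ** minv X ** minv c = e lo hi (X $ i $ hi)"
      using in_G[OF XB] in_G[OF cB] by (intro commutator_eq)
    then show ?thesis
      using V(4)[OF X(1)] e_corner[OF entry_F[OF XB, of i hi]] lo_ne_hi by (simp add: transvection_entry)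
  qed
  then show "\<exists>V. openin S V \<and> mat 1 \<in> V \<and> (\<forall>X\<in>V \<inter> pattern_group F last_column. X $ i $ j \<in> W)"
    using V(1,2) i by (intro exI[of _ V]) blast
qed

lemma agree_first_row: "agree (pattern_group F first_row)"
proof (rule agree_pattern)
  show "(lo, hi) \<in> first_row" using lo_less_hi by blast
  show "i < j" if "(i, j) \<in> first_row" for i j using that by blast
  fix i j W assume ij: "(i, j) \<in> first_row" "(i, j) \<noteq> (lo, hi)" and W: "open W" "(0 :: 'a) \<in> W"
  then have i: "i = lo" "lo < j" "j \<noteq> hi" by auto
  then have j_hi: "j < hi" using hi[of j] by simp
  define c where "c = e j hi 1"
  have cB: "c \<in> B" unfolding c_def by (intro e_B j_hi F_simps(2))
  obtain V where V: "openin S V" "mat 1 \<in> V" "V \<subseteq> B"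
    "\<And>X. X \<in> V \<Longrightarrow> X ** c ** minv X ** minv c \<in> corner \<Longrightarrow>
       (X ** c ** minv X ** minv c) $ lo $ hi - (if lo = hi then 1 else 0) \<in> W"
    using commutator_nbhd[OF agree_corner W cB] by metis
  have "X $ lo $ j \<in> W" if X: "X \<in> V" "X \<in> pattern_group F first_row" for X
  proof -
    have XB: "X \<in> B" using X V by blast
    have Xp: "X $ k $ l = (if k = l then 1 else 0)" if "k \<noteq> lo \<or> \<not> lo < l" for k l
      using X(2) that unfolding pattern_group_def by auto
    have "X ** c = e lo hi (X $ lo $ j) ** c ** X"
      unfolding vec_eq_iff
    proof (intro allI)
      fix k l show "(X ** c) $ k $ l = (e lo hi (X $ lo $ j) ** c ** X) $ k $ l"
        unfolding c_def matrix_mul_assoc[symmetric]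
        using Xp[of k j] Xp[of hi l] i j_hi lo_ne_hi
        by (auto simp: mult_transvection_entry transvection_mult_entry)
    qed
    then have "X ** c ** minv X ** minv c = e lo hi (X $ lo $ j)"
      using in_G[OF XB] in_G[OF cB] by (intro commutator_eq)
    then show ?thesis
      using V(4)[OF X(1)] e_corner[OF entry_F[OF XB, of lo j]] lo_ne_hi by (simp add: transvection_entry)
  qed
  then show "\<exists>V. openin S V \<and> mat 1 \<in> V \<and> (\<forall>X\<in>V \<inter> pattern_group F first_row. X $ i $ j \<in> W)"
    using V(1,2) i by (intro exI[of _ V]) blast
qed

subsection \<open>Commutators with root elements\<close>

definition column_matrix :: "('n \<Rightarrow> 'a) \<Rightarrow> 'a ^ 'n :: {finite, wellorder} ^ 'n :: {finite, wellorder}" where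
  "column_matrix v = (\<chi> k l. (if k = l then 1 else 0) + (if l = hi then v k else 0))"

definition row_matrix :: "('n \<Rightarrow> 'a) \<Rightarrow> 'a ^ 'n :: {finite, wellorder} ^ 'n :: {finite, wellorder}" where
  "row_matrix v = (\<chi> k l. (if k = l then 1 else 0) + (if k = lo then v l else 0))"

lemma column_matrix_mult: "(column_matrix v ** M) $ k $ l = M $ k $ l + v k * M $ hi $ l"
proof -
  have "(column_matrix v ** M) $ k $ l
     = (\<Sum>r\<in>UNIV. (if k = r then M $ r $ l else 0) + (if r = hi then v k * M $ hi $ l else 0))"
    unfolding matrix_matrix_mult_def column_matrix_def vec_lambda_beta
    by (intro sum.cong refl) (simp add: algebra_simps)
  then show ?thesis by (simp add: sum.distrib)
qed

lemma mult_row_matrix: "(M ** row_matrix v) $ k $ l = M $ k $ l + M $ k $ lo * v l"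
proof -
  have "(M ** row_matrix v) $ k $ l
     = (\<Sum>r\<in>UNIV. (if r = l then M $ k $ r else 0) + (if r = lo then M $ k $ lo * v l else 0))"
    unfolding matrix_matrix_mult_def row_matrix_def vec_lambda_beta
    by (intro sum.cong refl) (simp add: algebra_simps)
  then show ?thesis by (simp add: sum.distrib)
qed

lemma ST_diagonal_nonzero: "A \<in> carrier (ST_plus UNIV) \<Longrightarrow> A $ i $ i \<noteq> 0"
  for A :: "'a ^ 'n :: {finite, wellorder} ^ 'n :: {finite, wellorder}"
proof
  assume A: "A \<in> carrier (ST_plus UNIV)" "A $ i $ i = 0"
  then have "det A = (\<Prod>i\<in>UNIV. A $ i $ i)" by (intro det_upperdiagonal) auto
  also have "\<dots> = 0" using A(2) by (intro prod_zero) auto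
  finally show False using A by simp
qed

lemma commutator_column:
  assumes A: "A \<in> carrier (ST_plus UNIV)" and j: "j \<noteq> hi"
  shows "A ** e j hi 1 ** minv A ** minv (e j hi 1)
    = column_matrix (\<lambda>k. A $ k $ j / A $ hi $ hi - (if k = j then 1 else 0))" (is "_ = column_matrix ?v")
proof (rule commutator_eq)
  show AG: "A \<in> carrier (SL UNIV)" "e j hi 1 \<in> carrier (SL UNIV)" using A j by auto
  have 0: "A $ hi $ l = 0" if "l \<noteq> hi" for l using A that hi[of l] by simp
  have nz: "A $ hi $ hi \<noteq> 0" by (rule ST_diagonal_nonzero[OF A])
  show "A ** e j hi 1 = column_matrix ?v ** e j hi 1 ** A"
    unfolding vec_eq_iff
  proof (intro allI)
    fix k l show "(A ** e j hi 1) $ k $ l = (column_matrix ?v ** e j hi 1 ** A) $ k $ l"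
      unfolding matrix_mul_assoc[symmetric] column_matrix_mult mult_transvection_entry transvection_mult_entry
      using 0[of l] nz j by (cases "l = hi") (auto simp: algebra_simps)
  qed
qed

lemma commutator_row:
  assumes A: "A \<in> carrier (ST_plus UNIV)" and j: "j \<noteq> lo"
  shows "minv A ** e lo j 1 ** A ** minv (e lo j 1)
    = row_matrix (\<lambda>l. A $ j $ l / A $ lo $ lo - (if l = j then 1 else 0))" (is "_ = row_matrix ?v")
proof -
  have AG: "A \<in> carrier (SL UNIV)" "e lo j 1 \<in> carrier (SL UNIV)" using A j by auto
  have 0: "A $ k $ lo = 0" if "k \<noteq> lo" for k using A that lo[of k] by simp
  have nz: "A $ lo $ lo \<noteq> 0" by (rule ST_diagonal_nonzero[OF A])
  have eq: "e lo j 1 ** A = A ** row_matrix ?v ** e lo j 1"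
    unfolding vec_eq_iff
  proof (intro allI)
    fix k l show "(e lo j 1 ** A) $ k $ l = (A ** row_matrix ?v ** e lo j 1) $ k $ l"
      unfolding mult_row_matrix mult_transvection_entry transvection_mult_entry
      using 0[of k] 0[of j] nz j by (cases "k = lo") (auto simp: algebra_simps)
  qed
  have "minv A ** e lo j 1 ** A ** minv (e lo j 1) = minv A ** (e lo j 1 ** A) ** minv (e lo j 1)"
    by (simp add: matrix_mul_assoc)
  also have "\<dots> = (minv A ** A) ** row_matrix ?v ** (e lo j 1 ** minv (e lo j 1))"
    unfolding eq by (simp add: matrix_mul_assoc)
  also have "\<dots> = row_matrix ?v" using minv_mult[OF AG(1)] minv_mult[OF AG(2)] by simp
  finally show ?thesis .
qed

end

context coarser_on_ST
begin

lemma commutator_in_B: "A \<in> B \<Longrightarrow> C \<in> B \<Longrightarrow> A ** C ** minv A ** minv C \<in> B"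
  by (intro B_mult H.m_inv_closed)

lemma mat_below_diagonal: "j < i \<Longrightarrow> (mat c :: 'a ^ 'n :: {finite, wellorder} ^ 'n :: {finite, wellorder}) $ i $ j = 0"
  by (auto simp: mat_def)

lemma B_UNIV: "A \<in> B \<Longrightarrow> A \<in> carrier (ST_plus UNIV)" by simp

lemma near_column:
  assumes W: "open W" "0 \<in> W" and j: "j \<noteq> hi"
  shows "\<exists>V. openin S V \<and> mat 1 \<in> V \<and> (\<forall>A\<in>V. A $ k $ j / A $ hi $ hi - (if k = j then 1 else 0) \<in> W)"
proof -
  have "j < hi" using j hi[of j] by simp
  then have cB: "e j hi 1 \<in> B" by (intro e_B F_simps(2))
  obtain V where V: "openin S V" "mat 1 \<in> V" "V \<subseteq> B"
    "\<And>X. X \<in> V \<Longrightarrow> X ** e j hi 1 ** minv X ** minv (e j hi 1) \<in> pattern_group F last_column \<Longrightarrow>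
       (X ** e j hi 1 ** minv X ** minv (e j hi 1)) $ k $ hi - (if k = hi then 1 else 0) \<in> W"
    by (rule commutator_nbhd[OF agree_last_column W cB, where i = k and j = hi]) blast
  have "A $ k $ j / A $ hi $ hi - (if k = j then 1 else 0) \<in> W" if A: "A \<in> V" for A
  proof -
    have AB: "A \<in> B" using A V(3) by blast
    let ?v = "\<lambda>k. A $ k $ j / A $ hi $ hi - (if k = j then 1 else 0)"
    note eq = commutator_column[OF B_UNIV[OF AB] j]
    have "A $ hi $ j = 0" using AB \<open>j < hi\<close> by simp
    then have v: "?v hi = 0" using j by simp
    have "column_matrix ?v \<in> B" using commutator_in_B[OF AB cB] unfolding eq .
    moreover have "column_matrix ?v $ i $ l = (if i = l then 1 else 0)" if "(i, l) \<notin> last_column" for i l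
      using that v hi[of i] unfolding column_matrix_def by (cases "l = hi") auto
    ultimately have "column_matrix ?v \<in> pattern_group F last_column"
      unfolding pattern_group_def by blast
    then have "column_matrix ?v $ k $ hi - (if k = hi then 1 else 0) \<in> W" using V(4)[OF A] unfolding eq by blast
    then show ?thesis by (simp add: column_matrix_def)
  qed
  then show ?thesis using V(1,2) by blast
qed

lemma near_row:
  assumes W: "open W" "0 \<in> W" and j: "j \<noteq> lo"
  shows "\<exists>V. openin S V \<and> mat 1 \<in> V \<and> (\<forall>A\<in>V. A $ j $ l / A $ lo $ lo - (if l = j then 1 else 0) \<in> W)"
proof -
  have "lo < j" using j lo[of j] by simp
  then have cB: "e lo j 1 \<in> B" by (intro e_B F_simps(2))
  obtain V where V: "openin S V" "mat 1 \<in> V" "V \<subseteq> B"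
    "\<And>X. X \<in> V \<Longrightarrow> X ** e lo j 1 ** minv X ** minv (e lo j 1) \<in> pattern_group F first_row \<Longrightarrow>
       (X ** e lo j 1 ** minv X ** minv (e lo j 1)) $ lo $ l - (if lo = l then 1 else 0) \<in> W"
    by (rule commutator_nbhd[OF agree_first_row W cB, where i = lo and j = l]) blast
  have "continuous_map S S (\<lambda>X. minv X)" by (intro contS)
  then have "openin S {A \<in> B. minv A \<in> V}" using V(1) by (rule open_preimageS)
  moreover have "minv (mat 1) = mat 1" using inv_one unfolding SL_sel(3) .
  then have "mat 1 \<in> {A \<in> B. minv A \<in> V}" using B_one V(2) by simp
  moreover have "A $ j $ l / A $ lo $ lo - (if l = j then 1 else 0) \<in> W" if A: "A \<in> B" "minv A \<in> V" for A
  proof -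
    let ?v = "\<lambda>l. A $ j $ l / A $ lo $ lo - (if l = j then 1 else 0)"
    have eq: "minv A ** e lo j 1 ** minv (minv A) ** minv (e lo j 1) = row_matrix ?v"
      unfolding inv_inv[OF in_G[OF A(1)]] by (rule commutator_row[OF B_UNIV[OF A(1)] j])
    have "A $ j $ lo = 0" using A(1) \<open>lo < j\<close> by simp
    then have v: "?v lo = 0" using j by simp
    have "row_matrix ?v \<in> B" using commutator_in_B[OF H.m_inv_closed[OF A(1)] cB] unfolding eq .
    moreover have "row_matrix ?v $ i $ k = (if i = k then 1 else 0)" if "(i, k) \<notin> first_row" for i k
      using that v lo[of k] unfolding row_matrix_def by (cases "i = lo") auto
    ultimately have "row_matrix ?v \<in> pattern_group F first_row"
      unfolding pattern_group_def by blast
    then have "row_matrix ?v $ lo $ l - (if lo = l then 1 else 0) \<in> W" using V(4)[OF A(2)] unfolding eq by blast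
    then show ?thesis by (simp add: row_matrix_def)
  qed
  ultimately show ?thesis by blast
qed

text \<open>Near the identity of \<open>S\<close>, a triangular matrix is close to a scalar multiple of the identity except
  possibly at the corner: commutators with the root elements of the last column control its columns, those
  with the root elements of the first row control its rows.\<close>

lemma near_scalar_times_corner:
  assumes W: "open W" "0 \<in> W"
  obtains V where "openin S V" "mat 1 \<in> V" "V \<subseteq> B"
    "\<And>A k j. A \<in> V \<Longrightarrow> j \<noteq> hi \<Longrightarrow> A $ k $ j / A $ hi $ hi - (if k = j then 1 else 0) \<in> W"
    "\<And>A j l. A \<in> V \<Longrightarrow> j \<noteq> lo \<Longrightarrow> A $ j $ l / A $ lo $ lo - (if l = j then 1 else 0) \<in> W"
proof -
  define P where "P q A \<longleftrightarrow>
      (snd q \<noteq> hi \<longrightarrow> A $ fst q $ snd q / A $ hi $ hi - (if fst q = snd q then 1 else 0) \<in> W) \<and>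
      (fst q \<noteq> lo \<longrightarrow> A $ fst q $ snd q / A $ lo $ lo - (if snd q = fst q then 1 else 0) \<in> W)"
    for q :: "'n \<times> 'n" and A
  have "\<exists>V. openin S V \<and> mat 1 \<in> V \<and> (\<forall>A\<in>V. P q A)" for q
  proof -
    have "\<exists>V1. openin S V1 \<and> mat 1 \<in> V1 \<and>
       (\<forall>A\<in>V1. snd q \<noteq> hi \<longrightarrow> A $ fst q $ snd q / A $ hi $ hi - (if fst q = snd q then 1 else 0) \<in> W)"
      using near_column[OF W, of "snd q" "fst q"] openS_H B_one by (cases "snd q = hi") blast+
    moreover have "\<exists>V2. openin S V2 \<and> mat 1 \<in> V2 \<and>
       (\<forall>A\<in>V2. fst q \<noteq> lo \<longrightarrow> A $ fst q $ snd q / A $ lo $ lo - (if snd q = fst q then 1 else 0) \<in> W)"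
      using near_row[OF W, of "fst q" "snd q"] openS_H B_one by (cases "fst q = lo") blast+
    ultimately obtain V1 V2 where V1: "openin S V1" "mat 1 \<in> V1"
       "\<forall>A\<in>V1. snd q \<noteq> hi \<longrightarrow> A $ fst q $ snd q / A $ hi $ hi - (if fst q = snd q then 1 else 0) \<in> W"
      and V2: "openin S V2" "mat 1 \<in> V2"
       "\<forall>A\<in>V2. fst q \<noteq> lo \<longrightarrow> A $ fst q $ snd q / A $ lo $ lo - (if snd q = fst q then 1 else 0) \<in> W"
      by (elim exE conjE) rule
    have "P q A" if "A \<in> V1 \<inter> V2" for A
      unfolding P_def using bspec[OF V1(3), of A] bspec[OF V2(3), of A] that by (intro conjI) blast+
    then show ?thesis
      using V1(1,2) V2(1,2) by (intro exI[of _ "V1 \<inter> V2"] conjI openin_Int IntI ballI)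
  qed
  then obtain V where V: "\<And>q. openin S (V q) \<and> mat 1 \<in> V q \<and> (\<forall>A\<in>V q. P q A)" by metis
  let ?V = "B \<inter> \<Inter> (V ` UNIV)"
  have P: "P q A" if "A \<in> ?V" for q A using V that by blast
  show ?thesis
  proof (rule that[of ?V])
    show "openin S ?V" "mat 1 \<in> ?V" using V by (intro openS_finite_Inter finite; blast)+
    show "A $ k $ j / A $ hi $ hi - (if k = j then 1 else 0) \<in> W" if "A \<in> ?V" "j \<noteq> hi" for A k j
      using P[OF that(1), of "(k, j)"] that(2) by (simp add: P_def)
    show "A $ j $ l / A $ lo $ lo - (if l = j then 1 else 0) \<in> W" if "A \<in> ?V" "j \<noteq> lo" for A j l
      using P[OF that(1), of "(j, l)"] that(2) by (simp add: P_def)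
  qed blast
qed

text \<open>Let \<open>a\<close> be the last diagonal entry. All ratios \<open>a / A $ i $ i\<close> are close to one, and their product
  is \<open>a ^ CARD('n)\<close> as the determinant is one; so \<open>a\<close> is bounded, and with it all entries except the corner.
  The corner entry is split off as a factor from the corner group.\<close>

lemma bounded_neighbourhood:
  obtains V C where "openin S V" "mat 1 \<in> V" "V \<subseteq> C" "compactin SL_top C"
proof -
  obtain U0 K0 :: "'a set" where U0: "open U0" "compact K0" "0 \<in> U0" "U0 \<subseteq> K0"
    using locally_compact[of 0] by blast
  define K1 where "K1 = K0 \<union> (\<lambda>x. 1 + x) ` K0"
  have "continuous_on A (\<lambda>x :: 'a. 1 + x)" for A by (intro continuous_intros)
  then have K1: "compact K1"
    unfolding K1_def using U0(2) by (intro compact_Un compact_continuous_image)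
  obtain W where W: "open W" "0 \<in> W" "\<And>x. x \<in> W \<Longrightarrow> 1 + x \<noteq> 0 \<and> x \<in> U0 \<and> inverse (1 + x) - 1 \<in> U0"
    using near_one_inverse[OF U0(1,3), of 1] unfolding eventually_nhds by auto
  obtain V where V: "openin S V" "mat 1 \<in> V" "V \<subseteq> B"
    "\<And>A k j. A \<in> V \<Longrightarrow> j \<noteq> hi \<Longrightarrow> A $ k $ j / A $ hi $ hi - (if k = j then 1 else 0) \<in> W"
    "\<And>A j l. A \<in> V \<Longrightarrow> j \<noteq> lo \<Longrightarrow> A $ j $ l / A $ lo $ lo - (if l = j then 1 else 0) \<in> W"
    using near_scalar_times_corner[OF W(1,2)] by metis
  have inK1: "x \<in> K1" if "x - (if b then 1 else 0) \<in> U0" for x b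
  proof (cases b)
    case True
    then have "x - 1 \<in> K0" using that U0(4) by auto
    then have "1 + (x - 1) \<in> (\<lambda>x. 1 + x) ` K0" by (rule imageI)
    then show ?thesis by (simp add: K1_def)
  next
    case False
    then show ?thesis using that U0(4) by (auto simp: K1_def)
  qed
  obtain D0 where D0: "compact D0" "\<And>f. (\<forall>i\<in>UNIV :: 'n set. f i \<in> K1) \<Longrightarrow> prod f UNIV \<in> D0"
    using compact_bounded_products[OF K1, of "UNIV :: 'n set"] by auto
  obtain D where D: "compact D" "\<And>x. x ^ CARD('n) \<in> D0 \<Longrightarrow> CARD('n) \<noteq> 0 \<Longrightarrow> x \<in> D"
    using bounded_of_bounded_power[OF D0(1)] by blast
  define E1 where "E1 = (\<lambda>p. fst p * snd p) ` (K1 \<times> D)"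
  define E2 where "E2 = (\<lambda>p. fst p * snd p) ` (K1 \<times> E1)"
  have E1: "compact E1" unfolding E1_def
    using K1 D(1) by (intro compact_continuous_image compact_Times continuous_intros)
  have E2: "compact E2" unfolding E2_def
    using K1 E1 by (intro compact_continuous_image compact_Times continuous_intros)
  define C where "C = insert 0 (E1 \<union> E2)"
  have C: "compact C" unfolding C_def using E1 E2 by (simp add: compact_Un)
  define M where "M = {X \<in> B. \<forall>i j. X $ i $ j \<in> C}"
  have fac: "\<exists>m\<in>M. \<exists>l\<in>corner. A = m ** l" if A: "A \<in> V" for A
  proof -
    have AB: "A \<in> B" using A V(3) by blast
    have nz: "A $ i $ i \<noteq> 0" for i using ST_diagonal_nonzero[OF B_UNIV[OF AB]] .
    let ?a = "A $ hi $ hi"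
    have "?a / A $ i $ i \<in> K1" for i
    proof -
      have "1 + (A $ i $ i / ?a - 1) \<noteq> 0 \<and> inverse (1 + (A $ i $ i / ?a - 1)) - 1 \<in> U0"
      proof (cases "i = hi")
        case True
        then show ?thesis using nz U0(3) by simp
      next
        case False
        have "A $ i $ i / ?a - 1 \<in> W" using V(4)[OF A False, of i] by simp
        from W(3)[OF this] show ?thesis by blast
      qed
      then have "?a / A $ i $ i - (if True then 1 else 0) \<in> U0" by (simp add: inverse_eq_divide)
      then show ?thesis by (rule inK1)
    qed
    then have "(\<Prod>i\<in>UNIV. ?a / A $ i $ i) \<in> D0" by (intro D0(2)) blast
    also have "(\<Prod>i\<in>UNIV. ?a / A $ i $ i) = ?a ^ CARD('n) / (\<Prod>i\<in>UNIV. A $ i $ i)"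
      by (simp add: prod_dividef)
    also have "(\<Prod>i\<in>UNIV. A $ i $ i) = det A" using AB by (intro det_upperdiagonal[symmetric]) simp
    finally have aD: "?a \<in> D" using AB by (intro D(2)) auto
    have col: "A $ k $ j \<in> E1" if "j \<noteq> hi" for k j
    proof -
      have "A $ k $ j / ?a \<in> K1" using V(4)[OF A that, of k] W(3) by (intro inK1) blast
      then have "fst (A $ k $ j / ?a, ?a) * snd (A $ k $ j / ?a, ?a) \<in> E1"
        unfolding E1_def using aD by (intro imageI) simp
      then show ?thesis using nz by simp
    qed
    have row: "A $ j $ l \<in> E2" if "j \<noteq> lo" for j l
    proof -
      have "A $ j $ l / A $ lo $ lo \<in> K1" using V(5)[OF A that, of l] W(3) by (intro inK1) blast
      then have "fst (A $ j $ l / A $ lo $ lo, A $ lo $ lo) * snd (A $ j $ l / A $ lo $ lo, A $ lo $ lo) \<in> E2"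
        unfolding E2_def using col[OF lo_ne_hi, of lo] by (intro imageI) simp
      then show ?thesis using nz by simp
    qed
    define x where "x = A $ lo $ hi / A $ lo $ lo"
    have xF: "x \<in> F" unfolding x_def by (intro F_simps(8) entry_F AB)
    define m where "m = A ** e lo hi (- x)"
    have lo0: "A $ k $ lo = 0" if "k \<noteq> lo" for k using AB that lo[of k] by simp
    have m: "m $ k $ l = (if (k, l) = (lo, hi) then 0 else A $ k $ l)" for k l
      unfolding m_def mult_transvection_entry using lo0[of k] nz by (auto simp: x_def)
    have "m $ k $ l \<in> C" for k l
      using col[of l k] row[of k l] unfolding m C_def by (cases "l = hi"; cases "k = lo") auto
    moreover have "m \<in> B" unfolding m_def by (intro B_mult AB e_B[OF lo_less_hi] F_simps(5) xF)
    ultimately have "m \<in> M" unfolding M_def by blast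
    moreover have "A = m ** e lo hi x"
      unfolding m_def matrix_mul_assoc[symmetric] transvection_add[OF lo_ne_hi] by simp
    ultimately show ?thesis using e_corner[OF xF] by blast
  qed
  obtain V0 C0 where V0: "openin S V0" "mat 1 \<in> V0" "V0 \<inter> corner \<subseteq> C0" "compactin SL_top C0"
    by (rule corner_bounded)
  have MK: "M \<subseteq> {X. det X = 1 \<and> (\<forall>i j. X $ i $ j \<in> C)}" by (auto simp: M_def)
  have MB: "M \<subseteq> B" unfolding M_def by blast
  show ?thesis
    using bounded_of_factorization[unfolded SL_sel(2,3), OF V0 V(1,2) fac MK compactin_SL[OF C] MB subgroup_corner corner_B] that
    by blast
qed

lemma residue_commutator:
  assumes g: "g \<in> residue B" and c: "c \<in> B"
  shows "g ** c ** minv g ** minv c \<in> residue B" "minv g ** c ** g ** minv c \<in> residue B"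
proof -
  have cc: "c \<in> SL_top closure_of B" using closure_of_subset[of B SL_top] c H.subset topT by auto
  have conj: "c ** h ** minv c \<in> residue B" if "h \<in> residue B" for h
    by (rule res_conj[OF subset_refl _ cc that]) (intro B_mult H.m_inv_closed)
  have ig: "minv g \<in> residue B" by (rule residue_inv[OF H.m_inv_closed g])
  have "g ** (c ** minv g ** minv c) \<in> residue B" by (rule res_mult[OF B_mult g conj[OF ig]])
  then show "g ** c ** minv g ** minv c \<in> residue B" by (simp add: matrix_mul_assoc)
  have "minv g ** (c ** g ** minv c) \<in> residue B" by (rule res_mult[OF B_mult ig conj[OF g]])
  then show "minv g ** c ** g ** minv c \<in> residue B" by (simp add: matrix_mul_assoc)
qed

lemma residue_pattern:
  assumes X: "X \<in> residue B" and P: "agree (pattern_group F P)" "\<And>i j. (i, j) \<in> P \<Longrightarrow> i < j"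
    and XP: "\<And>i j. (i, j) \<notin> P \<Longrightarrow> X $ i $ j = (if i = j then 1 else 0)"
  shows "X = mat 1"
proof -
  have "X \<in> SL_top closure_of carrier (SL F)"
  proof -
    have "B \<subseteq> carrier (SL F)" by auto
    from closure_of_mono[OF this] show ?thesis using residue_closure[OF X] by blast
  qed
  then have "X $ i $ j \<in> closure F" for i j by (rule closure_entries)
  then have "X \<in> SL_top closure_of pattern_group F P"
    unfolding pattern_group_def using P(2) XP F by (intro closure_unipotent_pattern) auto
  then show ?thesis using residue_Int_closure[OF P(1) corner_B X] by simp
qed

text \<open>The commutators of \<open>g\<close> with root elements lie in the residue and in the closure of the last column
  or first row group, so they are trivial. Thus \<open>g\<close> commutes with these root elements, which makes it scalar
  up to its corner entry. Commuting with a torus element \<open>dg a\<close> with \<open>a * a \<noteq> 1\<close> removes that entry as well.\<close>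

lemma residue_scalar:
  assumes g: "g \<in> residue B"
  shows "g = mat (g $ hi $ hi)" "(g $ hi $ hi) ^ CARD('n) = 1"
proof -
  let ?z = "g $ hi $ hi"
  have gcl: "g \<in> SL_top closure_of B" by (rule residue_closure[OF g])
  have up: "g $ i $ j = 0" if "j < i" for i j
  proof (rule ccontr)
    assume "g $ i $ j \<noteq> 0"
    then have "g \<in> {X \<in> carrier (SL UNIV). X $ i $ j \<in> - {0}}" using residue_carrier[OF g] by simp
    moreover have "openin SL_top {X \<in> carrier (SL UNIV). X $ i $ j \<in> - {0}}"
      by (intro openin_SL_entry continuous_intros)
    ultimately obtain X where "X \<in> B" "X $ i $ j \<noteq> 0" using closure_meets[OF gcl] by blast
    then show False using that by simp
  qed
  have gST: "g \<in> carrier (ST_plus UNIV)" using residue_carrier[OF g] up by simp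
  have gG: "g \<in> carrier (SL UNIV)" by (rule residue_carrier[OF g])
  have nz: "g $ i $ i \<noteq> 0" for i by (rule ST_diagonal_nonzero[OF gST])
  have col: "g $ k $ j = (if k = j then ?z else 0)" if j: "j \<noteq> hi" for k j
  proof -
    have jh: "j < hi" using j hi[of j] by simp
    let ?v = "\<lambda>k. g $ k $ j / ?z - (if k = j then 1 else 0)"
    have "column_matrix ?v \<in> residue B"
      using residue_commutator(1)[OF g e_B[OF jh F_simps(2)]] unfolding commutator_column[OF gST j] .
    moreover have "?v hi = 0" using up[OF jh] j by simp
    then have "column_matrix ?v $ i $ l = (if i = l then 1 else 0)" if "(i, l) \<notin> last_column" for i l
      using that hi[of i] unfolding column_matrix_def by (cases "l = hi") auto
    ultimately have "column_matrix ?v = mat 1"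
      by (intro residue_pattern[OF _ agree_last_column]) auto
    then have "column_matrix ?v $ k $ hi = mat 1 $ k $ hi" by simp
    then have "?v k = 0" by (auto simp: column_matrix_def mat_def split: if_splits)
    then show ?thesis using nz[of hi] by (auto simp: field_simps split: if_splits)
  qed
  have row: "g $ j $ l = (if l = j then g $ lo $ lo else 0)" if j: "j \<noteq> lo" for j l
  proof -
    have jl: "lo < j" using j lo[of j] by simp
    let ?v = "\<lambda>l. g $ j $ l / g $ lo $ lo - (if l = j then 1 else 0)"
    have "row_matrix ?v \<in> residue B"
      using residue_commutator(2)[OF g e_B[OF jl F_simps(2)]] unfolding commutator_row[OF gST j] .
    moreover have "?v lo = 0" using up[OF jl] j by simp
    then have "row_matrix ?v $ i $ k = (if i = k then 1 else 0)" if "(i, k) \<notin> first_row" for i k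
      using that lo[of k] unfolding row_matrix_def by (cases "i = lo") auto
    ultimately have "row_matrix ?v = mat 1"
      by (intro residue_pattern[OF _ agree_first_row]) auto
    then have "row_matrix ?v $ lo $ l = mat 1 $ lo $ l" by simp
    then have "?v l = 0" by (auto simp: row_matrix_def mat_def split: if_splits)
    then show ?thesis using nz[of lo] by (auto simp: field_simps split: if_splits)
  qed
  have lolo: "g $ lo $ lo = ?z" using col[OF lo_ne_hi, of lo] by simp
  have "g $ lo $ hi = 0"
  proof -
    obtain a where a: "a \<in> F" "a \<noteq> 0" "a \<noteq> inverse a" by (rule infinite_field_scalar[OF inf F])
    define y where "y = (1 - a * a) * g $ lo $ hi / ?z"
    have ent: "g $ k $ l = (if k = l then ?z else if (k, l) = (lo, hi) then g $ lo $ hi else 0)" for k l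
      using col[of l k] row[of k l] lolo lo_ne_hi by (cases "l = hi"; cases "k = lo") auto
    have dgd: "dg a $ lo $ lo = a" "dg a $ hi $ hi = inverse a" using hi_ne_lo by (simp_all add: torus_element_def)
    have "g ** dg a = e lo hi y ** dg a ** g"
      unfolding vec_eq_iff
    proof (intro allI)
      fix k l
      have hl: "g $ hi $ l = (if l = hi then ?z else 0)" using ent[of hi l] hi_ne_lo by auto
      show "(g ** dg a) $ k $ l = (e lo hi y ** dg a ** g) $ k $ l"
        unfolding matrix_mul_assoc[symmetric] transvection_mult_entry torus_element_mult hl
        using ent[of k l] dgd a(2) nz[of hi] lo_ne_hi
        by (auto simp: y_def field_simps)
    qed
    then have "g ** dg a ** minv g ** minv (dg a) = e lo hi y"
      using gG in_G[OF dg_B[OF a(1,2)]] by (intro commutator_eq)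
    then have "e lo hi y \<in> residue B" using residue_commutator(1)[OF g dg_B[OF a(1,2)]] by simp
    then have "e lo hi y = mat 1"
      by (rule residue_pattern[OF _ agree_corner]) (use lo_less_hi in \<open>auto simp: transvection_entry\<close>)
    then have "e lo hi y $ lo $ hi = mat 1 $ lo $ hi" by simp
    then have "y = 0" using lo_ne_hi by (simp add: transvection_entry mat_def)
    moreover have "1 - a * a \<noteq> 0"
    proof
      assume "1 - a * a = 0"
      then have "a * a = 1" by simp
      then show False using a(2,3) by (metis inverse_unique)
    qed
    ultimately show ?thesis using nz[of hi] by (simp add: y_def)
  qed
  then show *: "g = mat ?z"
    unfolding vec_eq_iff mat_def using col row lolo by (auto, metis+)
  have "det g = (\<Prod>i\<in>UNIV. g $ i $ i)" using up by (intro det_upperdiagonal) auto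
  also have "\<dots> = (\<Prod>i\<in>(UNIV :: 'n set). ?z)" by (subst *, simp add: mat_def)
  finally show "?z ^ CARD('n) = 1" using gG by simp
qed

text \<open>The residue is a finite central subgroup of the big group, contained in the closure of \<open>SL F\<close>, and its
  elements with entries in \<open>F\<close> are triangular, hence trivial. Minimality of \<open>SL F\<close> excludes anything else.\<close>

lemma residue_trivial:
  assumes min: "minimal_topological_group
       (SL F :: ('a ^ 'n :: {finite, wellorder} ^ 'n :: {finite, wellorder}) monoid)
       (top_of_set (carrier (SL F)))"
  shows "residue B = {mat 1}"
proof -
  have "residue B = {\<one>\<^bsub>SL UNIV\<^esub>}"
  proof (rule minimal_subgroup_meets_finite_central[OF tg_SL subgroup_SL[OF F]])
    show "minimal_topological_group ((SL UNIV)\<lparr>carrier := carrier (SL F)\<rparr>) (subtopology SL_top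
      (carrier (SL F) :: ('a ^ 'n :: {finite, wellorder} ^ 'n :: {finite, wellorder}) set))"
      using min unfolding subtopology_SL_top SL_carrier_update(1)[symmetric] .
    show "subgroup (residue B) (SL UNIV)"
    proof (rule subgroupI)
      show "residue B \<subseteq> carrier (SL UNIV)" using residue_carrier by blast
      show "residue B \<noteq> {}" using one_residue[OF H.one_closed] by blast
      show "minv a \<in> residue B" if "a \<in> residue B" for a by (rule residue_inv[OF H.m_inv_closed that])
      show "a \<otimes>\<^bsub>SL UNIV\<^esub> b \<in> residue B" if "a \<in> residue B" "b \<in> residue B" for a b
        by (rule residue_mult[OF H.m_closed that])
    qed
    have "residue B \<subseteq> mat ` {z :: 'a. z ^ CARD('n) = 1}" using residue_scalar by blast
    then show "finite (residue B)"
      by (rule finite_subset) (intro finite_imageI finite_roots_of_unity, simp)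
    show "z \<otimes>\<^bsub>SL UNIV\<^esub> x = x \<otimes>\<^bsub>SL UNIV\<^esub> z" if "z \<in> residue B" for z x
    proof -
      have "mat c ** x = x ** mat c" for c :: 'a
        unfolding vec_eq_iff matrix_matrix_mult_def mat_def
        by (simp add: if_distrib[of "\<lambda>x. x * _"] if_distrib[of "\<lambda>x. _ * x"] mult.commute cong: if_cong)
      then show ?thesis using residue_scalar(1)[OF that] unfolding SL_sel(2) by metis
    qed
    have sub: "B \<subseteq> carrier (SL F)" by auto
    show "residue B \<subseteq> SL_top closure_of carrier (SL F)"
      using residue_closure closure_of_mono[OF sub] by blast
    show "z = \<one>\<^bsub>SL UNIV\<^esub>" if z: "z \<in> residue B" "z \<in> carrier (SL F)" for z
    proof (rule residue_Int_H[OF z(1)])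
      have "z $ i $ j = 0" if "j < i" for i j
        by (subst residue_scalar(1)[OF z(1)]) (rule mat_below_diagonal[OF that])
      then show "z \<in> B" using z(2) by simp
    qed
  qed
  then show ?thesis by simp
qed

end

theorem SL_minimal_imp_ST_minimal:
  fixes F :: "'a :: local_field set" and lo hi :: "'n :: {finite, wellorder}"
  assumes F: "is_subfield F" and inf: "infinite F" and two: "(2 :: 'a) \<noteq> 0"
    and idx: "\<And>i. lo \<le> i" "\<And>i. i \<le> hi" "lo \<noteq> hi"
    and min: "minimal_topological_group
       (SL F :: ('a ^ 'n :: {finite, wellorder} ^ 'n :: {finite, wellorder}) monoid)
       (top_of_set (carrier (SL F)))"
  shows "minimal_topological_group
       (ST_plus F :: ('a ^ 'n :: {finite, wellorder} ^ 'n :: {finite, wellorder}) monoid)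
       (top_of_set (carrier (ST_plus F)))"
  unfolding minimal_topological_group_iff_coarser
proof (intro conjI allI impI topological_group_ST_plus F)
  fix S :: "('a ^ 'n :: {finite, wellorder} ^ 'n :: {finite, wellorder}) topology"
  assume S_coarser: "topological_group (ST_plus F) S \<and>
    (\<forall>U. openin S U \<longrightarrow> openin (top_of_set (carrier (ST_plus F))) U)"
  interpret coarser_on_ST F S lo hi
  proof (rule coarser_on_ST.intro[OF coarser_group_topology.intro coarser_on_ST_axioms.intro])
    show "topological_group ((SL UNIV)\<lparr>carrier := carrier (ST_plus F)\<rparr>) S"
      unfolding SL_carrier_update(2)[symmetric] using S_coarser by blast
    fix U assume "openin S U"
    then show "openin (subtopology SL_top (carrier (ST_plus F))) U"
      using S_coarser unfolding subtopology_SL_top by blast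
  qed (rule tg_SL subgroup_ST[OF F] F inf two idx)+
  obtain V C where V: "openin S V" "mat 1 \<in> V" "V \<subseteq> C" "compactin SL_top C"
    by (rule bounded_neighbourhood)
  have "agree B"
  proof (rule agree_of_compact[OF V(1) _ _ V(4)])
    show "\<one>\<^bsub>SL UNIV\<^esub> \<in> V" using V(2) by simp
    show "V \<inter> B \<subseteq> C" using V(3) by blast
    show "residue B \<subseteq> {\<one>\<^bsub>SL UNIV\<^esub>}" using residue_trivial[OF min] unfolding SL_sel(3) by blast
  qed
  then show "S = top_of_set (carrier (ST_plus F))"
    using topologies_equal subtopology_SL_top(2) by metis
qed

section \<open>The equivalence\<close>

lemma minimal_of_finite_carrier:
  assumes G: "topological_group G T" and fin: "finite (carrier G)"
  shows "minimal_topological_group G T"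
  unfolding minimal_topological_group_iff_coarser
proof (intro conjI allI impI G)
  fix S assume S: "topological_group G S \<and> (\<forall>U. openin S U \<longrightarrow> openin T U)"
  have "X = discrete_topology (carrier G)" if "topological_group G X" for X
  proof -
    have X: "topspace X = carrier G" "Hausdorff_space X" using that by (auto simp: topological_group_def)
    then show ?thesis
      using fin Hausdorff_imp_t1_space[of X] finite_t1_space_imp_discrete_topology[of X] by metis
  qed
  then show "S = T" using S G by metis
qed

theorem theorem2p7:
  fixes F :: "'a :: local_field set"
  assumes "CHAR('a) \<noteq> 2"
    and "is_subfield F"
  shows
    "minimal_topological_group
       (SL F :: ('a ^ 'n :: {finite, wellorder} ^ 'n :: {finite, wellorder}) monoid)
       (top_of_set (carrier (SL F)))
     \<longleftrightarrow>
     minimal_topological_group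
       (ST_plus F :: ('a ^ 'n :: {finite, wellorder} ^ 'n :: {finite, wellorder}) monoid)
       (top_of_set (carrier (ST_plus F)))"
proof -
  let ?SL = "SL F :: ('a ^ 'n :: {finite, wellorder} ^ 'n :: {finite, wellorder}) monoid"
  let ?ST = "ST_plus F :: ('a ^ 'n :: {finite, wellorder} ^ 'n :: {finite, wellorder}) monoid"
  define lo hi :: 'n where "lo = Min UNIV" and "hi = Max UNIV"
  have lo: "lo \<le> i" and hi: "i \<le> hi" for i by (simp_all add: lo_def hi_def)
  have two: "(2 :: 'a) \<noteq> 0"
  proof
    assume "(2 :: 'a) = 0"
    then have "of_nat 2 = (0 :: 'a)" by simp
    then have "CHAR('a) dvd 2" by (simp only: of_nat_eq_0_iff_char_dvd)
    then have "CHAR('a) \<le> 2" by (rule dvd_imp_le) simp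
    moreover have "CHAR('a) \<noteq> 0" using \<open>CHAR('a) dvd 2\<close> by (metis dvd_0_left zero_neq_numeral)
    moreover have "CHAR('a) \<noteq> 1" using CHAR_not_1[where 'a = 'a] by simp
    ultimately show False using assms(1) by simp
  qed
  consider "lo = hi" | "finite F" | "lo \<noteq> hi" "infinite F" by blast
  then show ?thesis
  proof cases
    case 1
    have "\<not> j < i" for i j :: 'n
      using lo[of i] hi[of i] lo[of j] hi[of j] 1 by auto
    then have "?ST = ?SL" by (simp add: ST_plus_def SL_def)
    then show ?thesis by simp
  next
    case 2
    have "finite {X :: 'a ^ 'n :: {finite, wellorder} ^ 'n :: {finite, wellorder}. \<forall>i j. X $ i $ j \<in> F}"
    proof -
      have "finite (PiE (UNIV :: ('n \<times> 'n) set) (\<lambda>_. F))" using 2 by (intro finite_PiE) auto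
      moreover have "{X :: 'a ^ 'n :: {finite, wellorder} ^ 'n :: {finite, wellorder}. \<forall>i j. X $ i $ j \<in> F}
        \<subseteq> (\<lambda>f. \<chi> i j. f (i, j)) ` PiE (UNIV :: ('n \<times> 'n) set) (\<lambda>_. F)"
      proof
        fix X :: "'a ^ 'n :: {finite, wellorder} ^ 'n :: {finite, wellorder}"
        assume "X \<in> {X. \<forall>i j. X $ i $ j \<in> F}"
        then show "X \<in> (\<lambda>f. \<chi> i j. f (i, j)) ` PiE (UNIV :: ('n \<times> 'n) set) (\<lambda>_. F)"
          by (intro image_eqI[of _ _ "\<lambda>p. X $ fst p $ snd p"]) (auto simp: vec_eq_iff)
      qed
      ultimately show ?thesis using finite_surj by blast
    qed
    then have "finite (carrier ?SL)" "finite (carrier ?ST)" by (auto elim: rev_finite_subset)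
    then show ?thesis
      using minimal_of_finite_carrier topological_group_SL[OF assms(2), where 'n = 'n]
        topological_group_ST_plus[OF assms(2), where 'n = 'n] by blast
  next
    case 3
    then show ?thesis
      using ST_minimal_imp_SL_minimal[OF assms(2) 3(2)]
        SL_minimal_imp_ST_minimal[OF assms(2) 3(2) two lo hi 3(1)] by blast
  qed
qed

end
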